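(* Assume there exists a function $r:\mathbb R^+\to\mathbb R^+$ such that for all $\Delta t\le r(\Delta x)$ there are solutions $\{\tilde\varphi^n\}_{n=0}^N$ (of the forward Euler scheme with a time-discrete control $\{\tilde\alpha^n\}_{n=0}^{N-1}$) and $\{\mathring\varphi^n\}_{n=0}^N$ (of the forward Euler scheme driven by an optimal control $\bar\alpha$ of the time-continuous problem), both schemes being written out in the context, with $\tilde\varphi^0=\mathring\varphi^0=\bar\varphi_0$, where $\bar\varphi_0\in V_{\Delta x}$ satisfies $$\delta\big((\bar\varphi_0)_x,v_x\big)+\delta^{-1}\big(V'(\bar\varphi_0),v\big)=0\quad\text{for all } v\in V_{\Delta x},$$ and $$\|\tilde\varphi^{n+1}_x-\tilde\varphi^n_x\|+\|\mathring\varphi^{n+1}_x-\mathring\varphi^n_x\|\le C\,\Delta t\quad\text{for all }0\le n<N,$$ where $C$ does not depend on $\Delta x$. Then $$|\tilde u(\bar\varphi_0,0)-\bar u(\bar\varphi_0,0)|\le D\,\Delta t\quad\text{for }\Delta t\le r(\Delta x),$$ where $D$ does not depend on $\Delta x$.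
   Context: Fix constants $\delta,T,K>0$. $\|\cdot\|$ and $(\cdot,\cdot)$ are the norm and inner product of $L^2(0,1)$. The potential $V:\mathbb R\to\mathbb R$ is smooth, equals $\frac14(\varphi^2-1)^2$ on an interval $[-s,s]$ ($s$ large), and is modified outside $[-s,s]$ so that $V',V'',V'''$ (and arbitrarily many further derivatives) are bounded on $\mathbb R$. $\varphi_-$ is the negative one of the two stable critical points minimizing the energy $\int_0^1\big(\frac{\delta}{2}\varphi_x^2+\delta^{-1}V(\varphi)\big)dx$ under zero Dirichlet boundary conditions. Let $h(\alpha)=\|\alpha\|^2/2$ and $g(\varphi)=K\|\varphi-\varphi_-\|^2$. For $M\in\mathbb N$, $\Delta x=1/M$, $V_{\Delta x}$ is the space of continuous functions on $[0,1]$ that vanish at $0$ and $1$ and are linear on each interval $(i\Delta x,(i+1)\Delta x)$. Time-continuous, space-discrete value function: for $\bar\varphi_0\in V_{\Delta x}$, $$\bar u(\bar\varphi_0,t_0)=\inf_{\bar\alpha\in L^2(t_0,T;V_{\Delta x})}\Big\{g(\bar\varphi(T))+\int_{t_0}^T h(\bar\alpha)\,ds\Big\},$$ where $\bar\varphi\in C([t_0,T];V_{\Delta x})$ solves $(\bar\varphi_t,v)=-\delta(\bar\varphi_x,v_x)+(-\delta^{-1}V'(\bar\varphi)+\bar\alpha,v)$ for all $v\in V_{\Delta x}$, $\bar\varphi(t_0)=\bar\varphi_0$. The infimum is attained. An optimal control satisfies $\bar\alpha=-\bar\lambda$, where $\bar\lambda$ solves $-(\bar\lambda_t,v)=-\delta(\bar\lambda_x,v_x)-\delta^{-1}(\bar\lambda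 V''(\bar\varphi),v)$ for all $v\in V_{\Delta x}$, $\bar\lambda(T)=2K(\bar\varphi(T)-P\varphi_-)$ ($P$ the $L^2$ projection onto $V_{\Delta x}$), so point values $\bar\alpha(t)$ make sense. Time discretization: $\Delta t=T/N$, $t_n=n\Delta t$. For a time-discrete control $\{\tilde\alpha^n\}_{n=0}^{N-1}\subset V_{\Delta x}$, the time-discrete state $\{\tilde\varphi^n\}_{n=0}^N\subset V_{\Delta x}$ is given by $$(\tilde\varphi^{n+1},v)=(\tilde\varphi^n,v)+\Delta t\big(-\delta(\tilde\varphi^n_x,v_x)+(-\delta^{-1}V'(\tilde\varphi^n)+\tilde\alpha^n,v)\big)\quad\text{for all }v\in V_{\Delta x}.$$ The fully discrete value function is $$\tilde u(\tilde\varphi_0,t_m)=\min_{\{\tilde\alpha^n\}_{n=m}^{N-1}}\Big(g(\tilde\varphi^N)+\Delta t\sum_{n=m}^{N-1}h(\tilde\alpha^n)\Big),$$ where $\{\tilde\varphi^n\}$ solves the preceding scheme with $\tilde\varphi^m=\tilde\varphi_0$. The discrete state $\{\mathring\varphi^n\}_{n=0}^N\subset V_{\Delta x}$ is given by $$(\mathring\varphi^{n+1},v)=(\mathring\varphi^n,v)+\Delta t\big(-\delta(\mathring\varphi^n_x,v_x)+(-\delta^{-1}V'(\mathring\varphi^n)+\bar\alpha(t_n),v)\big)\quad\text{for all }v\in V_{\Delta x},$$ where $\bar\alpha$ is an optimal control for the time-continuous problem defining $\bar u(\bar\varphi_0,0)$.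
   Formalization: The solution of the forward Euler scheme with a time-discrete control is taken to be the state of a minimizing control for the fully discrete value function; for merely some control the bound on it is void (zero control keeps the stationary datum) and the estimate fails near the stability limit. *)

theory Defs
  imports "HOL-Analysis.Analysis"
begin

text \<open>Inner product and norm of \<open>L\<^sup>2(0,1)\<close>. The spatial derivative of a piecewise linear function
  is \<^term>\<open>deriv v\<close>, whose (unspecified) values at the finitely many kinks do not affect integrals.\<close>

definition ip :: "(real \<Rightarrow> real) \<Rightarrow> (real \<Rightarrow> real) \<Rightarrow> real" where
  "ip u v = (LINT x:{0..1}|lborel. u x * v x)"

definition l2norm :: "(real \<Rightarrow> real) \<Rightarrow> real" where
  "l2norm u = sqrt (ip u u)"

text \<open>The potential: smooth, equal to the double well on \<open>[-s,s]\<close>, with every derivative of order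
  at least one bounded. The condition \<open>s > 1\<close> puts both wells into that interval.\<close>

definition modified_double_well :: "real \<Rightarrow> (real \<Rightarrow> real) \<Rightarrow> bool" where
  "modified_double_well s V \<longleftrightarrow>
     s > 1 \<and>
     (\<forall>k x. (deriv ^^ k) V field_differentiable (at x)) \<and>
     (\<forall>x\<in>{-s..s}. V x = (x\<^sup>2 - 1)\<^sup>2 / 4) \<and>
     (\<forall>k\<ge>1. bounded (range ((deriv ^^ k) V)))"

text \<open>\<open>h10 u w\<close>: \<open>u\<close> belongs to \<open>H\<^sup>1(0,1)\<close>, vanishes at \<open>0\<close> and \<open>1\<close>, and has weak derivative \<open>w\<close>.\<close>

definition h10 :: "(real \<Rightarrow> real) \<Rightarrow> (real \<Rightarrow> real) \<Rightarrow> bool" where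
  "h10 u w \<longleftrightarrow>
     set_borel_measurable lborel {0..1} w \<and>
     set_integrable lborel {0..1} (\<lambda>x. (w x)\<^sup>2) \<and>
     (\<forall>x\<in>{0..1}. u x = (LINT y:{0..x}|lborel. w y)) \<and> u 1 = 0"

definition energy :: "real \<Rightarrow> (real \<Rightarrow> real) \<Rightarrow> (real \<Rightarrow> real) \<Rightarrow> (real \<Rightarrow> real) \<Rightarrow> real" where
  "energy \<delta> V u w = (LINT x:{0..1}|lborel. \<delta> / 2 * (w x)\<^sup>2 + V (u x) / \<delta>)"

definition negative_minimizer :: "real \<Rightarrow> (real \<Rightarrow> real) \<Rightarrow> (real \<Rightarrow> real) \<Rightarrow> bool" where
  "negative_minimizer \<delta> V \<phi>m \<longleftrightarrow>
     (\<exists>w. h10 \<phi>m w \<and> (\<forall>u z. h10 u z \<longrightarrow> energy \<delta> V \<phi>m w \<le> energy \<delta> V u z)) \<and>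
     (\<forall>x\<in>{0<..<1}. \<phi>m x < 0)"

definition h_cost :: "(real \<Rightarrow> real) \<Rightarrow> real" where
  "h_cost a = (l2norm a)\<^sup>2 / 2"

definition g_cost :: "real \<Rightarrow> (real \<Rightarrow> real) \<Rightarrow> (real \<Rightarrow> real) \<Rightarrow> real" where
  "g_cost K \<phi>m u = K * (l2norm (\<lambda>x. u x - \<phi>m x))\<^sup>2"

text \<open>The finite element space for mesh size \<open>1/M\<close>. Its members are extended by zero to the
  real line, so that they are determined by their values on \<open>[0,1]\<close>.\<close>

definition fem_space :: "nat \<Rightarrow> (real \<Rightarrow> real) set" where
  "fem_space M = {v. continuous_on {0..1} v \<and> v 0 = 0 \<and> v 1 = 0 \<and>
     (\<forall>i<M. \<exists>a b. \<forall>x\<in>{real i / real M<..<real (Suc i) / real M}. v x = a * x + b) \<and>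
     (\<forall>x. x \<notin> {0..1} \<longrightarrow> v x = 0)}"

text \<open>The weak form \<open>-\<delta>(u\<^sub>x,v\<^sub>x) + (-\<delta>\<inverse>V'(u) + a, v)\<close> of the controlled right-hand side.\<close>

definition flux :: "real \<Rightarrow> (real \<Rightarrow> real) \<Rightarrow> (real \<Rightarrow> real) \<Rightarrow> (real \<Rightarrow> real) \<Rightarrow> (real \<Rightarrow> real) \<Rightarrow> real" where
  "flux \<delta> V u a v = - \<delta> * ip (deriv u) (deriv v) + ip (\<lambda>x. - deriv V (u x) / \<delta> + a x) v"

definition discrete_stationary :: "real \<Rightarrow> (real \<Rightarrow> real) \<Rightarrow> nat \<Rightarrow> (real \<Rightarrow> real) \<Rightarrow> bool" where
  "discrete_stationary \<delta> V M u \<longleftrightarrow> u \<in> fem_space M \<and>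
     (\<forall>v\<in>fem_space M. \<delta> * ip (deriv u) (deriv v) + ip (\<lambda>x. deriv V (u x)) v / \<delta> = 0)"

text \<open>Time-dependent elements of the finite element space are written \<open>f t x\<close>, with \<open>t\<close> the time.
  As the space is finite-dimensional, measurability of a space-valued map is measurability of
  its point evaluations.\<close>

definition L2_time :: "nat \<Rightarrow> real \<Rightarrow> real \<Rightarrow> (real \<Rightarrow> real \<Rightarrow> real) set" where
  "L2_time M t0 T = {\<alpha>. (\<forall>t\<in>{t0..T}. \<alpha> t \<in> fem_space M) \<and>
     (\<forall>x\<in>{0..1}. set_borel_measurable lborel {t0..T} (\<lambda>t. \<alpha> t x)) \<and>
     set_integrable lborel {t0..T} (\<lambda>t. (l2norm (\<alpha> t))\<^sup>2)}"

definition C_time :: "nat \<Rightarrow> real \<Rightarrow> real \<Rightarrow> (real \<Rightarrow> real \<Rightarrow> real) set" where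
  "C_time M t0 T = {\<phi>. (\<forall>t\<in>{t0..T}. \<phi> t \<in> fem_space M) \<and>
     (\<forall>t\<in>{t0..T}. ((\<lambda>s. l2norm (\<lambda>x. \<phi> s x - \<phi> t x)) \<longlongrightarrow> 0) (at t within {t0..T}))}"

text \<open>Solutions of the semidiscrete equation are understood in the Caratheodory sense (the control is
  only square integrable in time), i.e. through the equation integrated in time.\<close>

definition semidiscrete_state ::
  "real \<Rightarrow> real \<Rightarrow> (real \<Rightarrow> real) \<Rightarrow> nat \<Rightarrow> (real \<Rightarrow> real) \<Rightarrow> real \<Rightarrow>
   (real \<Rightarrow> real \<Rightarrow> real) \<Rightarrow> (real \<Rightarrow> real \<Rightarrow> real) \<Rightarrow> bool" where
  "semidiscrete_state \<delta> T V M \<phi>0 t0 \<alpha> \<phi> \<longleftrightarrow>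
     \<phi> \<in> C_time M t0 T \<and> \<phi> t0 = \<phi>0 \<and>
     (\<forall>v\<in>fem_space M. \<forall>t\<in>{t0..T}.
        ip (\<phi> t) v = ip \<phi>0 v + (LINT s:{t0..t}|lborel. flux \<delta> V (\<phi> s) (\<alpha> s) v))"

definition semidiscrete_cost ::
  "real \<Rightarrow> real \<Rightarrow> (real \<Rightarrow> real) \<Rightarrow> real \<Rightarrow> (real \<Rightarrow> real \<Rightarrow> real) \<Rightarrow> (real \<Rightarrow> real \<Rightarrow> real) \<Rightarrow> real" where
  "semidiscrete_cost T K \<phi>m t0 \<alpha> \<phi> = g_cost K \<phi>m (\<phi> T) + (LINT s:{t0..T}|lborel. h_cost (\<alpha> s))"

definition u_bar ::
  "real \<Rightarrow> real \<Rightarrow> real \<Rightarrow> (real \<Rightarrow> real) \<Rightarrow> (real \<Rightarrow> real) \<Rightarrow> nat \<Rightarrow> (real \<Rightarrow> real) \<Rightarrow> real \<Rightarrow> real" where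
  "u_bar \<delta> T K V \<phi>m M \<phi>0 t0 =
     Inf {semidiscrete_cost T K \<phi>m t0 \<alpha> \<phi> | \<alpha> \<phi>.
            \<alpha> \<in> L2_time M t0 T \<and> semidiscrete_state \<delta> T V M \<phi>0 t0 \<alpha> \<phi>}"

text \<open>Point values of an optimal control, an element of \<open>L\<^sup>2\<close> in time, are those of its continuous
  representative.\<close>

definition optimal_semidiscrete_control ::
  "real \<Rightarrow> real \<Rightarrow> real \<Rightarrow> (real \<Rightarrow> real) \<Rightarrow> (real \<Rightarrow> real) \<Rightarrow> nat \<Rightarrow> (real \<Rightarrow> real) \<Rightarrow> real \<Rightarrow>
   (real \<Rightarrow> real \<Rightarrow> real) \<Rightarrow> bool" where
  "optimal_semidiscrete_control \<delta> T K V \<phi>m M \<phi>0 t0 \<alpha> \<longleftrightarrow>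
     \<alpha> \<in> L2_time M t0 T \<and> \<alpha> \<in> C_time M t0 T \<and>
     (\<exists>\<phi>. semidiscrete_state \<delta> T V M \<phi>0 t0 \<alpha> \<phi> \<and>
          semidiscrete_cost T K \<phi>m t0 \<alpha> \<phi> = u_bar \<delta> T K V \<phi>m M \<phi>0 t0)"

text \<open>Forward Euler with step \<open>T/N\<close>, started at time index \<open>m\<close>.\<close>

definition euler_state ::
  "real \<Rightarrow> real \<Rightarrow> (real \<Rightarrow> real) \<Rightarrow> nat \<Rightarrow> nat \<Rightarrow> (real \<Rightarrow> real) \<Rightarrow> nat \<Rightarrow>
   (nat \<Rightarrow> real \<Rightarrow> real) \<Rightarrow> (nat \<Rightarrow> real \<Rightarrow> real) \<Rightarrow> bool" where
  "euler_state \<delta> T V M N \<phi>0 m \<alpha> \<phi> \<longleftrightarrow>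
     (\<forall>n\<in>{m..N}. \<phi> n \<in> fem_space M) \<and> \<phi> m = \<phi>0 \<and>
     (\<forall>n\<in>{m..<N}. \<forall>v\<in>fem_space M.
        ip (\<phi> (Suc n)) v = ip (\<phi> n) v + T / real N * flux \<delta> V (\<phi> n) (\<alpha> n) v)"

definition discrete_controls :: "nat \<Rightarrow> nat \<Rightarrow> nat \<Rightarrow> (nat \<Rightarrow> real \<Rightarrow> real) set" where
  "discrete_controls M N m = {\<alpha>. \<forall>n\<in>{m..<N}. \<alpha> n \<in> fem_space M}"

definition discrete_cost ::
  "real \<Rightarrow> real \<Rightarrow> (real \<Rightarrow> real) \<Rightarrow> nat \<Rightarrow> nat \<Rightarrow> (nat \<Rightarrow> real \<Rightarrow> real) \<Rightarrow> (nat \<Rightarrow> real \<Rightarrow> real) \<Rightarrow> real" where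
  "discrete_cost T K \<phi>m N m \<alpha> \<phi> = g_cost K \<phi>m (\<phi> N) + T / real N * (\<Sum>n=m..<N. h_cost (\<alpha> n))"

definition u_tilde ::
  "real \<Rightarrow> real \<Rightarrow> real \<Rightarrow> (real \<Rightarrow> real) \<Rightarrow> (real \<Rightarrow> real) \<Rightarrow> nat \<Rightarrow> nat \<Rightarrow> (real \<Rightarrow> real) \<Rightarrow> nat \<Rightarrow> real" where
  "u_tilde \<delta> T K V \<phi>m M N \<phi>0 m =
     Inf {discrete_cost T K \<phi>m N m \<alpha> \<phi> | \<alpha> \<phi>.
            \<alpha> \<in> discrete_controls M N m \<and> euler_state \<delta> T V M N \<phi>0 m \<alpha> \<phi>}"

definition optimal_discrete_pair ::
  "real \<Rightarrow> real \<Rightarrow> real \<Rightarrow> (real \<Rightarrow> real) \<Rightarrow> (real \<Rightarrow> real) \<Rightarrow> nat \<Rightarrow> nat \<Rightarrow> (real \<Rightarrow> real) \<Rightarrow> nat \<Rightarrow>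
   (nat \<Rightarrow> real \<Rightarrow> real) \<Rightarrow> (nat \<Rightarrow> real \<Rightarrow> real) \<Rightarrow> bool" where
  "optimal_discrete_pair \<delta> T K V \<phi>m M N \<phi>0 m \<alpha> \<phi> \<longleftrightarrow>
     \<alpha> \<in> discrete_controls M N m \<and> euler_state \<delta> T V M N \<phi>0 m \<alpha> \<phi> \<and>
     discrete_cost T K \<phi>m N m \<alpha> \<phi> = u_tilde \<delta> T K V \<phi>m M N \<phi>0 m"

end

theory Submission
  imports Defs "HOL-Probability.Discrete_Topology"
begin

text \<open>The value functions are compared by transferring controls, once in each direction. A control of
  one problem is used in the other, and an energy estimate compares the two resulting states. The
  difference \<open>w\<close> between the semidiscrete state and the time interpolant of the Euler state satisfies
  an equation in which the stiffness form is evaluated at an Euler node instead of at the current time.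
  Tested with \<open>w\<close>, this form yields the dissipation \<open>\<delta> (w\<^sub>x, w\<^sub>x)\<close> and a term in the
  Euler increment \<open>\<phi>\<^sup>n\<^sup>+\<^sup>1 - \<phi>\<^sup>n\<close>, whose \<open>H\<^sup>1\<close> seminorm is at most \<open>C \<Delta>t\<close> by hypothesis and is absorbed by the
  dissipation. So no power of the mesh size enters, and a Gronwall argument over the time cells gives
  an error of order \<open>\<Delta>t\<close> in \<open>L\<^sup>2\<close> at the final time (\<open>euler_error\<close>). The final costs
  then differ by \<open>O(\<Delta>t)\<close> because the final states are bounded uniformly in the mesh: the initial
  value is stationary, so the zero control bounds both value functions by the final cost of the
  initial value.

  To bound the semidiscrete value by the discrete one (\<open>u_bar_le_u_tilde\<close>), the optimal discrete control
  is extended to be constant on time cells. The running costs agree exactly, and the two controls in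
  the energy estimate coincide. The semidiscrete state for this control exists by a Picard argument.

  To bound the discrete value by the semidiscrete one (\<open>u_tilde_le_u_bar\<close>), the optimal control \<open>\<alpha>\<close> is
  sampled at the time nodes, and its regularity in time is needed. It comes from the first-order
  condition, that \<open>-\<alpha>\<close> solves the adjoint equation. This is derived by varying the state: any
  perturbation \<open>\<eta>(t) v\<close> with \<open>\<eta>(0) = 0\<close> leads to a state again, for an explicit control
  (\<open>first_variation\<close>). By the adjoint equation the squared norm of \<open>\<alpha>\<close>, corrected by a linear
  function of time, is nondecreasing, and it grows at least at the rate \<open>2 \<delta> (\<alpha>\<^sub>x, \<alpha>\<^sub>x)\<close>. Monotonicity bounds the
  quadrature error of the running cost from the required side. The growth over a time cell bounds the change of
  \<open>\<alpha>\<close> in the dual \<open>H\<^sup>1\<close> norm (\<open>control_modulus\<close>), which is the norm that the dissipation can absorb;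
  summed over the cells the growth telescopes, and its total is bounded by the \<open>L\<^sup>2\<close> norm of the final
  datum of the adjoint equation.\<close>

section \<open>The bilinear form on bounded measurable functions\<close>

text \<open>Every spatial function of the argument (finite element functions, their derivatives, smooth
  functions of them, the target) is bounded and measurable on the unit interval. This class is an
  algebra of integrable functions, so on it \<^const>\<open>ip\<close> is bilinear.\<close>

definition bdm :: "(real \<Rightarrow> real) set" where
  "bdm = {f. set_borel_measurable lborel {0..1} f \<and> (\<exists>B. \<forall>x\<in>{0..1}. \<bar>f x\<bar> \<le> B)}"

lemma bdmI:
  "set_borel_measurable lborel {0..1} f \<Longrightarrow> (\<And>x. x \<in> {0..1} \<Longrightarrow> \<bar>f x\<bar> \<le> B) \<Longrightarrow> f \<in> bdm"
  unfolding bdm_def by blast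

lemma bdm_const [simp]: "(\<lambda>x. c) \<in> bdm"
  by (rule bdmI[of _ "\<bar>c\<bar>"]) (auto simp: set_borel_measurable_def)

lemma bdm_add [simp]:
  assumes "f \<in> bdm" "g \<in> bdm" shows "(\<lambda>x. f x + g x) \<in> bdm"
proof -
  obtain B where B: "\<forall>x\<in>{0..1}. \<bar>f x\<bar> \<le> B" using assms(1) by (auto simp: bdm_def)
  obtain B' where B': "\<forall>x\<in>{0..1}. \<bar>g x\<bar> \<le> B'" using assms(2) by (auto simp: bdm_def)
  have [measurable]: "(\<lambda>x. indicator {0..1} x *\<^sub>R f x) \<in> borel_measurable lborel"
    "(\<lambda>x. indicator {0..1} x *\<^sub>R g x) \<in> borel_measurable lborel"
    using assms by (auto simp: bdm_def set_borel_measurable_def)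
  have "set_borel_measurable lborel {0..1} (\<lambda>x. f x + g x)"
    unfolding set_borel_measurable_def scaleR_add_right by measurable
  then show ?thesis
    by (rule bdmI[of _ "B + B'"]) (use B B' in force)
qed

lemma bdm_mult [simp]:
  assumes "f \<in> bdm" "g \<in> bdm" shows "(\<lambda>x. f x * g x) \<in> bdm"
proof -
  obtain B where B: "\<forall>x\<in>{0..1}. \<bar>f x\<bar> \<le> B" using assms(1) by (auto simp: bdm_def)
  obtain B' where B': "\<forall>x\<in>{0..1}. \<bar>g x\<bar> \<le> B'" using assms(2) by (auto simp: bdm_def)
  have [measurable]: "(\<lambda>x. indicator {0..1} x *\<^sub>R f x) \<in> borel_measurable lborel"
    "(\<lambda>x. indicator {0..1} x *\<^sub>R g x) \<in> borel_measurable lborel"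
    using assms by (auto simp: bdm_def set_borel_measurable_def)
  have "(\<lambda>x. indicator {0..1} x *\<^sub>R (f x * g x)) =
      (\<lambda>x. (indicator {0..1} x *\<^sub>R f x) * (indicator {0..1} x *\<^sub>R g x))"
    by (auto simp: fun_eq_iff indicator_def)
  then have "set_borel_measurable lborel {0..1} (\<lambda>x. f x * g x)"
    unfolding set_borel_measurable_def by (simp only:) measurable
  moreover have "\<bar>f x * g x\<bar> \<le> B * B'" if "x \<in> {0..1}" for x
    unfolding abs_mult using B B' that
    by (intro mult_mono) (auto intro: order_trans[OF abs_ge_zero])
  ultimately show ?thesis by (rule bdmI)
qed

lemma bdm_uminus [simp]: "f \<in> bdm \<Longrightarrow> (\<lambda>x. - f x) \<in> bdm"
  using bdm_mult[OF bdm_const[of "-1"]] by simp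

lemma bdm_diff [simp]: "f \<in> bdm \<Longrightarrow> g \<in> bdm \<Longrightarrow> (\<lambda>x. f x - g x) \<in> bdm"
  using bdm_add[OF _ bdm_uminus] by simp

lemma bdm_divide [simp]: "f \<in> bdm \<Longrightarrow> (\<lambda>x. f x / c) \<in> bdm"
  using bdm_mult[OF _ bdm_const[of "1/c"]] by simp

lemma bdm_sum [simp]: "(\<And>i. i \<in> I \<Longrightarrow> f i \<in> bdm) \<Longrightarrow> (\<lambda>x. \<Sum>i\<in>I. f i x) \<in> bdm"
  by (induction I rule: infinite_finite_induct) auto

lemma bdm_comp:
  assumes "f \<in> bdm" "continuous_on UNIV F" "\<And>x. \<bar>F x\<bar> \<le> B"
  shows "(\<lambda>x. F (f x)) \<in> bdm"
proof -
  have [measurable]: "(\<lambda>x. indicator {0..1} x *\<^sub>R f x) \<in> borel_measurable lborel"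
    using assms by (auto simp: bdm_def set_borel_measurable_def)
  have [measurable]: "F \<in> borel_measurable borel"
    using assms(2) by (rule borel_measurable_continuous_onI)
  have "(\<lambda>x. indicator {0..1} x *\<^sub>R F (f x)) =
      (\<lambda>x. indicator {0..1} x *\<^sub>R F (indicator {0..1} x *\<^sub>R f x))"
    by (auto simp: fun_eq_iff indicator_def)
  moreover have "(\<lambda>x. indicator {0..1} x *\<^sub>R F (indicator {0..1} x *\<^sub>R f x)) \<in> borel_measurable lborel"
    by measurable
  ultimately have "set_borel_measurable lborel {0..1} (\<lambda>x. F (f x))"
    unfolding set_borel_measurable_def by simp
  then show ?thesis by (rule bdmI) (rule assms(3))
qed

lemma bdm_continuous: "continuous_on {0..1} f \<Longrightarrow> f \<in> bdm"
proof -
  assume f: "continuous_on {0..1} f"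
  then have "bounded (f ` {0..1})"
    by (intro compact_imp_bounded compact_continuous_image) auto
  then obtain B where "\<forall>x\<in>{0..1}. \<bar>f x\<bar> \<le> B" by (auto simp: bounded_iff)
  moreover have "set_borel_measurable lborel {0..1} f"
    using borel_integrable_atLeastAtMost'[OF f]
    by (auto simp: set_integrable_def set_borel_measurable_def)
  ultimately show ?thesis by (auto simp: bdm_def)
qed

lemma bdm_borel: "f \<in> borel_measurable borel \<Longrightarrow> bounded (range f) \<Longrightarrow> f \<in> bdm"
  by (auto simp: bdm_def set_borel_measurable_def bounded_iff)

lemma bdm_integrable [simp]: "f \<in> bdm \<Longrightarrow> set_integrable lborel {0..1} f"
proof -
  assume f: "f \<in> bdm"
  obtain B where B: "\<forall>x\<in>{0..1}. \<bar>f x\<bar> \<le> B" using f by (auto simp: bdm_def)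
  show ?thesis unfolding set_integrable_def
    by (rule integrableI_bounded_set[where A="{0..1}" and B=B])
      (use f B in \<open>auto simp: bdm_def set_borel_measurable_def\<close>)
qed

lemma ip_commute: "ip u v = ip v u"
  by (simp add: ip_def mult.commute)

lemma ip_add_left:
  "u \<in> bdm \<Longrightarrow> v \<in> bdm \<Longrightarrow> w \<in> bdm \<Longrightarrow> ip (\<lambda>x. u x + v x) w = ip u w + ip v w"
  by (simp add: ip_def distrib_right set_integral_add)

lemma ip_scale_left: "ip (\<lambda>x. c * u x) w = c * ip u w"
  by (simp add: ip_def mult.assoc)

lemma ip_diff_left:
  "u \<in> bdm \<Longrightarrow> v \<in> bdm \<Longrightarrow> w \<in> bdm \<Longrightarrow> ip (\<lambda>x. u x - v x) w = ip u w - ip v w"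
  by (simp add: ip_def left_diff_distrib set_integral_diff)

lemma ip_divide_left: "ip (\<lambda>x. u x / c) w = ip u w / c"
  using ip_scale_left[of "1/c" u w] by simp

lemma ip_uminus_left: "ip (\<lambda>x. - u x) w = - ip u w"
  using ip_scale_left[of "-1" u w] by simp

lemma ip_zero_left [simp]: "ip (\<lambda>x. 0) w = 0"
  by (simp add: ip_def)

lemma ip_sum_left:
  "(\<And>i. i \<in> I \<Longrightarrow> u i \<in> bdm) \<Longrightarrow> w \<in> bdm \<Longrightarrow> ip (\<lambda>x. \<Sum>i\<in>I. u i x) w = (\<Sum>i\<in>I. ip (u i) w)"
  by (induction I rule: infinite_finite_induct) (auto simp: ip_add_left)

lemma bdm_lincomb: "(\<And>i. i \<in> I \<Longrightarrow> u i \<in> bdm) \<Longrightarrow> (\<lambda>x. \<Sum>i\<in>I. c i * u i x) \<in> bdm"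
  by (rule bdm_sum) (rule bdm_mult[OF bdm_const])

lemma ip_lincomb_left:
  assumes "\<And>i. i \<in> I \<Longrightarrow> u i \<in> bdm" "w \<in> bdm"
  shows "ip (\<lambda>x. \<Sum>i\<in>I. c i * u i x) w = (\<Sum>i\<in>I. c i * ip (u i) w)"
  using assms ip_sum_left[of I "\<lambda>i x. c i * u i x" w] bdm_mult[OF bdm_const]
  by (simp add: ip_scale_left)

lemma ip_add_right:
  "u \<in> bdm \<Longrightarrow> v \<in> bdm \<Longrightarrow> w \<in> bdm \<Longrightarrow> ip w (\<lambda>x. u x + v x) = ip w u + ip w v"
  using ip_add_left ip_commute by metis

lemma ip_scale_right: "ip w (\<lambda>x. c * u x) = c * ip w u"
  using ip_scale_left ip_commute by metis

lemma ip_diff_right: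
  "u \<in> bdm \<Longrightarrow> v \<in> bdm \<Longrightarrow> w \<in> bdm \<Longrightarrow> ip w (\<lambda>x. u x - v x) = ip w u - ip w v"
  using ip_diff_left ip_commute by metis

lemma ip_zero_right [simp]: "ip w (\<lambda>x. 0) = 0"
  by (simp add: ip_def)

lemmas ip_linear = ip_add_left ip_add_right ip_diff_left ip_diff_right ip_scale_left ip_scale_right
  ip_uminus_left ip_divide_left

lemma ip_self_nonneg [simp]: "0 \<le> ip u u"
  unfolding ip_def set_lebesgue_integral_def by (intro integral_nonneg_AE) auto

lemma l2norm_nonneg [simp]: "0 \<le> l2norm u"
  by (simp add: l2norm_def)

lemma l2norm_sq: "(l2norm u)\<^sup>2 = ip u u"
  by (simp add: l2norm_def)

lemma ip_mono:
  assumes "u \<in> bdm" "v \<in> bdm" "w \<in> bdm" "z \<in> bdm" "\<And>x. x \<in> {0..1} \<Longrightarrow> u x * v x \<le> w x * z x"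
  shows "ip u v \<le> ip w z"
  unfolding ip_def using assms by (intro set_integral_mono) auto

text \<open>For \<open>X, Z > 0\<close> the right-hand side is smallest at \<open>\<mu> = (Z / X)\<^sup>1\<^sup>/\<^sup>2\<close>, with value \<open>2 (X Z)\<^sup>1\<^sup>/\<^sup>2\<close>. The choice
  \<open>\<mu> = y / X\<close> below avoids the root. The lemma gives the Cauchy--Schwarz inequality, and later its
  analogue for quantities integrated in time.\<close>

lemma sq_le_of_scaled:
  fixes y X Z :: real
  assumes "X \<ge> 0" "Z \<ge> 0" "\<And>\<mu>. \<mu> > 0 \<Longrightarrow> 2 * y \<le> \<mu> * X + Z / \<mu>" "y \<ge> 0"
  shows "y\<^sup>2 \<le> X * Z"
proof (rule ccontr)
  assume "\<not> ?thesis"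
  then have lt: "X * Z < y\<^sup>2" by simp
  then have "y\<^sup>2 > 0" using mult_nonneg_nonneg[OF assms(1,2)] by linarith
  then have "y > 0" using assms(4) by (simp add: less_le)
  show False
  proof (cases "X = 0")
    case True
    have "2 * y \<le> Z / ((Z + 1) / y)"
      using assms(3)[of "(Z + 1) / y"] True \<open>y > 0\<close> assms(2) by (simp add: zero_less_divide_iff)
    also have "\<dots> = y * (Z / (Z + 1))" by simp
    also have "\<dots> \<le> y * 1" using \<open>y > 0\<close> assms(2) by (intro mult_left_mono) (auto simp: divide_simps)
    finally show False using \<open>y > 0\<close> by simp
  next
    case False
    then have X: "X > 0" using assms(1) by simp
    have "2 * y \<le> (y / X) * X + Z / (y / X)" using assms(3)[of "y / X"] \<open>y > 0\<close> X by simp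
    then have "y \<le> Z * X / y" using X by simp
    then have "y\<^sup>2 \<le> Z * X" using \<open>y > 0\<close> by (simp add: field_simps power2_eq_square)
    with lt show False by (simp add: mult.commute)
  qed
qed

lemma Cauchy_Schwarz_ip_sq:
  assumes "u \<in> bdm" "v \<in> bdm" shows "(ip u v)\<^sup>2 \<le> ip u u * ip v v"
proof -
  have "2 * \<bar>ip u v\<bar> \<le> \<mu> * ip u u + ip v v / \<mu>" if "\<mu> > 0" for \<mu>
  proof -
    have "0 \<le> ip (\<lambda>x. \<mu> * u x - v x) (\<lambda>x. \<mu> * u x - v x)" by simp
    also have "\<dots> = \<mu> * (\<mu> * ip u u - 2 * ip u v) + ip v v"
      using assms by (simp add: ip_linear ip_commute[of v u] algebra_simps)
    finally have 1: "2 * ip u v \<le> \<mu> * ip u u + ip v v / \<mu>"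
      using that by (simp add: field_simps)
    have "0 \<le> ip (\<lambda>x. \<mu> * u x + v x) (\<lambda>x. \<mu> * u x + v x)" by simp
    also have "\<dots> = \<mu> * (\<mu> * ip u u + 2 * ip u v) + ip v v"
      using assms by (simp add: ip_linear ip_commute[of v u] algebra_simps)
    finally have "- 2 * ip u v \<le> \<mu> * ip u u + ip v v / \<mu>"
      using that by (simp add: field_simps)
    with 1 show ?thesis by linarith
  qed
  then have "\<bar>ip u v\<bar>\<^sup>2 \<le> ip u u * ip v v" by (intro sq_le_of_scaled) auto
  then show ?thesis by simp
qed

lemma Cauchy_Schwarz_ip:
  assumes "u \<in> bdm" "v \<in> bdm" shows "\<bar>ip u v\<bar> \<le> l2norm u * l2norm v"
proof (rule power2_le_imp_le)
  show "\<bar>ip u v\<bar>\<^sup>2 \<le> (l2norm u * l2norm v)\<^sup>2"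
    using Cauchy_Schwarz_ip_sq[OF assms] by (simp add: power_mult_distrib l2norm_sq)
qed simp

lemma l2norm_triangle:
  assumes "u \<in> bdm" "v \<in> bdm" shows "l2norm (\<lambda>x. u x + v x) \<le> l2norm u + l2norm v"
proof (rule power2_le_imp_le)
  have "(l2norm (\<lambda>x. u x + v x))\<^sup>2 = (l2norm u)\<^sup>2 + (l2norm v)\<^sup>2 + 2 * ip u v"
    unfolding l2norm_sq using assms by (simp add: ip_linear ip_commute[of v u])
  also have "\<dots> \<le> (l2norm u + l2norm v)\<^sup>2"
    using Cauchy_Schwarz_ip[OF assms] by (simp add: power2_sum)
  finally show "(l2norm (\<lambda>x. u x + v x))\<^sup>2 \<le> (l2norm u + l2norm v)\<^sup>2" .
qed simp

lemma l2norm_minus_commute: "l2norm (\<lambda>x. u x - v x) = l2norm (\<lambda>x. v x - u x)"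
  by (simp add: l2norm_def ip_def algebra_simps)

lemma l2norm_mono:
  assumes "u \<in> bdm" "v \<in> bdm" "c \<ge> 0" "\<And>x. x \<in> {0..1} \<Longrightarrow> \<bar>u x\<bar> \<le> c * \<bar>v x\<bar>"
  shows "l2norm u \<le> c * l2norm v"
proof (rule power2_le_imp_le)
  have "ip u u \<le> ip (\<lambda>x. c * v x) (\<lambda>x. c * v x)"
  proof (rule ip_mono)
    fix x :: real assume "x \<in> {0..1}"
    then have "\<bar>u x\<bar> \<le> \<bar>c * v x\<bar>" using assms by (simp add: abs_mult)
    then show "u x * u x \<le> c * v x * (c * v x)" 
      using abs_le_square_iff[of "u x" "c * v x"] by (simp add: power2_eq_square)
  qed (use assms in auto)
  then show "(l2norm u)\<^sup>2 \<le> (c * l2norm v)\<^sup>2"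
    by (simp only: l2norm_sq power_mult_distrib ip_linear) (simp add: power2_eq_square mult.assoc)
qed (use assms in simp)

lemma l2norm_le_const:
  assumes "u \<in> bdm" "c \<ge> 0" "\<And>x. x \<in> {0..1} \<Longrightarrow> \<bar>u x\<bar> \<le> c"
  shows "l2norm u \<le> c"
  using l2norm_mono[OF assms(1) bdm_const[of 1] assms(2)] assms(3)
  by (simp add: l2norm_def ip_def set_lebesgue_integral_def)

section \<open>The finite element space\<close>

abbreviation stiff :: "(real \<Rightarrow> real) \<Rightarrow> (real \<Rightarrow> real) \<Rightarrow> real" where
  "stiff u v \<equiv> ip (deriv u) (deriv v)"

definition nodes :: "nat \<Rightarrow> real set" where
  "nodes M = (\<lambda>i. real i / real M) ` {..M}"

lemma finite_nodes [simp]: "finite (nodes M)"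
  by (simp add: nodes_def)

lemma cell_exists:
  assumes "M \<ge> 1" "x \<in> {0..1}" "x \<notin> nodes M"
  shows "\<exists>i<M. x \<in> {real i / real M<..<real (Suc i) / real M}"
proof -
  define i where "i = nat \<lfloor>x * real M\<rfloor>"
  have nn: "0 \<le> x * real M" using assms by simp
  have lo: "real i \<le> x * real M" unfolding i_def using nn by simp
  have hi: "x * real M < real (Suc i)" unfolding i_def using nn by linarith
  have le1: "x * real M \<le> real M" using assms by (simp add: mult_left_le_one_le)
  have ne: "real j \<noteq> x * real M" if "j \<le> M" for j
  proof
    assume "real j = x * real M"
    then have "x = real j / real M" using assms(1) by (simp add: field_simps)
    with that assms(3) show False by (auto simp: nodes_def)
  qed
  have "i \<le> M" using lo le1 by linarith
  then have lo': "real i < x * real M" using lo ne[of i] by linarith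
  have "i < M" using lo' le1 by linarith
  then show ?thesis using lo' hi assms(1) by (intro exI[of _ i]) (auto simp: field_simps)
qed

lemma fem_spaceD:
  assumes "u \<in> fem_space M"
  shows "continuous_on {0..1} u" "u 0 = 0" "u 1 = 0" "x \<notin> {0..1} \<Longrightarrow> u x = 0"
  using assms by (auto simp: fem_space_def)

lemma fem_lincomb:
  assumes "u \<in> fem_space M" "v \<in> fem_space M"
  shows "(\<lambda>x. u x + c * v x) \<in> fem_space M"
  unfolding fem_space_def mem_Collect_eq
proof (intro conjI allI impI)
  show "continuous_on {0..1} (\<lambda>x. u x + c * v x)"
    using assms by (intro continuous_intros) (auto simp: fem_space_def)
  fix i assume "i < M"
  then obtain a b a' b' where
    "\<forall>x\<in>{real i / real M<..<real (Suc i) / real M}. u x = a * x + b"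
    "\<forall>x\<in>{real i / real M<..<real (Suc i) / real M}. v x = a' * x + b'"
    using assms unfolding fem_space_def by blast
  then have "\<forall>x\<in>{real i / real M<..<real (Suc i) / real M}. u x + c * v x = (a + c * a') * x + (b + c * b')"
    by (simp add: algebra_simps)
  then show "\<exists>a b. \<forall>x\<in>{real i / real M<..<real (Suc i) / real M}. u x + c * v x = a * x + b"
    by blast
qed (simp_all add: fem_spaceD(2-4)[OF assms(1)] fem_spaceD(2-4)[OF assms(2)])

lemma fem_zero [simp]: "(\<lambda>x. 0) \<in> fem_space M"
  by (auto simp: fem_space_def intro!: exI[of _ 0])

lemma fem_scale [simp]: "v \<in> fem_space M \<Longrightarrow> (\<lambda>x. c * v x) \<in> fem_space M"
  using fem_lincomb[OF fem_zero, of v M c] by simp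

lemma fem_add [simp]: "u \<in> fem_space M \<Longrightarrow> v \<in> fem_space M \<Longrightarrow> (\<lambda>x. u x + v x) \<in> fem_space M"
  using fem_lincomb[of u M v 1] by simp

lemma fem_diff [simp]: "u \<in> fem_space M \<Longrightarrow> v \<in> fem_space M \<Longrightarrow> (\<lambda>x. u x - v x) \<in> fem_space M"
  using fem_lincomb[of u M v "-1"] by simp

lemma fem_sum [simp]:
  "(\<And>i. i \<in> I \<Longrightarrow> f i \<in> fem_space M) \<Longrightarrow> (\<lambda>x. \<Sum>i\<in>I. f i x) \<in> fem_space M"
  by (induction I rule: infinite_finite_induct) auto

lemma fem_lincomb_sum:
  "(\<And>i. i \<in> I \<Longrightarrow> u i \<in> fem_space M) \<Longrightarrow> (\<lambda>x. \<Sum>i\<in>I. c i * u i x) \<in> fem_space M"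
  by (rule fem_sum) (rule fem_scale)

lemma fem_bdm [simp]: "u \<in> fem_space M \<Longrightarrow> u \<in> bdm"
  by (rule bdm_continuous) (rule fem_spaceD)

lemma affine_has_deriv:
  fixes u :: "real \<Rightarrow> real"
  assumes "open S" "\<forall>y\<in>S. u y = a * y + b" "x \<in> S"
  shows "(u has_real_derivative a) (at x)"
proof -
  have "((\<lambda>y. a * y + b) has_real_derivative a) (at x)" by (auto intro!: derivative_eq_intros)
  then show ?thesis
    by (rule has_field_derivative_transform_within_open[OF _ assms(1,3)]) (simp add: assms(2))
qed

definition cell :: "nat \<Rightarrow> nat \<Rightarrow> real set" where
  "cell M i = {real i / real M<..<real (Suc i) / real M}"

lemma fem_affine_on_cell:
  "u \<in> fem_space M \<Longrightarrow> i < M \<Longrightarrow> \<exists>a b. \<forall>y\<in>cell M i. u y = a * y + b"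
  by (simp add: fem_space_def cell_def)

text \<open>Away from the nodes a finite element function is locally affine, also outside the unit
  interval, where it vanishes.\<close>

lemma fem_locally_affine:
  assumes "M \<ge> 1" "u \<in> fem_space M" "x \<notin> nodes M"
  shows "\<exists>S a b. open S \<and> x \<in> S \<and> (\<forall>y\<in>S. u y = a * y + b) \<and>
    (S = - {0..1} \<and> a = 0 \<or> (\<exists>i<M. S = cell M i))"
proof (cases "x \<in> {0..1}")
  case True
  then obtain i where i: "i < M" "x \<in> cell M i"
    using cell_exists[OF assms(1) True assms(3)] by (auto simp: cell_def)
  then obtain a b where "\<forall>y\<in>cell M i. u y = a * y + b"
    using fem_affine_on_cell[OF assms(2)] by blast
  then show ?thesis using i by (intro exI[of _ "cell M i"] exI[of _ a] exI[of _ b]) (auto simp: cell_def)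
next
  case False
  then show ?thesis using fem_spaceD(4)[OF assms(2)]
    by (intro exI[of _ "- {0..1}"] exI[of _ 0]) auto
qed

lemma fem_has_deriv:
  assumes "M \<ge> 1" "u \<in> fem_space M" "x \<notin> nodes M"
  shows "(u has_real_derivative deriv u x) (at x)"
proof -
  obtain S a b where S: "open S" "x \<in> S" "\<forall>y\<in>S. u y = a * y + b"
    using fem_locally_affine[OF assms] by blast
  note D = affine_has_deriv[OF S(1,3,2)]
  then show ?thesis using DERIV_imp_deriv[OF D] by simp
qed

lemma fem_deriv_bdm:
  assumes "M \<ge> 1" "u \<in> fem_space M"
  shows "deriv u \<in> bdm"
proof (rule bdm_borel)
  show "deriv u \<in> borel_measurable borel"
  proof (rule borel_measurable_continuous_countable_exceptions)
    show "countable (nodes M)" by (simp add: countable_finite)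
    have "isCont (deriv u) x" if x: "x \<notin> nodes M" for x
    proof -
      obtain S a b where S: "open S" "x \<in> S" "\<forall>y\<in>S. u y = a * y + b"
        using fem_locally_affine[OF assms x] by blast
      have "deriv u y = a" if "y \<in> S" for y
        by (rule DERIV_imp_deriv) (rule affine_has_deriv[OF S(1,3) that])
      then have "\<forall>\<^sub>F y in nhds x. deriv u y = a"
        using S(1,2) by (auto simp: eventually_nhds)
      then show ?thesis using isCont_cong[of "deriv u" "\<lambda>_. a" x] by auto
    qed
    then show "continuous_on (- nodes M) (deriv u)"
      by (intro continuous_at_imp_continuous_on) auto
  qed
  have "finite (deriv u ` cell M i)" if "i < M" for i
  proof -
    obtain a b where ab: "\<forall>y\<in>cell M i. u y = a * y + b"
      using fem_affine_on_cell[OF assms(2) \<open>i < M\<close>] by blast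
    have "deriv u y = a" if "y \<in> cell M i" for y
      by (rule DERIV_imp_deriv, rule affine_has_deriv[OF _ ab that]) (simp add: cell_def)
    then have "deriv u ` cell M i \<subseteq> {a}" by blast
    then show ?thesis by (rule finite_subset) simp
  qed
  then have fin: "finite (insert 0 (deriv u ` nodes M \<union> (\<Union>i<M. deriv u ` cell M i)))" by simp
  have "deriv u x \<in> insert 0 (deriv u ` nodes M \<union> (\<Union>i<M. deriv u ` cell M i))" for x
  proof (cases "x \<in> nodes M")
    case False
    obtain S a b where S: "open S" "x \<in> S" "\<forall>y\<in>S. u y = a * y + b"
      "S = - {0..1} \<and> a = 0 \<or> (\<exists>i<M. S = cell M i)"
      using fem_locally_affine[OF assms False] by blast
    have "deriv u x = a" by (rule DERIV_imp_deriv, rule affine_has_deriv[OF S(1,3,2)])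
    then show ?thesis using S(2,4) \<open>x \<notin> nodes M\<close> by auto
  qed simp
  then have "range (deriv u) \<subseteq> insert 0 (deriv u ` nodes M \<union> (\<Union>i<M. deriv u ` cell M i))" by auto
  then have "finite (range (deriv u))" using fin by (rule finite_subset)
  then show "bounded (range (deriv u))" by (rule finite_imp_bounded)
qed

lemma AE_not_nodes: "AE x in lborel. x \<notin> nodes M"
  by (intro AE_not_in finite_imp_null_set_lborel) simp

lemma fem_deriv_lincomb:
  assumes "M \<ge> 1" "u \<in> fem_space M" "v \<in> fem_space M" "x \<notin> nodes M"
  shows "deriv (\<lambda>x. u x + c * v x) x = deriv u x + c * deriv v x"
  using fem_has_deriv[OF assms(1,2,4)] fem_has_deriv[OF assms(1,3,4)]
  by (intro DERIV_imp_deriv) (auto intro!: derivative_eq_intros)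

text \<open>The derivative is linear off the nodes, hence almost everywhere.\<close>

lemma stiff_lincomb_left:
  assumes "M \<ge> 1" "u \<in> fem_space M" "v \<in> fem_space M" "w \<in> fem_space M"
  shows "stiff (\<lambda>x. u x + c * v x) w = stiff u w + c * stiff v w"
proof -
  have "stiff (\<lambda>x. u x + c * v x) w = ip (\<lambda>x. deriv u x + c * deriv v x) (deriv w)"
    unfolding ip_def set_lebesgue_integral_def
  proof (rule integral_cong_AE)
    have m: "(\<lambda>x. indicator {0..1} x *\<^sub>R f x) \<in> borel_measurable lborel" if "f \<in> bdm" for f :: "real \<Rightarrow> real"
      using that by (auto simp: bdm_def set_borel_measurable_def)
    show "(\<lambda>x. indicator {0..1} x *\<^sub>R (deriv (\<lambda>x. u x + c * v x) x * deriv w x)) \<in> borel_measurable lborel"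
      using assms by (intro m bdm_mult fem_deriv_bdm fem_lincomb)
    show "(\<lambda>x. indicator {0..1} x *\<^sub>R ((deriv u x + c * deriv v x) * deriv w x)) \<in> borel_measurable lborel"
      using assms by (intro m bdm_mult bdm_add bdm_const fem_deriv_bdm)
    show "AE x in lborel. indicator {0..1} x *\<^sub>R (deriv (\<lambda>x. u x + c * v x) x * deriv w x) =
        indicator {0..1} x *\<^sub>R ((deriv u x + c * deriv v x) * deriv w x)"
      using AE_not_nodes[of M] by eventually_elim (simp add: fem_deriv_lincomb[OF assms(1-3)])
  qed
  then show ?thesis using assms by (simp add: ip_linear fem_deriv_bdm[OF assms(1)])
qed

lemma stiff_zero_left [simp]: "stiff (\<lambda>x. 0) w = 0"
  by (simp add: deriv_const[abs_def])

lemma stiff_scale_left: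
  "M \<ge> 1 \<Longrightarrow> v \<in> fem_space M \<Longrightarrow> w \<in> fem_space M \<Longrightarrow> stiff (\<lambda>x. c * v x) w = c * stiff v w"
  using stiff_lincomb_left[of M "\<lambda>_. 0" v w c] by simp

lemma stiff_add_left:
  "M \<ge> 1 \<Longrightarrow> u \<in> fem_space M \<Longrightarrow> v \<in> fem_space M \<Longrightarrow> w \<in> fem_space M \<Longrightarrow>
    stiff (\<lambda>x. u x + v x) w = stiff u w + stiff v w"
  using stiff_lincomb_left[of M u v w 1] by simp

lemma stiff_diff_left:
  "M \<ge> 1 \<Longrightarrow> u \<in> fem_space M \<Longrightarrow> v \<in> fem_space M \<Longrightarrow> w \<in> fem_space M \<Longrightarrow>
    stiff (\<lambda>x. u x - v x) w = stiff u w - stiff v w"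
  using stiff_lincomb_left[of M u v w "-1"] by simp

lemma stiff_sum_left:
  "M \<ge> 1 \<Longrightarrow> (\<And>i. i \<in> I \<Longrightarrow> u i \<in> fem_space M) \<Longrightarrow> w \<in> fem_space M \<Longrightarrow>
    stiff (\<lambda>x. \<Sum>i\<in>I. u i x) w = (\<Sum>i\<in>I. stiff (u i) w)"
  by (induction I rule: infinite_finite_induct) (auto simp: stiff_add_left)

lemma stiff_commute: "stiff u w = stiff w u"
  by (rule ip_commute)

lemma stiff_diff_eq_l2norm:
  assumes "M \<ge> 1" "u \<in> fem_space M" "v \<in> fem_space M"
  shows "stiff (\<lambda>x. u x - v x) (\<lambda>x. u x - v x) = (l2norm (\<lambda>x. deriv u x - deriv v x))\<^sup>2"
proof -
  let ?D = "\<lambda>x. u x - v x"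
  have *: "stiff w ?D = stiff u w - stiff v w" if "w \<in> fem_space M" for w
    using stiff_diff_left[OF assms that] by (simp add: stiff_commute)
  have d: "deriv u \<in> bdm" "deriv v \<in> bdm" using assms by (auto intro: fem_deriv_bdm)
  have "stiff ?D ?D = stiff u ?D - stiff v ?D"
    using assms by (intro stiff_diff_left) auto
  also have "\<dots> = stiff u u - 2 * stiff u v + stiff v v"
    using assms by (simp add: * stiff_commute[of v u])
  also have "\<dots> = ip (\<lambda>x. deriv u x - deriv v x) (\<lambda>x. deriv u x - deriv v x)"
    using d by (simp add: ip_diff_left ip_diff_right ip_commute[of "deriv v" "deriv u"])
  finally show ?thesis by (simp add: l2norm_sq)
qed

text \<open>Integrating from the left boundary value, which is zero, writes a point value as an inner product
  with the derivative. The sup bound and the Poincare inequality below then follow from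
  Cauchy--Schwarz, with constant one on the unit interval.\<close>

lemma fem_primitive:
  assumes "M \<ge> 1" "u \<in> fem_space M" "x \<in> {0..1}"
  shows "u x = ip (indicator {0..x}) (deriv u)"
proof -
  have int: "(deriv u has_integral (u x - u 0)) {0..x}"
  proof (rule fundamental_theorem_of_calculus_interior_strong[OF finite_nodes[of M]])
    show "continuous_on {0..x} u"
      using fem_spaceD(1)[OF assms(2)] assms(3) by (auto intro: continuous_on_subset)
  qed (use assms fem_has_deriv[OF assms(1,2)] in
      \<open>auto simp: has_real_derivative_iff_has_vector_derivative[symmetric]\<close>)
  have eq: "indicator {0..1} y *\<^sub>R (indicator {0..x} y * deriv u y) = indicator {0..x} y *\<^sub>R deriv u y" for y
    using assms(3) by (auto simp: indicator_def)
  have "set_integrable lborel {0..x} (deriv u)"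
    using assms by (intro set_integrable_subset[OF bdm_integrable[OF fem_deriv_bdm[OF assms(1,2)]]]) auto
  then have "(LINT y:{0..x}|lborel. deriv u y) = integral {0..x} (deriv u)"
    by (rule set_borel_integral_eq_integral)
  also have "\<dots> = u x" using int fem_spaceD(2)[OF assms(2)] by (simp add: integral_unique)
  finally show ?thesis unfolding ip_def set_lebesgue_integral_def eq by simp
qed

lemma fem_sup_bound:
  assumes "M \<ge> 1" "u \<in> fem_space M" "x \<in> {0..1}"
  shows "(u x)\<^sup>2 \<le> stiff u u"
proof -
  have b: "indicator {0..x} \<in> bdm"
  proof (rule bdm_borel)
    show "bounded (range (indicat_real {0..x}))"
      by (rule boundedI[of _ 1]) (clarsimp simp: indicator_def)
  qed measurable
  have n: "l2norm (indicator {0..x}) \<le> 1"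
    by (rule l2norm_le_const[OF b]) (simp_all add: indicator_def)
  have "(u x)\<^sup>2 \<le> ip (indicator {0..x}) (indicator {0..x}) * stiff u u"
    unfolding fem_primitive[OF assms]
    by (rule Cauchy_Schwarz_ip_sq[OF b fem_deriv_bdm[OF assms(1,2)]])
  also have "\<dots> \<le> 1 * stiff u u"
    using power_mono[OF n, of 2] by (intro mult_right_mono) (simp_all add: l2norm_sq)
  finally show ?thesis by simp
qed

lemma Poincare_fem:
  assumes "M \<ge> 1" "u \<in> fem_space M" shows "ip u u \<le> stiff u u"
proof -
  have "l2norm u \<le> sqrt (stiff u u)"
    using assms fem_sup_bound[OF assms] by (intro l2norm_le_const) (auto intro!: real_le_rsqrt)
  then have "(l2norm u)\<^sup>2 \<le> (sqrt (stiff u u))\<^sup>2" by (intro power_mono) auto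
  then show ?thesis by (simp add: l2norm_sq)
qed

lemma fem_definite:
  assumes "u \<in> fem_space M" "ip u u = 0" shows "u = (\<lambda>x. 0)"
proof -
  have c: "continuous_on {0..1} (\<lambda>x. u x * u x)"
    using fem_spaceD(1)[OF assms(1)] by (intro continuous_intros)
  have "integral {0..1} (\<lambda>x. u x * u x) = 0"
    using set_borel_integral_eq_integral(2)[of "{0..1}" "\<lambda>x. u x * u x"] assms by (simp add: ip_def)
  then have "\<forall>x\<in>{0..1}. u x = 0"
    using integral_eq_0_iff[OF c] by simp
  then show ?thesis using fem_spaceD(4)[OF assms(1)] by (intro ext) blast
qed

text \<open>A finite element function is determined by its nodal values: between two zeros at
  neighbouring nodes an affine function vanishes.\<close>

lemma fem_nodal_zero:
  assumes "M \<ge> 1" "u \<in> fem_space M" "\<And>j. j \<le> M \<Longrightarrow> u (real j / real M) = 0"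
  shows "u = (\<lambda>x. 0)"
proof
  fix x
  show "u x = 0"
  proof (cases "x \<in> {0..1} \<and> x \<notin> nodes M")
    case True
    then obtain i where i: "i < M" "x \<in> cell M i"
      using cell_exists[OF assms(1)] by (auto simp: cell_def)
    define l r where "l = real i / real M" and "r = real (Suc i) / real M"
    have lr: "0 \<le> l" "r \<le> 1" "l < r" "x \<in> {l<..<r}"
      using i assms(1) by (auto simp: l_def r_def cell_def divide_simps)
    obtain a b where ab: "\<And>y. y \<in> {l<..<r} \<Longrightarrow> u y = a * y + b"
      using fem_affine_on_cell[OF assms(2) i(1)] unfolding cell_def l_def r_def by blast
    have ends: "u l = 0" "u r = 0" using assms(3)[of i] assms(3)[of "Suc i"] i by (auto simp: l_def r_def)
    have cont: "continuous_on {l..r} u"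
      using lr by (intro continuous_on_subset[OF fem_spaceD(1)[OF assms(2)]]) auto
    have "u y = a * y + b" if "y \<in> {l..r}" for y
    proof (rule continuous_constant_on_closure[of "{l<..<r}" "\<lambda>y. u y - (a * y + b)" 0 y, simplified])
      show "continuous_on (closure {l<..<r}) (\<lambda>y. u y - (a * y + b))"
        using cont lr by (auto intro!: continuous_intros)
    qed (use ab that lr in auto)
    from this[of l] this[of r] have "a * l + b = 0" "a * r + b = 0" using lr ends by auto
    then have "a * r = a * l" by linarith
    then have "a * (r - l) = 0" by (simp add: right_diff_distrib)
    then have "a = 0" using lr by simp
    then show ?thesis using ab[OF lr(4)] \<open>a * l + b = 0\<close> by simp
  next
    case False
    then show ?thesis using assms(3) fem_spaceD(4)[OF assms(2)] by (auto simp: nodes_def)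
  qed
qed

section \<open>Orthonormal coordinates\<close>

text \<open>Gram--Schmidt, with one new basis element for each node at which the functions are released:
  the functions vanishing at the nodes with index at least \<open>k\<close> have codimension at most one among
  those vanishing at the nodes with index greater than \<open>k\<close>.\<close>

lemma fem_orthonormal_basis:
  assumes M: "M \<ge> 1"
  shows "\<exists>(d::nat) e. (\<forall>i<d. e i \<in> fem_space M) \<and>
    (\<forall>i<d. \<forall>j<d. ip (e i) (e j) = (if i = j then 1 else 0)) \<and>
    (\<forall>u\<in>fem_space M. u = (\<lambda>x. \<Sum>i<d. ip u (e i) * e i x))"
proof -
  define W where "W k = {u \<in> fem_space M. \<forall>j. k \<le> j \<longrightarrow> j \<le> M \<longrightarrow> u (real j / real M) = 0}" for k
  have W_fem: "u \<in> fem_space M" if "u \<in> W k" for u k using that by (simp add: W_def)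
  have "\<exists>(d::nat) e. (\<forall>i<d. e i \<in> W k) \<and>
    (\<forall>i<d. \<forall>j<d. ip (e i) (e j) = (if i = j then 1 else 0)) \<and>
    (\<forall>u\<in>W k. u = (\<lambda>x. \<Sum>i<d. ip u (e i) * e i x))" for k
  proof (induction k)
    case 0
    show ?case
    proof (rule exI[of _ "0::nat"], rule exI[of _ "(\<lambda>_ _. 0) :: nat \<Rightarrow> real \<Rightarrow> real"], intro conjI ballI)
      fix u assume "u \<in> W 0"
      then have "u = (\<lambda>x. 0)" by (intro fem_nodal_zero[OF M]) (auto simp: W_def)
      then show "u = (\<lambda>x. \<Sum>i<0. ip u ((\<lambda>_ _. 0) i) * (\<lambda>_ _. 0) i x)" by simp
    qed simp_all
  next
    case (Suc k)
    then obtain d :: nat and e where H: "(\<forall>i<d. e i \<in> W k) \<and>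
      (\<forall>i<d. \<forall>j<d. ip (e i) (e j) = (if i = j then 1 else 0)) \<and>
      (\<forall>u\<in>W k. u = (\<lambda>x. \<Sum>i<d. ip u (e i) * e i x))" by blast
    have e: "e i \<in> W k" if "i < d" for i using H that by blast
    have on: "ip (e i) (e j) = (if i = j then 1 else 0)" if "i < d" "j < d" for i j
      using H that by blast
    have ex: "u = (\<lambda>x. \<Sum>i<d. ip u (e i) * e i x)" if "u \<in> W k" for u using H that by blast
    have WSuc: "u \<in> W (Suc k)" if "u \<in> W k" for u using that by (auto simp: W_def)
    show ?case
    proof (cases "W (Suc k) \<subseteq> W k")
      case True
      then have "W (Suc k) = W k" using WSuc by blast
      then show ?thesis using e on ex by (intro exI[of _ d] exI[of _ e]) auto
    next
      case False
      let ?p = "real k / real M"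
      obtain w where w: "w \<in> W (Suc k)" "w \<notin> W k" using False by blast
      have wp: "w ?p \<noteq> 0"
      proof
        assume "w ?p = 0"
        then have "w (real j / real M) = 0" if "k \<le> j" "j \<le> M" for j
          using w(1) that by (cases "j = k") (auto simp: W_def)
        then have "w \<in> W k" using w(1) by (auto simp: W_def)
        with w(2) show False by simp
      qed
      have kM: "k \<le> M"
      proof (rule ccontr)
        assume "\<not> k \<le> M"
        then have "w \<in> W k" using w(1) by (auto simp: W_def)
        with w(2) show False by simp
      qed
      have efem [simp]: "e i \<in> fem_space M" if "i < d" for i using W_fem[OF e[OF that]] .
      have wfem [simp]: "w \<in> fem_space M" using W_fem[OF w(1)] .
      define w' where "w' = (\<lambda>x. w x - (\<Sum>i<d. ip w (e i) * e i x))"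
      have w'fem [simp]: "w' \<in> fem_space M" unfolding w'_def
        by (intro fem_diff wfem fem_lincomb_sum efem) simp
      have [simp]: "e i \<in> bdm" if "i < d" for i using fem_bdm[OF efem[OF that]] .
      have [simp]: "w \<in> bdm" "w' \<in> bdm" using fem_bdm[OF wfem] fem_bdm[OF w'fem] .
      have ep: "e i ?p = 0" if "i < d" for i using e[OF that] kM by (auto simp: W_def)
      have w'p: "w' ?p = w ?p" by (simp add: w'_def ep)
      have w'W: "w' \<in> W (Suc k)"
        using w(1) e w'fem by (auto simp: W_def w'_def intro!: sum.neutral)
      have orth: "ip w' (e j) = 0" if "j < d" for j
      proof -
        have "ip w' (e j) = ip w (e j) - (\<Sum>i<d. ip w (e i) * ip (e i) (e j))"
          unfolding w'_def using that
          by (subst ip_diff_left) (auto intro!: bdm_lincomb ip_lincomb_left)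
        also have "(\<Sum>i<d. ip w (e i) * ip (e i) (e j)) = (\<Sum>i<d. if i = j then ip w (e i) else 0)"
          using that by (intro sum.cong) (auto simp: on)
        finally show ?thesis using that by simp
      qed
      define n where "n = l2norm w'"
      have n: "n > 0"
      proof -
        have "ip w' w' \<noteq> 0"
        proof
          assume "ip w' w' = 0"
          then have "w' = (\<lambda>x. 0)" by (rule fem_definite[OF w'fem])
          then show False using w'p wp by simp
        qed
        then show ?thesis using ip_self_nonneg[of w'] by (simp add: n_def l2norm_def less_le)
      qed
      have nn: "ip w' w' = n * n" using l2norm_sq[of w'] by (simp add: n_def power2_eq_square)
      define e' where "e' i = (if i < d then e i else (\<lambda>x. inverse n * w' x))" for i
      have e'_lt: "e' i = e i" if "i < d" for i using that by (simp add: e'_def)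
      have e'_d: "e' d = (\<lambda>x. inverse n * w' x)" by (simp add: e'_def)
      have "e' i \<in> W (Suc k)" if "i < Suc d" for i
        using that WSuc[OF e] w'W by (auto simp: e'_def W_def)
      moreover have "ip (e' i) (e' j) = (if i = j then 1 else 0)" if "i < Suc d" "j < Suc d" for i j
      proof -
        consider "i < d" "j < d" | "i < d" "j = d" | "i = d" "j < d" | "i = d" "j = d"
          using \<open>i < Suc d\<close> \<open>j < Suc d\<close> by (auto simp: less_Suc_eq)
        then show ?thesis
        proof cases
          case 1 then show ?thesis by (simp add: e'_lt on)
        next
          case 2 then show ?thesis
            by (simp only: e'_lt e'_d ip_scale_right) (simp add: ip_commute[of "e i"] orth)
        next
          case 3 then show ?thesis
            by (simp only: e'_lt e'_d ip_scale_left) (simp add: orth)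
        next
          case 4 then show ?thesis
            using n by (simp only: e'_d ip_scale_left ip_scale_right nn) (simp add: field_simps)
        qed
      qed
      moreover have "u = (\<lambda>x. \<Sum>i<Suc d. ip u (e' i) * e' i x)" if u: "u \<in> W (Suc k)" for u
      proof -
        have ufem [simp]: "u \<in> fem_space M" using W_fem[OF u] .
        define c where "c = u ?p / w' ?p"
        define u0 where "u0 = (\<lambda>x. u x - c * w' x)"
        have u0fem [simp]: "u0 \<in> fem_space M" unfolding u0_def by (intro fem_diff fem_scale ufem w'fem)
        have [simp]: "u \<in> bdm" "u0 \<in> bdm" using fem_bdm[OF ufem] fem_bdm[OF u0fem] .
        have "u0 \<in> W k"
          unfolding W_def mem_Collect_eq
        proof (intro conjI allI impI)
          fix j assume j: "k \<le> j" "j \<le> M"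
          show "u0 (real j / real M) = 0"
          proof (cases "j = k")
            case True then show ?thesis using w'p wp by (simp add: u0_def c_def)
          next
            case False
            then show ?thesis using j u w'W by (auto simp: u0_def W_def)
          qed
        qed simp
        note u0 = ex[OF this]
        have iu: "ip u v = ip u0 v + c * ip w' v" if "v \<in> fem_space M" for v
        proof -
          have "u = (\<lambda>x. u0 x + c * w' x)" by (auto simp: u0_def)
          then have "ip u v = ip (\<lambda>x. u0 x + c * w' x) v" by (rule arg_cong)
          also have "\<dots> = ip u0 v + c * ip w' v" using fem_bdm[OF that] by (simp add: ip_add_left ip_scale_left)
          finally show ?thesis .
        qed
        have lt: "ip u (e i) = ip u0 (e i)" if "i < d" for i
          using that by (simp add: iu orth)
        have "ip u0 w' = ip (\<lambda>x. \<Sum>i<d. ip u0 (e i) * e i x) w'"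
          by (rule arg_cong[OF u0, of "\<lambda>v. ip v w'"])
        also have "\<dots> = 0"
          using orth by (subst ip_lincomb_left) (auto simp: ip_commute[of "e _" w'])
        finally have "ip u w' = c * (n * n)" by (simp add: iu nn)
        then have d: "ip u (e' d) * e' d x = c * w' x" for x
          using n by (simp only: e'_d ip_scale_right) (simp add: field_simps)
        show ?thesis
        proof
          fix x
          have "u x = u0 x + c * w' x" by (simp add: u0_def)
          also have "u0 x = (\<Sum>i<d. ip u (e' i) * e' i x)"
            using fun_cong[OF u0, of x] by (simp add: lt e'_lt)
          finally show "u x = (\<Sum>i<Suc d. ip u (e' i) * e' i x)" by (simp add: d)
        qed
      qed
      ultimately show ?thesis by (intro exI[of _ "Suc d"] exI[of _ e']) blast
    qed
  qed
  note this[of "Suc M"]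
  moreover have "W (Suc M) = fem_space M" by (auto simp: W_def)
  ultimately show ?thesis by simp
qed

locale fem_basis =
  fixes M d :: nat and e :: "nat \<Rightarrow> real \<Rightarrow> real"
  assumes M: "M \<ge> 1"
    and basis_fem [simp]: "i < d \<Longrightarrow> e i \<in> fem_space M"
    and orthonormal: "i < d \<Longrightarrow> j < d \<Longrightarrow> ip (e i) (e j) = (if i = j then 1 else 0)"
    and expansion: "u \<in> fem_space M \<Longrightarrow> u = (\<lambda>x. \<Sum>i<d. ip u (e i) * e i x)"
begin

text \<open>Restated for the mesh of the locale, so that the simplifier has no schematic mesh to instantiate.\<close>

lemma fem_bdm_M [simp]: "u \<in> fem_space M \<Longrightarrow> u \<in> bdm"
  by (rule fem_bdm)

lemma basis_bdm [simp]: "i < d \<Longrightarrow> e i \<in> bdm"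
  by simp

lemma deriv_bdm [simp]: "u \<in> fem_space M \<Longrightarrow> deriv u \<in> bdm"
  by (rule fem_deriv_bdm[OF M])

definition comb :: "(nat \<Rightarrow> real) \<Rightarrow> real \<Rightarrow> real" where
  "comb c = (\<lambda>x. \<Sum>i<d. c i * e i x)"

lemma comb_fem [simp]: "comb c \<in> fem_space M"
  unfolding comb_def by (intro fem_lincomb_sum basis_fem) simp

lemma comb_coords: "u \<in> fem_space M \<Longrightarrow> comb (\<lambda>i. ip u (e i)) = u"
  unfolding comb_def by (rule expansion[symmetric])

lemma ip_comb_left: "w \<in> bdm \<Longrightarrow> ip (comb c) w = (\<Sum>i<d. c i * ip (e i) w)"
  unfolding comb_def by (rule ip_lincomb_left) auto

lemma ip_comb_basis: "j < d \<Longrightarrow> ip (comb c) (e j) = c j"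
proof -
  assume j: "j < d"
  then have "ip (comb c) (e j) = (\<Sum>i<d. c i * ip (e i) (e j))"
    by (simp add: ip_comb_left)
  also have "\<dots> = (\<Sum>i<d. if i = j then c i else 0)"
    using j by (intro sum.cong) (auto simp: orthonormal)
  finally show ?thesis using j by simp
qed

lemma ip_coords: "u \<in> fem_space M \<Longrightarrow> w \<in> bdm \<Longrightarrow> ip u w = (\<Sum>i<d. ip u (e i) * ip (e i) w)"
  using ip_comb_left[of w "\<lambda>i. ip u (e i)"] by (simp add: comb_coords)

lemma ip_self_coords: "u \<in> fem_space M \<Longrightarrow> ip u u = (\<Sum>i<d. (ip u (e i))\<^sup>2)"
  using ip_coords[of u u] by (simp add: ip_commute[of "e _" u] power2_eq_square)

lemma stiff_coords:
  "u \<in> fem_space M \<Longrightarrow> w \<in> fem_space M \<Longrightarrow> stiff u w = (\<Sum>i<d. ip u (e i) * stiff (e i) w)"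
proof -
  assume u: "u \<in> fem_space M" and w: "w \<in> fem_space M"
  have "stiff u w = stiff (\<lambda>x. \<Sum>i<d. ip u (e i) * e i x) w" 
    by (rule arg_cong[OF expansion[OF u], of "\<lambda>v. stiff v w"])
  also have "\<dots> = (\<Sum>i<d. ip u (e i) * stiff (e i) w)"
    using w stiff_scale_left[OF M basis_fem w]
    by (subst stiff_sum_left[OF M]) (auto intro!: fem_scale basis_fem)
  finally show ?thesis .
qed

text \<open>Riesz representation: the second premise holds for every functional \<open>F\<close> that is linear on the
  space.\<close>

lemma ip_comb_eq_linear:
  assumes "v \<in> fem_space M" "F v = (\<Sum>i<d. ip v (e i) * F (e i))"
  shows "ip (comb (\<lambda>i. F (e i))) v = F v"
proof -
  have "ip (comb (\<lambda>i. F (e i))) v = (\<Sum>i<d. F (e i) * ip (e i) v)"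
    using assms(1) by (simp add: ip_comb_left)
  also have "\<dots> = F v"
    unfolding assms(2) by (intro sum.cong) (auto simp: ip_commute[of v] mult.commute)
  finally show ?thesis .
qed

lemma C_time_fem: "\<phi> \<in> C_time M a b \<Longrightarrow> t \<in> {a..b} \<Longrightarrow> \<phi> t \<in> fem_space M"
  by (simp add: C_time_def)

text \<open>Continuity in the \<open>L\<^sup>2\<close> norm is continuity of the finitely many coordinates. All time-dependent
  functions are handled in this form.\<close>

lemma C_time_iff:
  "\<phi> \<in> C_time M a b \<longleftrightarrow> (\<forall>t\<in>{a..b}. \<phi> t \<in> fem_space M) \<and>
     (\<forall>i<d. continuous_on {a..b} (\<lambda>t. ip (\<phi> t) (e i)))"
proof (cases "\<forall>t\<in>{a..b}. \<phi> t \<in> fem_space M")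
  case True
  have "(\<forall>t\<in>{a..b}. ((\<lambda>s. l2norm (\<lambda>x. \<phi> s x - \<phi> t x)) \<longlongrightarrow> 0) (at t within {a..b})) \<longleftrightarrow>
      (\<forall>i<d. continuous_on {a..b} (\<lambda>t. ip (\<phi> t) (e i)))"
  proof safe
    fix i assume lim: "\<forall>t\<in>{a..b}. ((\<lambda>s. l2norm (\<lambda>x. \<phi> s x - \<phi> t x)) \<longlongrightarrow> 0) (at t within {a..b})"
      and i: "i < d"
    show "continuous_on {a..b} (\<lambda>t. ip (\<phi> t) (e i))"
      unfolding continuous_on_def
    proof
      fix t assume t: "t \<in> {a..b}"
      have "\<forall>\<^sub>F s in at t within {a..b}. norm (ip (\<phi> s) (e i) - ip (\<phi> t) (e i)) \<le> l2norm (\<lambda>x. \<phi> s x - \<phi> t x) * l2norm (e i)"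
        unfolding eventually_at_topological
      proof (intro exI[of _ UNIV] conjI ballI impI)
        fix s assume "s \<in> {a..b}"
        then have "\<phi> s \<in> bdm" "\<phi> t \<in> bdm" using True t fem_bdm by blast+
        then show "norm (ip (\<phi> s) (e i) - ip (\<phi> t) (e i)) \<le> l2norm (\<lambda>x. \<phi> s x - \<phi> t x) * l2norm (e i)"
          using Cauchy_Schwarz_ip[of "\<lambda>x. \<phi> s x - \<phi> t x" "e i"] i
          by (simp add: ip_diff_left)
      qed auto
      moreover have "((\<lambda>s. l2norm (\<lambda>x. \<phi> s x - \<phi> t x) * l2norm (e i)) \<longlongrightarrow> 0) (at t within {a..b})"
        using tendsto_mult_left_zero[OF lim[rule_format, OF t]] .
      ultimately have "((\<lambda>s. ip (\<phi> s) (e i) - ip (\<phi> t) (e i)) \<longlongrightarrow> 0) (at t within {a..b})"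
        by (rule Lim_null_comparison)
      then show "((\<lambda>t. ip (\<phi> t) (e i)) \<longlongrightarrow> ip (\<phi> t) (e i)) (at t within {a..b})"
        by (simp add: LIM_zero_iff)
    qed
  next
    fix t assume co: "\<forall>i<d. continuous_on {a..b} (\<lambda>t. ip (\<phi> t) (e i))" and t: "t \<in> {a..b}"
    have eq: "l2norm (\<lambda>x. \<phi> s x - \<phi> t x) = sqrt (\<Sum>i<d. (ip (\<phi> s) (e i) - ip (\<phi> t) (e i))\<^sup>2)"
      if "s \<in> {a..b}" for s
    proof -
      have "\<phi> s \<in> fem_space M" "\<phi> t \<in> fem_space M" using True t that by blast+
      then show ?thesis by (simp add: l2norm_def ip_self_coords ip_diff_left)
    qed
    have "((\<lambda>s. sqrt (\<Sum>i<d. (ip (\<phi> s) (e i) - ip (\<phi> t) (e i))\<^sup>2)) \<longlongrightarrow>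
        sqrt (\<Sum>i<d. (ip (\<phi> t) (e i) - ip (\<phi> t) (e i))\<^sup>2)) (at t within {a..b})"
      using co t by (intro tendsto_intros) (auto simp: continuous_on_def)
    then have "((\<lambda>s. sqrt (\<Sum>i<d. (ip (\<phi> s) (e i) - ip (\<phi> t) (e i))\<^sup>2)) \<longlongrightarrow> 0) (at t within {a..b})"
      by simp
    then show "((\<lambda>s. l2norm (\<lambda>x. \<phi> s x - \<phi> t x)) \<longlongrightarrow> 0) (at t within {a..b})"
    proof (rule Lim_transform_eventually)
      show "\<forall>\<^sub>F s in at t within {a..b}. sqrt (\<Sum>i<d. (ip (\<phi> s) (e i) - ip (\<phi> t) (e i))\<^sup>2)
          = l2norm (\<lambda>x. \<phi> s x - \<phi> t x)"
        unfolding eventually_at_topological by (intro exI[of _ UNIV]) (simp add: eq)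
    qed
  qed
  then show ?thesis using True by (simp add: C_time_def)
qed (auto simp: C_time_def)

lemma comb_C_time:
  assumes "\<And>i. i < d \<Longrightarrow> continuous_on {a..b} (\<lambda>t. c t i)"
  shows "(\<lambda>t. comb (c t)) \<in> C_time M a b"
  unfolding C_time_iff using assms by (simp add: ip_comb_basis)

lemma continuous_ip:
  assumes "\<phi> \<in> C_time M a b" "w \<in> bdm"
  shows "continuous_on {a..b} (\<lambda>t. ip (\<phi> t) w)"
proof -
  have "continuous_on {a..b} (\<lambda>t. \<Sum>i<d. ip (\<phi> t) (e i) * ip (e i) w)"
    using assms by (intro continuous_intros) (auto simp: C_time_iff)
  then show ?thesis
    using ip_coords[OF C_time_fem[OF assms(1)] assms(2)]
    by (subst continuous_on_cong[OF refl]) auto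
qed

lemma continuous_stiff:
  assumes "\<phi> \<in> C_time M a b" "w \<in> fem_space M"
  shows "continuous_on {a..b} (\<lambda>t. stiff (\<phi> t) w)"
proof -
  have "continuous_on {a..b} (\<lambda>t. \<Sum>i<d. ip (\<phi> t) (e i) * stiff (e i) w)"
    using assms by (intro continuous_intros) (auto simp: C_time_iff)
  then show ?thesis
    using stiff_coords[OF C_time_fem[OF assms(1)] assms(2)]
    by (subst continuous_on_cong[OF refl]) auto
qed

lemma continuous_ip_self:
  assumes "\<phi> \<in> C_time M a b"
  shows "continuous_on {a..b} (\<lambda>t. ip (\<phi> t) (\<phi> t))"
proof -
  have "continuous_on {a..b} (\<lambda>t. \<Sum>i<d. (ip (\<phi> t) (e i))\<^sup>2)"
    using assms by (intro continuous_intros) (auto simp: C_time_iff)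
  then show ?thesis
    using ip_self_coords[OF C_time_fem[OF assms(1)]]
    by (subst continuous_on_cong[OF refl]) auto
qed

lemma continuous_ip_comp:
  assumes "\<phi> \<in> C_time M a b" "w \<in> bdm" "L \<ge> 0"
    and F: "\<And>x y. \<bar>F x - F y\<bar> \<le> L * \<bar>x - y\<bar>" "\<And>x. \<bar>F x\<bar> \<le> L"
  shows "continuous_on {a..b} (\<lambda>t. ip (\<lambda>x. F (\<phi> t x)) w)"
  unfolding continuous_on_def
proof
  have contF: "continuous_on UNIV F"
    by (rule lipschitz_on_continuous_on[of L])
      (use F(1) assms(3) in \<open>auto simp: lipschitz_on_def dist_real_def\<close>)
  fix t assume t: "t \<in> {a..b}"
  have bd: "(\<lambda>x. F (\<phi> s x)) \<in> bdm" if "s \<in> {a..b}" for s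
    by (rule bdm_comp[OF fem_bdm[OF C_time_fem[OF assms(1) that]] contF F(2)])
  have fem: "\<phi> s \<in> bdm" if "s \<in> {a..b}" for s using C_time_fem[OF assms(1) that] by simp
  have "\<forall>\<^sub>F s in at t within {a..b}. norm (ip (\<lambda>x. F (\<phi> s x)) w - ip (\<lambda>x. F (\<phi> t x)) w)
      \<le> l2norm (\<lambda>x. \<phi> s x - \<phi> t x) * (L * l2norm w)"
    unfolding eventually_at_topological
  proof (intro exI[of _ UNIV] conjI ballI impI)
    fix s assume s: "s \<in> {a..b}"
    have "norm (ip (\<lambda>x. F (\<phi> s x)) w - ip (\<lambda>x. F (\<phi> t x)) w) = \<bar>ip (\<lambda>x. F (\<phi> s x) - F (\<phi> t x)) w\<bar>"
      using bd s t assms(2) by (simp add: ip_diff_left)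
    also have "\<dots> \<le> l2norm (\<lambda>x. F (\<phi> s x) - F (\<phi> t x)) * l2norm w"
      using bd s t assms(2) by (intro Cauchy_Schwarz_ip) auto
    also have "\<dots> \<le> L * l2norm (\<lambda>x. \<phi> s x - \<phi> t x) * l2norm w"
      using bd s t assms(3) F(1) fem by (intro mult_right_mono l2norm_mono) auto
    finally show "norm (ip (\<lambda>x. F (\<phi> s x)) w - ip (\<lambda>x. F (\<phi> t x)) w)
      \<le> l2norm (\<lambda>x. \<phi> s x - \<phi> t x) * (L * l2norm w)" by (simp add: mult_ac)
  qed auto
  moreover have "((\<lambda>s. l2norm (\<lambda>x. \<phi> s x - \<phi> t x) * (L * l2norm w)) \<longlongrightarrow> 0) (at t within {a..b})"
    by (rule tendsto_mult_left_zero) (use assms(1) t in \<open>auto simp: C_time_def\<close>)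
  ultimately have "((\<lambda>s. ip (\<lambda>x. F (\<phi> s x)) w - ip (\<lambda>x. F (\<phi> t x)) w) \<longlongrightarrow> 0) (at t within {a..b})"
    by (rule Lim_null_comparison)
  then show "((\<lambda>t. ip (\<lambda>x. F (\<phi> t x)) w) \<longlongrightarrow> ip (\<lambda>x. F (\<phi> t x)) w) (at t within {a..b})"
    by (simp add: LIM_zero_iff)
qed

lemma C_time_imp_L2_time:
  assumes "\<alpha> \<in> C_time M a b"
  shows "\<alpha> \<in> L2_time M a b"
  unfolding L2_time_def mem_Collect_eq
proof (intro conjI ballI)
  fix x :: real
  have "continuous_on {a..b} (\<lambda>t. \<Sum>i<d. ip (\<alpha> t) (e i) * e i x)"
    using assms by (intro continuous_intros) (auto simp: C_time_iff)
  moreover have "(\<Sum>i<d. ip (\<alpha> t) (e i) * e i x) = \<alpha> t x" if "t \<in> {a..b}" for t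
    using fun_cong[OF expansion[OF C_time_fem[OF assms that]], of x] by simp
  ultimately have "continuous_on {a..b} (\<lambda>t. \<alpha> t x)"
    using continuous_on_cong[OF refl, of "{a..b}" "\<lambda>t. \<alpha> t x" "\<lambda>t. \<Sum>i<d. ip (\<alpha> t) (e i) * e i x"]
    by simp
  then show "set_borel_measurable lborel {a..b} (\<lambda>t. \<alpha> t x)"
    using borel_integrable_atLeastAtMost'[of a b "\<lambda>t. \<alpha> t x"]
    by (auto simp: set_integrable_def set_borel_measurable_def)
next
  show "set_integrable lborel {a..b} (\<lambda>t. (l2norm (\<alpha> t))\<^sup>2)"
    unfolding l2norm_sq by (intro borel_integrable_atLeastAtMost' continuous_ip_self assms)
qed (rule C_time_fem[OF assms])

end

section \<open>Forward Euler against the semidiscrete flow\<close>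

text \<open>The function \<open>exp (-\<kappa> (t - a)) E t - R (t - a)\<close> is nonincreasing. Only interior derivatives are
  used, because the states have kinks in time at the ends of the time cells.\<close>

lemma Gronwall_step:
  fixes E E' :: "real \<Rightarrow> real"
  assumes "a < b" "continuous_on {a..b} E"
    and deriv: "\<And>t. a < t \<Longrightarrow> t < b \<Longrightarrow> (E has_real_derivative E' t) (at t)"
    and le: "\<And>t. a < t \<Longrightarrow> t < b \<Longrightarrow> E' t \<le> \<kappa> * E t + R"
    and "\<kappa> \<ge> 0" "R \<ge> 0"
  shows "E b \<le> exp (\<kappa> * (b - a)) * (E a + R * (b - a))"
proof -
  define F where "F t = exp (- \<kappa> * (t - a)) * E t - R * (t - a)" for t
  have "F b \<le> F a"
  proof (rule DERIV_nonpos_imp_decreasing_open[OF less_imp_le[OF assms(1)]])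
    show "continuous_on {a..b} F"
      unfolding F_def by (intro continuous_intros assms(2))
    fix t assume t: "a < t" "t < b"
    have d: "(F has_real_derivative (exp (- \<kappa> * (t - a)) * (E' t - \<kappa> * E t) - R)) (at t)"
      unfolding F_def using deriv[OF t]
      by (auto intro!: derivative_eq_intros simp: algebra_simps)
    have "exp (- \<kappa> * (t - a)) * (E' t - \<kappa> * E t) \<le> exp (- \<kappa> * (t - a)) * R"
      using le[OF t] by (intro mult_left_mono) auto
    also have "\<dots> \<le> 1 * R" using t assms(5,6) by (intro mult_right_mono) auto
    finally show "\<exists>y. (F has_real_derivative y) (at t) \<and> y \<le> 0" using d by force
  qed
  then have "exp (- \<kappa> * (b - a)) * E b \<le> E a + R * (b - a)" by (simp add: F_def)
  then have "exp (\<kappa> * (b - a)) * (exp (- \<kappa> * (b - a)) * E b) \<le> exp (\<kappa> * (b - a)) * (E a + R * (b - a))"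
    by (intro mult_left_mono) auto
  also have "exp (\<kappa> * (b - a)) * (exp (- \<kappa> * (b - a)) * E b) = (exp (\<kappa> * (b - a)) * exp (- \<kappa> * (b - a))) * E b"
    by (simp only: mult.assoc)
  also have "\<dots> = E b" by (simp add: exp_minus)
  finally show ?thesis .
qed

lemma Young_abs:
  fixes x A B c :: real
  assumes "x\<^sup>2 \<le> A * B" "A \<ge> 0" "B \<ge> 0" "c > 0"
  shows "\<bar>x\<bar> \<le> c * A + B / (4 * c)"
proof (rule power2_le_imp_le)
  have "0 \<le> (c * A - B / (4 * c))\<^sup>2" by simp
  also have "\<dots> = (c * A + B / (4 * c))\<^sup>2 - A * B"
    using assms(4) by (simp add: power2_eq_square field_simps)
  finally show "\<bar>x\<bar>\<^sup>2 \<le> (c * A + B / (4 * c))\<^sup>2" using assms(1) by simp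
qed (use assms in simp)

text \<open>The potential enters through bounds on its first three derivatives, stated as Lipschitz and Taylor
  bounds with one constant.\<close>

locale allen_cahn = fem_basis M d e for M d :: nat and e :: "nat \<Rightarrow> real \<Rightarrow> real" +
  fixes \<delta> L :: real and V :: "real \<Rightarrow> real"
  assumes \<delta>: "\<delta> > 0" and L: "L \<ge> 0"
    and V1_bound: "\<bar>deriv V x\<bar> \<le> L" and V2_bound: "\<bar>deriv (deriv V) x\<bar> \<le> L"
    and V1_lipschitz: "\<bar>deriv V x - deriv V y\<bar> \<le> L * \<bar>x - y\<bar>"
    and V2_lipschitz: "\<bar>deriv (deriv V) x - deriv (deriv V) y\<bar> \<le> L * \<bar>x - y\<bar>"
    and V1_Taylor: "\<bar>deriv V (x + y) - deriv V x - y * deriv (deriv V) x\<bar> \<le> L * y\<^sup>2"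
begin

abbreviation V1 :: "real \<Rightarrow> real" where "V1 \<equiv> deriv V"
abbreviation V2 :: "real \<Rightarrow> real" where "V2 \<equiv> deriv (deriv V)"
abbreviation flx :: "(real \<Rightarrow> real) \<Rightarrow> (real \<Rightarrow> real) \<Rightarrow> (real \<Rightarrow> real) \<Rightarrow> real" where
  "flx \<equiv> flux \<delta> V"

lemma lipschitz_continuous:
  fixes F :: "real \<Rightarrow> real"
  assumes "\<And>x y. \<bar>F x - F y\<bar> \<le> L * \<bar>x - y\<bar>"
  shows "continuous_on UNIV F"
  by (rule lipschitz_on_continuous_on[of L]) (use assms L in \<open>auto simp: lipschitz_on_def dist_real_def\<close>)

lemma V1_bdm [simp]: "u \<in> bdm \<Longrightarrow> (\<lambda>x. V1 (u x)) \<in> bdm"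
  by (rule bdm_comp[OF _ lipschitz_continuous V1_bound]) (auto intro: V1_lipschitz)

lemma V2_bdm [simp]: "u \<in> bdm \<Longrightarrow> (\<lambda>x. V2 (u x)) \<in> bdm"
  by (rule bdm_comp[OF _ lipschitz_continuous V2_bound]) (auto intro: V2_lipschitz)

lemma flux_eq:
  assumes "u \<in> fem_space M" "a \<in> fem_space M" "v \<in> bdm"
  shows "flx u a v = - \<delta> * stiff u v - ip (\<lambda>x. V1 (u x)) v / \<delta> + ip a v"
proof -
  have [simp]: "u \<in> bdm" "a \<in> bdm" using assms by auto
  have "ip (\<lambda>x. - V1 (u x) / \<delta> + a x) v = ip (\<lambda>x. - V1 (u x) / \<delta>) v + ip a v"
    using assms(3) by (intro ip_add_left bdm_divide bdm_uminus V1_bdm) auto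
  also have "ip (\<lambda>x. - V1 (u x) / \<delta>) v = - ip (\<lambda>x. V1 (u x)) v / \<delta>"
    by (simp only: ip_divide_left ip_uminus_left)
  finally show ?thesis by (simp add: flux_def)
qed

lemma flux_coords:
  assumes "u \<in> fem_space M" "a \<in> fem_space M" "v \<in> fem_space M"
  shows "flx u a v = (\<Sum>i<d. ip v (e i) * flx u a (e i))"
proof -
  have [simp]: "u \<in> bdm" "a \<in> bdm" "v \<in> bdm" using assms by auto
  have 1: "stiff u v = (\<Sum>i<d. ip v (e i) * stiff u (e i))"
    using stiff_coords[OF assms(3,1)] by (simp only: stiff_commute[of _ u])
  have 2: "ip w v = (\<Sum>i<d. ip v (e i) * ip w (e i))" if "w \<in> bdm" for w
    using ip_coords[OF assms(3) that] by (simp only: ip_commute[of _ w])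
  have "(\<Sum>i<d. ip v (e i) * flx u a (e i)) =
      (\<Sum>i<d. - \<delta> * (ip v (e i) * stiff u (e i)) - ip v (e i) * ip (\<lambda>x. V1 (u x)) (e i) / \<delta>
        + ip v (e i) * ip a (e i))"
    by (intro sum.cong refl) (simp add: flux_eq[OF assms(1,2)] algebra_simps)
  also have "\<dots> = - \<delta> * stiff u v - ip (\<lambda>x. V1 (u x)) v / \<delta> + ip a v"
    unfolding 1 2[OF \<open>a \<in> bdm\<close>] 2[OF V1_bdm[OF \<open>u \<in> bdm\<close>]]
    by (simp add: sum.distrib sum_subtractf sum_distrib_left sum_divide_distrib sum_negf)
  finally show ?thesis using assms by (simp add: flux_eq)
qed

text \<open>The energy estimate behind the error bound. The stiffness term at the Euler node is split
  into the dissipation of the error \<open>w\<close> and a part of the increment \<open>D\<close> of the Euler state. The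
  dissipation is \<open>2 \<delta> (w\<^sub>x, w\<^sub>x)\<close>. A quarter of it absorbs the increment and a quarter the control
  defect, which enters through a dual \<open>H\<^sup>1\<close> bound with constant \<open>R\<^sup>1\<^sup>/\<^sup>2\<close>.\<close>

lemma flux_difference_estimate:
  assumes fem: "u \<in> fem_space M" "y \<in> fem_space M" "D \<in> fem_space M" "w \<in> fem_space M"
      "a1 \<in> fem_space M" "a2 \<in> fem_space M"
    and split: "u = (\<lambda>x. y x + (w x + \<theta> * D x))" and \<theta>: "0 \<le> \<theta>" "\<theta> \<le> 1"
    and Q: "stiff D D \<le> Q" and R: "R \<ge> 0" "(ip (\<lambda>x. a1 x - a2 x) w)\<^sup>2 \<le> R * stiff w w"
  shows "2 * (flx u a1 w - flx y a2 w) \<le>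
      3 * L / \<delta> * ip w w + ((2 * \<delta> + L / \<delta>) * Q + 2 * R / \<delta>)"
proof -
  have [simp]: "u \<in> bdm" "y \<in> bdm" "D \<in> bdm" "w \<in> bdm" "a1 \<in> bdm" "a2 \<in> bdm" using fem by auto
  define p where "p = stiff w w"
  have p: "p \<ge> 0" by (simp add: p_def)
  have q: "0 \<le> stiff D D" by simp
  have su: "stiff u w = stiff y w + (p + \<theta> * stiff D w)"
    unfolding split p_def using fem by (subst stiff_add_left[OF M]) (auto simp: stiff_lincomb_left[OF M] intro!: fem_lincomb)
  have "(stiff D w)\<^sup>2 \<le> stiff D D * p"
    unfolding p_def using fem by (intro Cauchy_Schwarz_ip_sq) auto
  from Young_abs[OF this q p, of 1] have "\<bar>stiff D w\<bar> \<le> Q + p / 4" using Q by simp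
  then have "\<theta> * \<bar>stiff D w\<bar> \<le> 1 * (Q + p / 4)" using \<theta> by (intro mult_mono) auto
  then have "\<bar>\<theta> * stiff D w\<bar> \<le> Q + p / 4" using \<theta> by (simp add: abs_mult)
  then have "- (\<theta> * stiff D w) \<le> Q + p / 4" by linarith
  from mult_left_mono[OF this, of "2 * \<delta>"]
  have A: "- 2 * \<delta> * (\<theta> * stiff D w) \<le> 2 * \<delta> * Q + \<delta> * p / 2" using \<delta> by (simp add: algebra_simps)
  have "\<bar>ip (\<lambda>x. a1 x - a2 x) w\<bar> \<le> (1 / \<delta>) * R + p / (4 * (1 / \<delta>))"
    using R p \<delta> by (intro Young_abs) (auto simp: p_def)
  then have "\<bar>ip a1 w - ip a2 w\<bar> \<le> (1 / \<delta>) * R + p / (4 * (1 / \<delta>))"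
    by (simp only: ip_diff_left \<open>a1 \<in> bdm\<close> \<open>a2 \<in> bdm\<close> \<open>w \<in> bdm\<close>)
  from mult_left_mono[OF order_trans[OF abs_ge_self this], of 2]
  have "2 * (ip a1 w - ip a2 w) \<le> 2 * ((1 / \<delta>) * R + p / (4 * (1 / \<delta>)))" by simp
  also have "\<dots> = 2 * R / \<delta> + \<delta> * p / 2" by (simp add: algebra_simps)
  finally have B: "2 * (ip a1 w - ip a2 w) \<le> 2 * R / \<delta> + \<delta> * p / 2" .
  have D2: "(l2norm D)\<^sup>2 \<le> Q" using Poincare_fem[OF M fem(3)] Q by (simp add: l2norm_sq)
  have "\<bar>ip (\<lambda>x. V1 (u x) - V1 (y x)) w\<bar> \<le> l2norm (\<lambda>x. V1 (u x) - V1 (y x)) * l2norm w"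
    by (intro Cauchy_Schwarz_ip) auto
  also have "\<dots> \<le> (L * l2norm (\<lambda>x. w x + \<theta> * D x)) * l2norm w"
  proof (intro mult_right_mono l2norm_mono)
    show "\<bar>V1 (u x) - V1 (y x)\<bar> \<le> L * \<bar>w x + \<theta> * D x\<bar>" for x
      using V1_lipschitz[of "u x" "y x"] by (simp add: split)
  qed (use L in \<open>auto intro!: bdm_add bdm_mult bdm_const\<close>)
  also have "\<dots> \<le> (L * (l2norm w + l2norm D)) * l2norm w"
  proof (intro mult_right_mono mult_left_mono)
    have "l2norm (\<lambda>x. w x + \<theta> * D x) \<le> l2norm w + l2norm (\<lambda>x. \<theta> * D x)"
      by (intro l2norm_triangle) auto
    also have "l2norm (\<lambda>x. \<theta> * D x) \<le> 1 * l2norm D"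
      using \<theta> by (intro l2norm_mono) (auto simp: abs_mult intro!: mult_left_le_one_le)
    finally show "l2norm (\<lambda>x. w x + \<theta> * D x) \<le> l2norm w + l2norm D" by simp
  qed (use L in auto)
  also have "\<dots> = L * ((l2norm w)\<^sup>2 + l2norm D * l2norm w)" by (simp add: power2_eq_square algebra_simps)
  also have "\<dots> \<le> L * ((l2norm w)\<^sup>2 + (Q + (l2norm w)\<^sup>2) / 2)"
  proof -
    have "0 \<le> (l2norm D - l2norm w)\<^sup>2" by simp
    then have "l2norm D * l2norm w \<le> ((l2norm D)\<^sup>2 + (l2norm w)\<^sup>2) / 2"
      by (simp add: power2_diff)
    also have "((l2norm D)\<^sup>2 + (l2norm w)\<^sup>2) / 2 \<le> (Q + (l2norm w)\<^sup>2) / 2"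
      using D2 by simp
    finally have "l2norm D * l2norm w \<le> (Q + (l2norm w)\<^sup>2) / 2" .
    then show ?thesis using L by (intro mult_left_mono) auto
  qed
  also have "\<dots> = L * (3 * ip w w + Q) / 2" by (simp add: l2norm_sq field_simps)
  finally have "\<bar>ip (\<lambda>x. V1 (u x)) w - ip (\<lambda>x. V1 (y x)) w\<bar> \<le> L * (3 * ip w w + Q) / 2"
    by (subst (asm) ip_diff_left) auto
  from abs_le_D2[OF this]
  have "- (ip (\<lambda>x. V1 (u x)) w - ip (\<lambda>x. V1 (y x)) w) \<le> L * (3 * ip w w + Q) / 2" .
  from mult_left_mono[OF this, of "2 / \<delta>"]
  have Cc: "- 2 / \<delta> * (ip (\<lambda>x. V1 (u x)) w - ip (\<lambda>x. V1 (y x)) w) \<le> 3 * L / \<delta> * ip w w + L / \<delta> * Q"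
    using \<delta> by (simp add: field_simps)
  have "2 * (flx u a1 w - flx y a2 w) = - 2 * \<delta> * p + (- 2 * \<delta> * (\<theta> * stiff D w))
      + (- 2 / \<delta> * (ip (\<lambda>x. V1 (u x)) w - ip (\<lambda>x. V1 (y x)) w)) + 2 * (ip a1 w - ip a2 w)"
    using fem \<delta> by (simp add: flux_eq su field_simps)
  also have "\<dots> \<le> - 2 * \<delta> * p + (2 * \<delta> * Q + \<delta> * p / 2) + (3 * L / \<delta> * ip w w + L / \<delta> * Q) + (2 * R / \<delta> + \<delta> * p / 2)"
    by (intro add_mono A B Cc order_refl)
  also have "\<dots> = 3 * L / \<delta> * ip w w + ((2 * \<delta> + L / \<delta>) * Q + 2 * R / \<delta>) - \<delta> * p"
    by (simp add: algebra_simps)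
  also have "\<dots> \<le> 3 * L / \<delta> * ip w w + ((2 * \<delta> + L / \<delta>) * Q + 2 * R / \<delta>)"
    using mult_nonneg_nonneg[OF less_imp_le[OF \<delta>] p] by (simp only: diff_le_eq le_add_same_cancel1)
  finally show ?thesis .
qed

text \<open>On one time cell the error is measured against the linear interpolant of the two Euler states,
  whose time derivative is the flux at the left Euler state.\<close>

lemma euler_step_error:
  assumes ab: "a < b" and \<phi>: "\<phi> \<in> C_time M a b"
    and \<alpha>: "\<And>t. a < t \<Longrightarrow> t < b \<Longrightarrow> \<alpha> t \<in> fem_space M"
    and ode: "\<And>t v. a < t \<Longrightarrow> t < b \<Longrightarrow> v \<in> fem_space M \<Longrightarrow>
      ((\<lambda>s. ip (\<phi> s) v) has_real_derivative flx (\<phi> t) (\<alpha> t) v) (at t)"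
    and fem: "y \<in> fem_space M" "z \<in> fem_space M" "c \<in> fem_space M"
    and euler: "\<And>v. v \<in> fem_space M \<Longrightarrow> ip z v = ip y v + (b - a) * flx y c v"
    and Q: "stiff (\<lambda>x. z x - y x) (\<lambda>x. z x - y x) \<le> Q"
    and R: "R \<ge> 0" "\<And>t v. a < t \<Longrightarrow> t < b \<Longrightarrow> v \<in> fem_space M \<Longrightarrow>
      (ip (\<lambda>x. \<alpha> t x - c x) v)\<^sup>2 \<le> R * stiff v v"
  shows "ip (\<lambda>x. \<phi> b x - z x) (\<lambda>x. \<phi> b x - z x) \<le> exp (3 * L / \<delta> * (b - a)) *
    (ip (\<lambda>x. \<phi> a x - y x) (\<lambda>x. \<phi> a x - y x) + ((2 * \<delta> + L / \<delta>) * Q + 2 * R / \<delta>) * (b - a))"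
proof -
  let ?D = "\<lambda>x. z x - y x"
  define err where "err t = (\<lambda>x. \<phi> t x - y x - (t - a) / (b - a) * (z x - y x))" for t
  define k where "k i t = ip (\<phi> t) (e i) - ip y (e i) - (t - a) * flx y c (e i)" for i t
  define E where "E t = (\<Sum>i<d. (k i t)\<^sup>2)" for t
  have Dfem: "?D \<in> fem_space M" using fem by simp
  have errfem: "err t \<in> fem_space M" if "t \<in> {a..b}" for t
    unfolding err_def using C_time_fem[OF \<phi> that] fem by (intro fem_diff fem_scale)
  have errk: "ip (err t) (e i) = k i t" if "t \<in> {a..b}" "i < d" for t i
  proof -
    have [simp]: "\<phi> t \<in> bdm" "y \<in> bdm" "z \<in> bdm" using C_time_fem[OF \<phi> that(1)] fem by auto
    have "ip (err t) (e i) = ip (\<phi> t) (e i) - ip y (e i) - (t - a) / (b - a) * (ip z (e i) - ip y (e i))"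
      unfolding err_def using that(2)
      by (subst ip_diff_left) (simp_all only: ip_scale_left, simp_all add: ip_diff_left)
    then show ?thesis using euler[OF basis_fem[OF that(2)]] ab by (simp add: k_def)
  qed
  have Eerr: "E t = ip (err t) (err t)" if "t \<in> {a..b}" for t
    using that errfem[OF that] by (simp add: E_def ip_self_coords errk)
  have "E b \<le> exp (3 * L / \<delta> * (b - a)) * (E a + ((2 * \<delta> + L / \<delta>) * Q + 2 * R / \<delta>) * (b - a))"
  proof (rule Gronwall_step[OF ab])
    show "continuous_on {a..b} E"
      unfolding E_def k_def using \<phi> by (intro continuous_intros) (auto simp: C_time_iff)
    fix t assume t: "a < t" "t < b"
    then have tt: "t \<in> {a..b}" by simp
    have \<phi>t: "\<phi> t \<in> fem_space M" using C_time_fem[OF \<phi> tt] .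
    have dk: "(k i has_real_derivative (flx (\<phi> t) (\<alpha> t) (e i) - flx y c (e i))) (at t)" if "i < d" for i
      unfolding k_def using ode[OF t basis_fem[OF that]]
      by (auto intro!: derivative_eq_intros)
    show "(E has_real_derivative (\<Sum>i<d. 2 * k i t * (flx (\<phi> t) (\<alpha> t) (e i) - flx y c (e i)))) (at t)"
      unfolding E_def using dk
      by (intro DERIV_sum) (auto intro!: derivative_eq_intros)
    have "(\<Sum>i<d. 2 * k i t * (flx (\<phi> t) (\<alpha> t) (e i) - flx y c (e i))) =
        2 * (flx (\<phi> t) (\<alpha> t) (err t) - flx y c (err t))"
      unfolding flux_coords[OF \<phi>t \<alpha>[OF t] errfem[OF tt]] flux_coords[OF fem(1,3) errfem[OF tt]]
      by (simp add: errk[OF tt] sum_subtractf[symmetric] sum_distrib_left algebra_simps)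
    also have "\<dots> \<le> 3 * L / \<delta> * ip (err t) (err t) + ((2 * \<delta> + L / \<delta>) * Q + 2 * R / \<delta>)"
    proof (rule flux_difference_estimate[OF \<phi>t fem(1) Dfem errfem[OF tt] \<alpha>[OF t] fem(3), of "(t - a) / (b - a)"])
      show "\<phi> t = (\<lambda>x. y x + (err t x + (t - a) / (b - a) * (z x - y x)))"
        by (simp add: err_def)
    qed (use t Q R errfem[OF tt] in auto)
    finally show "(\<Sum>i<d. 2 * k i t * (flx (\<phi> t) (\<alpha> t) (e i) - flx y c (e i)))
        \<le> 3 * L / \<delta> * E t + ((2 * \<delta> + L / \<delta>) * Q + 2 * R / \<delta>)"
      by (simp only: Eerr[OF tt])
  next
    have "0 \<le> Q" using Q ip_self_nonneg order_trans by blast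
    then show "0 \<le> (2 * \<delta> + L / \<delta>) * Q + 2 * R / \<delta>" using \<delta> L R(1) by simp
  qed (use L \<delta> in simp)
  moreover have "err a = (\<lambda>x. \<phi> a x - y x)" "err b = (\<lambda>x. \<phi> b x - z x)"
    using ab by (auto simp: err_def)
  ultimately show ?thesis using ab by (simp add: Eerr)
qed

text \<open>The number \<open>R n\<close> bounds the squared dual \<open>H\<^sup>1\<close> norm of the control defect on the cell \<open>n\<close>. It vanishes
  for a control that is constant on the time cells; for the sampled optimal control the \<open>R n\<close> will
  have a sum of order of the time step. The equation is required inside the time cells, where both
  kinds of control are continuous.\<close>

lemma euler_error:
  fixes N :: nat
  assumes T: "T > 0" and N: "N \<ge> 1" and \<phi>: "\<phi> \<in> C_time M 0 T"
    and \<alpha>: "\<And>t. t \<in> {0..T} \<Longrightarrow> \<alpha> t \<in> fem_space M"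
    and ode: "\<And>n t v. n < N \<Longrightarrow> real n * (T / N) < t \<Longrightarrow> t < real (Suc n) * (T / N) \<Longrightarrow> v \<in> fem_space M \<Longrightarrow>
      ((\<lambda>s. ip (\<phi> s) v) has_real_derivative flx (\<phi> t) (\<alpha> t) v) (at t)"
    and euler: "euler_state \<delta> T V M N (\<phi> 0) 0 c y"
    and c: "c \<in> discrete_controls M N 0"
    and Q: "\<And>n. n < N \<Longrightarrow> stiff (\<lambda>x. y (Suc n) x - y n x) (\<lambda>x. y (Suc n) x - y n x) \<le> Q"
    and R: "\<And>n. n < N \<Longrightarrow> R n \<ge> 0" "\<And>n t v. n < N \<Longrightarrow> real n * (T / N) < t \<Longrightarrow> t < real (Suc n) * (T / N) \<Longrightarrow>
      v \<in> fem_space M \<Longrightarrow> (ip (\<lambda>x. \<alpha> t x - c n x) v)\<^sup>2 \<le> R n * stiff v v"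
  shows "(l2norm (\<lambda>x. \<phi> T x - y N x))\<^sup>2 \<le>
    exp (3 * L / \<delta> * T) * (\<Sum>n<N. ((2 * \<delta> + L / \<delta>) * Q + 2 * R n / \<delta>) * (T / N))"
proof -
  define h where "h = T / N"
  define \<kappa> where "\<kappa> = 3 * L / \<delta>"
  define S where "S n = (2 * \<delta> + L / \<delta>) * Q + 2 * R n / \<delta>" for n
  have h: "h > 0" and hN: "real N * h = T" using T N by (auto simp: h_def)
  have \<kappa>: "\<kappa> \<ge> 0" using L \<delta> by (simp add: \<kappa>_def)
  have S: "S n \<ge> 0" if "n < N" for n
  proof -
    have "0 \<le> Q" using Q[OF that] ip_self_nonneg order_trans by blast
    then show ?thesis using \<delta> L R(1)[OF that] by (simp add: S_def)
  qed
  have yfem: "y n \<in> fem_space M" if "n \<le> N" for n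
    using euler that by (simp add: euler_state_def)
  have "ip (\<lambda>x. \<phi> (n * h) x - y n x) (\<lambda>x. \<phi> (n * h) x - y n x) \<le> exp (\<kappa> * (n * h)) * (\<Sum>j<n. S j * h)"
    if "n \<le> N" for n :: nat
    using that
  proof (induction n)
    case 0
    have "y 0 = \<phi> 0" using euler by (simp add: euler_state_def)
    then show ?case by simp
  next
    case (Suc n)
    then have n: "n < N" by simp
    have sub: "{real n * h..real (Suc n) * h} \<subseteq> {0..T}"
    proof -
      have "real (Suc n) * h \<le> real N * h" using n h by (intro mult_right_mono) auto
      then show ?thesis using h hN by auto
    qed
    have len: "real (Suc n) * h - real n * h = h" by (simp add: algebra_simps)
    have "ip (\<lambda>x. \<phi> (Suc n * h) x - y (Suc n) x) (\<lambda>x. \<phi> (Suc n * h) x - y (Suc n) x) \<le>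
        exp (3 * L / \<delta> * (real (Suc n) * h - real n * h)) *
        (ip (\<lambda>x. \<phi> (n * h) x - y n x) (\<lambda>x. \<phi> (n * h) x - y n x)
          + ((2 * \<delta> + L / \<delta>) * Q + 2 * R n / \<delta>) * (real (Suc n) * h - real n * h))"
    proof (rule euler_step_error[where \<alpha> = \<alpha> and c = "c n"])
      show "real n * h < real (Suc n) * h" using h by simp
      show "\<phi> \<in> C_time M (real n * h) (real (Suc n) * h)"
        using \<phi> sub by (auto simp: C_time_iff intro: continuous_on_subset)
      show "y n \<in> fem_space M" "y (Suc n) \<in> fem_space M" using yfem n by auto
      show "c n \<in> fem_space M" using c n by (auto simp: discrete_controls_def)
      show "ip (y (Suc n)) v = ip (y n) v + (real (Suc n) * h - real n * h) * flx (y n) (c n) v"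
        if "v \<in> fem_space M" for v
        using euler n that unfolding len by (simp add: euler_state_def h_def)
    qed (use \<alpha> sub ode[OF n] Q[OF n] R(1)[OF n] R(2)[OF n] in \<open>auto simp: h_def\<close>)
    also have "\<dots> = exp (\<kappa> * h) * (ip (\<lambda>x. \<phi> (n * h) x - y n x) (\<lambda>x. \<phi> (n * h) x - y n x) + S n * h)"
      unfolding len by (simp add: \<kappa>_def S_def)
    also have "\<dots> \<le> exp (\<kappa> * h) * (exp (\<kappa> * (n * h)) * (\<Sum>j<n. S j * h) + exp (\<kappa> * (n * h)) * (S n * h))"
    proof (intro mult_left_mono add_mono)
      show "ip (\<lambda>x. \<phi> (n * h) x - y n x) (\<lambda>x. \<phi> (n * h) x - y n x) \<le> exp (\<kappa> * (n * h)) * (\<Sum>j<n. S j * h)"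
        using Suc by simp
      have "1 * (S n * h) \<le> exp (\<kappa> * (n * h)) * (S n * h)"
        using S[OF n] h \<kappa> by (intro mult_right_mono) auto
      then show "S n * h \<le> exp (\<kappa> * (n * h)) * (S n * h)" by simp
    qed auto
    also have "\<dots> = exp (\<kappa> * (Suc n * h)) * (\<Sum>j<Suc n. S j * h)"
      by (simp add: algebra_simps exp_add)
    finally show ?case .
  qed
  from this[of N] show ?thesis
    unfolding l2norm_sq hN S_def \<kappa>_def by (simp add: h_def)
qed

end

section \<open>Solving the semidiscrete equation\<close>

text \<open>Picard iteration in a weighted supremum norm: after multiplication with \<open>exp (-\<rho> t)\<close>, with
  \<open>\<rho>\<close> twice the Lipschitz constant, the integral operator halves distances on the whole interval.
  The control enters through its primitive, hidden in \<open>b\<close>, which is continuous also for a control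
  with jumps.\<close>

lemma Picard_global:
  fixes G :: "'a::banach \<Rightarrow> 'a" and b :: "real \<Rightarrow> 'a"
  assumes T: "T \<ge> 0" and b: "continuous_on {0..T} b"
    and G: "\<And>x y. norm (G x - G y) \<le> L * norm (x - y)" and L: "L > 0"
  shows "\<exists>\<phi>. continuous_on {0..T} \<phi> \<and> (\<forall>t\<in>{0..T}. \<phi> t = b t + integral {0..t} (\<lambda>s. G (\<phi> s)))"
proof -
  have contG: "continuous_on A G" for A
    by (rule continuous_on_subset[OF lipschitz_on_continuous_on[of L UNIV]])
      (use G L in \<open>auto simp: lipschitz_on_def dist_norm\<close>)
  define \<rho> where "\<rho> = 2 * L"
  have \<rho>: "\<rho> > 0" using L by (simp add: \<rho>_def)
  let ?g = "\<lambda>(Z :: real \<Rightarrow>\<^sub>C 'a) s. G (exp (\<rho> * s) *\<^sub>R apply_bcontfun Z s)"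
  define \<Phi> :: "(real \<Rightarrow>\<^sub>C 'a) \<Rightarrow> real \<Rightarrow> 'a"
    where "\<Phi> X t = exp (- \<rho> * t) *\<^sub>R (b t + integral {0..t} (?g X))" for X t
  have contGX: "continuous_on {0..t} (?g X)" for X :: "real \<Rightarrow>\<^sub>C 'a" and t
    by (rule continuous_on_compose2[OF contG[of UNIV]]) (auto intro!: continuous_intros)
  have cont\<Phi>: "continuous_on {0..T} (\<Phi> X)" for X
    unfolding \<Phi>_def
    by (intro continuous_intros b indefinite_integral_continuous_1 integrable_continuous_real contGX)
  define F where "F X = Bcontfun (ext_cont (\<Phi> X) 0 T)" for X
  have F: "apply_bcontfun (F X) t = \<Phi> X (clamp 0 T t)" for X t
  proof -
    have c: "continuous_on (cbox 0 T) (\<Phi> X)" using cont\<Phi> by simp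
    have "ext_cont (\<Phi> X) 0 T \<in> bcontfun"
      unfolding bcontfun_def mem_Collect_eq
    proof
      show "continuous_on UNIV (ext_cont (\<Phi> X) 0 T)" by (rule continuous_on_ext_cont[OF c])
      show "bounded (range (ext_cont (\<Phi> X) 0 T))"
        unfolding ext_cont_def by (intro clamp_bounded compact_imp_bounded compact_continuous_image c compact_cbox)
    qed
    then show ?thesis by (simp add: F_def Bcontfun_inverse ext_cont_def)
  qed
  have clampT: "clamp 0 T t \<in> {0..T}" for t :: real
    using clamp_in_interval[of 0 T t] T by simp
  have contr: "dist (F X) (F Y) \<le> 1/2 * dist X Y" for X Y
  proof (rule dist_bound)
    fix t
    define u where "u = clamp 0 T t"
    have u: "u \<in> {0..T}" unfolding u_def by (rule clampT)
    have int: "(?g Z) integrable_on {0..u}" for Z :: "real \<Rightarrow>\<^sub>C 'a"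
      by (intro integrable_continuous_real contGX)
    have e1: "((\<lambda>s. L * dist X Y * exp (\<rho> * s)) has_integral (L * dist X Y / \<rho> * exp (\<rho> * u) - L * dist X Y / \<rho> * exp (\<rho> * 0))) {0..u}"
      using u \<rho> by (intro fundamental_theorem_of_calculus)
        (auto intro!: derivative_eq_intros simp: has_real_derivative_iff_has_vector_derivative[symmetric])
    have "norm (integral {0..u} (?g X) - integral {0..u} (?g Y))
        = norm (integral {0..u} (\<lambda>s. ?g X s - ?g Y s))"
      by (simp add: integral_diff int)
    also have "\<dots> \<le> integral {0..u} (\<lambda>s. L * dist X Y * exp (\<rho> * s))"
    proof (rule integral_norm_bound_integral)
      fix s assume "s \<in> {0..u}"
      have "norm (?g X s - ?g Y s)
          \<le> L * norm (exp (\<rho> * s) *\<^sub>R apply_bcontfun X s - exp (\<rho> * s) *\<^sub>R apply_bcontfun Y s)" by (rule G)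
      also have "\<dots> = L * exp (\<rho> * s) * dist (apply_bcontfun X s) (apply_bcontfun Y s)"
        by (simp add: scaleR_diff_right[symmetric] dist_norm)
      also have "\<dots> \<le> L * exp (\<rho> * s) * dist X Y"
        using L by (intro mult_left_mono dist_bounded) auto
      finally show "norm (?g X s - ?g Y s)
          \<le> L * dist X Y * exp (\<rho> * s)" by (simp add: mult_ac)
    qed (use int e1 in \<open>auto intro: integrable_diff\<close>)
    also have "\<dots> \<le> L * dist X Y / \<rho> * exp (\<rho> * u)"
      using integral_unique[OF e1] L \<rho> by simp
    also have "\<dots> = exp (\<rho> * u) * (1/2 * dist X Y)"
      using L by (simp add: \<rho>_def)
    finally have bd: "norm (integral {0..u} (?g X) - integral {0..u} (?g Y))
      \<le> exp (\<rho> * u) * (1/2 * dist X Y)" .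
    have "dist (F X t) (F Y t) = exp (- \<rho> * u) * norm (integral {0..u} (?g X) - integral {0..u} (?g Y))"
      unfolding F u_def[symmetric] \<Phi>_def dist_norm scaleR_diff_right[symmetric] by simp
    also have "\<dots> \<le> exp (- \<rho> * u) * (exp (\<rho> * u) * (1/2 * dist X Y))"
      by (intro mult_left_mono bd) auto
    also have "\<dots> = (exp (- \<rho> * u) * exp (\<rho> * u)) * (1/2 * dist X Y)" by (simp only: mult.assoc)
    also have "\<dots> = 1/2 * dist X Y" by (simp add: exp_minus)
    finally show "dist (F X t) (F Y t) \<le> 1/2 * dist X Y" .
  qed
  obtain X where X: "F X = X"
    using banach_fix_type[of "1/2" F] contr by auto
  define \<phi> where "\<phi> t = exp (\<rho> * t) *\<^sub>R apply_bcontfun X t" for t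
  have "\<phi> t = b t + integral {0..t} (\<lambda>s. G (\<phi> s))" if t: "t \<in> {0..T}" for t
  proof -
    have "clamp 0 T t = t" using t by (intro clamp_cancel_cbox) simp
    then have "apply_bcontfun X t = \<Phi> X t" using F[of X t] X by simp
    then show ?thesis by (simp add: \<phi>_def \<Phi>_def exp_minus)
  qed
  moreover have "continuous_on {0..T} \<phi>" unfolding \<phi>_def by (intro continuous_intros) auto
  ultimately show ?thesis by blast
qed

instance bcontfun :: (metric_space, banach) banach ..

text \<open>The control that is constant on each time cell, with the final time assigned to the last
  cell, and its primitive.\<close>

definition time_cell :: "real \<Rightarrow> nat \<Rightarrow> real \<Rightarrow> nat" where
  "time_cell h N t = min (N - 1) (nat \<lfloor>t / h\<rfloor>)"

definition elapsed :: "real \<Rightarrow> nat \<Rightarrow> real \<Rightarrow> real" where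
  "elapsed h n t = max 0 (min h (t - real n * h))"

lemma time_cell_less: "N \<ge> 1 \<Longrightarrow> time_cell h N t < N"
  by (simp add: time_cell_def min_def) linarith

lemma time_cell_eq:
  assumes "h > 0" "n < N" "real n * h < t" "t < real (Suc n) * h"
  shows "time_cell h N t = n"
proof -
  have "real n \<le> t / h" "t / h < real n + 1" using assms by (simp_all add: field_simps)
  then have "\<lfloor>t / h\<rfloor> = int n" by (simp add: floor_eq_iff)
  then show ?thesis using assms(2) by (simp add: time_cell_def)
qed

lemma elapsed_continuous [continuous_intros]: "continuous_on A (elapsed h n)"
  unfolding elapsed_def by (intro continuous_intros)

lemma elapsed_zero: "h > 0 \<Longrightarrow> t \<le> real n * h \<Longrightarrow> elapsed h n t = 0"
  by (auto simp: elapsed_def max_def min_def)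

lemma elapsed_sum_deriv:
  fixes f :: "nat \<Rightarrow> real"
  assumes h: "h > 0" and mN: "m < N" and lo': "real m * h < s" and hi: "s < real (Suc m) * h"
  shows "((\<lambda>s. \<Sum>n<N. f n * elapsed h n s) has_real_derivative f m) (at s)"
proof -
  define I where "I = {real m * h<..<real (Suc m) * h}"
  have I: "open I" "s \<in> I" using lo' hi by (simp_all add: I_def)
  have dm: "(elapsed h n has_real_derivative (if n = m then 1 else 0)) (at s)" for n
  proof -
    consider "n < m" | "n = m" | "n > m" by linarith
    then show ?thesis
    proof cases
      case 1
      then have "real (Suc n) * h \<le> real m * h" using h by (intro mult_right_mono) auto
      then have "h = elapsed h n y" if "y \<in> I" for y
        using that h by (simp add: elapsed_def I_def algebra_simps)
      then have "(elapsed h n has_real_derivative 0) (at s)"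
        by (rule has_field_derivative_transform_within_open[OF DERIV_const I])
      then show ?thesis using 1 by simp
    next
      case 2
      have d: "((\<lambda>y. y - real n * h) has_real_derivative 1) (at s)"
        by (auto intro!: derivative_eq_intros)
      have "y - real n * h = elapsed h n y" if "y \<in> I" for y
        using that h 2 by (simp add: elapsed_def I_def algebra_simps)
      then have "(elapsed h n has_real_derivative 1) (at s)"
        by (rule has_field_derivative_transform_within_open[OF d I])
      then show ?thesis using 2 by simp
    next
      case 3
      then have le: "real (Suc m) * h \<le> real n * h" using h by (intro mult_right_mono) auto
      have "0 = elapsed h n y" if "y \<in> I" for y
      proof -
        have "y \<le> real (Suc m) * h" using that by (simp add: I_def)
        then show ?thesis using elapsed_zero[OF h order_trans[OF _ le]] by simp
      qed
      then have "(elapsed h n has_real_derivative 0) (at s)"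
        by (rule has_field_derivative_transform_within_open[OF DERIV_const I])
      then show ?thesis using 3 by simp
    qed
  qed
  have "((\<lambda>s. \<Sum>n<N. f n * elapsed h n s) has_real_derivative (\<Sum>n<N. f n * (if n = m then 1 else 0))) (at s)"
    by (intro DERIV_sum DERIV_cmult dm)
  also have "(\<Sum>n<N. f n * (if n = m then 1 else 0)) = (\<Sum>n<N. if n = m then f n else 0)"
    by (intro sum.cong) auto
  also have "\<dots> = f m" using mN by simp
  finally show ?thesis .
qed

text \<open>The primitive is continuous and piecewise linear, so the fundamental theorem applies with the time
  nodes as exceptional points.\<close>

lemma has_integral_time_cell:
  fixes f :: "nat \<Rightarrow> real"
  assumes h: "h > 0" and N: "N \<ge> 1" and t: "0 \<le> t" "t \<le> real N * h"
  shows "((\<lambda>s. f (time_cell h N s)) has_integral (\<Sum>n<N. f n * elapsed h n t)) {0..t}"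
proof -
  define K where "K = (\<lambda>n. real n * h) ` {..N}"
  have "((\<lambda>s. f (time_cell h N s)) has_integral
      ((\<Sum>n<N. f n * elapsed h n t) - (\<Sum>n<N. f n * elapsed h n 0))) {0..t}"
  proof (rule fundamental_theorem_of_calculus_interior_strong)
    show "finite K" by (simp add: K_def)
    show "continuous_on {0..t} (\<lambda>s. \<Sum>n<N. f n * elapsed h n s)"
      by (intro continuous_intros)
    fix s assume s: "s \<in> {0<..<t} - K"
    define m where "m = nat \<lfloor>s / h\<rfloor>"
    have nn: "0 \<le> s / h" using s h by simp
    then have "real m \<le> s / h" unfolding m_def by simp
    then have lo: "real m * h \<le> s" using h by (simp add: pos_le_divide_eq)
    have "s / h < real m + 1" unfolding m_def using nn by linarith
    then have hi: "s < real (Suc m) * h" using h by (simp add: pos_divide_less_eq add.commute)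
    have mN: "m < N"
    proof -
      have "real m * h < real N * h" using lo s t by simp
      then show ?thesis using h by simp
    qed
    have lo': "real m * h < s" using lo s mN by (auto simp: K_def)
    have cellm: "time_cell h N s = m" by (rule time_cell_eq[OF h mN lo' hi])
    from elapsed_sum_deriv[OF h mN lo' hi, of f]
    show "((\<lambda>s. \<Sum>n<N. f n * elapsed h n s) has_vector_derivative f (time_cell h N s)) (at s)"
      by (simp add: has_real_derivative_iff_has_vector_derivative cellm)
  qed (use t in simp)
  moreover have "elapsed h n 0 = 0" for n using h by (intro elapsed_zero) auto
  ultimately show ?thesis by simp
qed

lemma time_cell_borel:
  fixes f :: "nat \<Rightarrow> real"
  shows "(\<lambda>t. f (time_cell h N t)) \<in> borel_measurable borel"
proof -
  have "(\<lambda>t. time_cell h N t) \<in> measurable borel (count_space UNIV)"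
    unfolding time_cell_def by measurable
  then show ?thesis by (rule measurable_compose) simp
qed

lemma set_integrable_time_cell:
  fixes f :: "nat \<Rightarrow> real"
  shows "set_integrable lborel {a..b} (\<lambda>t. f (time_cell h N t))"
  unfolding set_integrable_def
proof (rule integrableI_bounded_set[where A="{a..b}" and B="Max ((\<lambda>n. \<bar>f n\<bar>) ` {..N})"])
  show "(\<lambda>x. indicat_real {a..b} x *\<^sub>R f (time_cell h N x)) \<in> borel_measurable lborel"
    using time_cell_borel[of f h N] by simp
  have "\<bar>f (time_cell h N x)\<bar> \<le> Max ((\<lambda>n. \<bar>f n\<bar>) ` {..N})" for x
    by (intro Max_ge) (auto simp: time_cell_def)
  then show "AE x in lborel. x \<in> {a..b} \<longrightarrow> norm (indicat_real {a..b} x *\<^sub>R f (time_cell h N x)) \<le> Max ((\<lambda>n. \<bar>f n\<bar>) ` {..N})"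
    by (intro AE_I2) (simp add: indicator_def)
qed (auto simp: emeasure_lborel_Icc_eq)

context allen_cahn
begin

lemma continuous_flux:
  assumes "\<phi> \<in> C_time M a b" "\<alpha> \<in> C_time M a b" "v \<in> fem_space M"
  shows "continuous_on {a..b} (\<lambda>t. flx (\<phi> t) (\<alpha> t) v)"
proof -
  have v: "v \<in> bdm" using assms(3) by simp
  have "continuous_on {a..b} (\<lambda>t. - \<delta> * stiff (\<phi> t) v - ip (\<lambda>x. V1 (\<phi> t x)) v / \<delta> + ip (\<alpha> t) v)"
    using \<delta> by (intro continuous_intros continuous_stiff[OF assms(1,3)] continuous_ip[OF assms(2) v]
      continuous_ip_comp[OF assms(1) v L V1_lipschitz V1_bound]) auto
  then show ?thesis
    using flux_eq[OF C_time_fem[OF assms(1)] C_time_fem[OF assms(2)] v]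
    by (subst continuous_on_cong[OF refl]) auto
qed

lemma zero_C_time: "(\<lambda>_ _. 0) \<in> C_time M a b"
  by (simp add: C_time_iff)

lemma flux_control:
  assumes "u \<in> fem_space M" "a \<in> fem_space M" "v \<in> bdm"
  shows "flx u a v = flx u (\<lambda>_. 0) v + ip a v"
  using assms by (simp add: flux_eq)

lemma step_control_L2_time:
  assumes "N \<ge> 1" "c \<in> discrete_controls M N 0"
  shows "(\<lambda>t. c (time_cell h N t)) \<in> L2_time M 0 T"
  unfolding L2_time_def mem_Collect_eq
proof (intro conjI ballI)
  show "c (time_cell h N t) \<in> fem_space M" for t
    using assms time_cell_less[OF assms(1)] by (simp add: discrete_controls_def)
  show "set_borel_measurable lborel {0..T} (\<lambda>t. c (time_cell h N t) x)" for x
    using set_integrable_time_cell[of 0 T "\<lambda>n. c n x" h N]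
    by (auto simp: set_integrable_def set_borel_measurable_def)
  show "set_integrable lborel {0..T} (\<lambda>t. (l2norm (c (time_cell h N t)))\<^sup>2)"
    by (rule set_integrable_time_cell)
qed

lemma step_control_cost:
  assumes "N \<ge> 1" "T > 0"
  shows "(LINT s:{0..T}|lborel. h_cost (c (time_cell (T / real N) N s))) = T / real N * (\<Sum>n<N. h_cost (c n))"
proof -
  let ?h = "T / real N"
  have h: "?h > 0" and hN: "real N * ?h = T" using assms by auto
  have "(LINT s:{0..T}|lborel. h_cost (c (time_cell ?h N s))) = integral {0..T} (\<lambda>s. h_cost (c (time_cell ?h N s)))"
    by (rule set_borel_integral_eq_integral(2)[OF set_integrable_time_cell])
  also have "\<dots> = (\<Sum>n<N. h_cost (c n) * elapsed ?h n T)"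
    by (rule integral_unique) (rule has_integral_time_cell, use h hN assms in auto)
  also have "\<dots> = (\<Sum>n<N. h_cost (c n) * ?h)"
  proof (intro sum.cong refl)
    fix n assume "n \<in> {..<N}"
    then have "real (Suc n) * ?h \<le> real N * ?h" using h by (intro mult_right_mono) auto
    then have "?h \<le> T - real n * ?h" unfolding hN by (simp add: algebra_simps add_divide_distrib)
    then show "h_cost (c n) * elapsed ?h n T = h_cost (c n) * ?h"
      using h unfolding elapsed_def by (simp only: min_absorb1 max_absorb2 less_imp_le)
  qed
  finally show ?thesis by (simp add: sum_distrib_left sum_divide_distrib mult.commute)
qed

text \<open>Coordinate vectors form a Banach space as bounded functions on a discrete index type.\<close>

abbreviation coord :: "(nat discrete \<Rightarrow>\<^sub>C real) \<Rightarrow> nat \<Rightarrow> real" where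
  "coord X i \<equiv> apply_bcontfun X (discrete i)"

definition vec :: "(nat \<Rightarrow> real) \<Rightarrow> (nat discrete \<Rightarrow>\<^sub>C real)" where
  "vec f = Bcontfun (\<lambda>i. if of_discrete i < d then f (of_discrete i) else 0)"

lemma vec_apply: "coord (vec f) i = (if i < d then f i else 0)"
proof -
  let ?g = "\<lambda>i. if of_discrete i < d then f (of_discrete i) else 0"
  have "?g i \<in> insert 0 (f ` {..<d})" for i by auto
  then have "range ?g \<subseteq> insert 0 (f ` {..<d})" by blast
  then have "finite (range ?g)" by (rule finite_subset) simp
  moreover have "continuous_on UNIV ?g"
    by (simp add: continuous_on_open_vimage open_discrete)
  ultimately have "?g \<in> bcontfun" by (auto simp: bcontfun_def intro: finite_imp_bounded)
  then show ?thesis by (simp add: vec_def Bcontfun_inverse discrete_inverse)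
qed

lemma bounded_linear_apply: "bounded_linear (\<lambda>X :: nat discrete \<Rightarrow>\<^sub>C real. coord X i)"
proof (rule bounded_linear_intro[where K = 1])
  show "norm (coord X i) \<le> norm X * 1" for X :: "nat discrete \<Rightarrow>\<^sub>C real"
    using norm_bounded[of X "discrete i"] by simp
qed (simp_all add: plus_bcontfun.rep_eq scaleR_bcontfun.rep_eq)

abbreviation free_flux :: "(real \<Rightarrow> real) \<Rightarrow> (real \<Rightarrow> real) \<Rightarrow> real" where
  "free_flux u \<equiv> flx u (\<lambda>_. 0)"

text \<open>The right-hand side without control is Lipschitz in the coordinates; the constant depends on
  the mesh, which is harmless for existence.\<close>

lemma flux_coords_Lipschitz:
  "\<exists>K>0. \<forall>X Y. norm (vec (\<lambda>i. free_flux (comb (coord X)) (e i)) -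
      vec (\<lambda>i. free_flux (comb (coord Y)) (e i))) \<le> K * norm (X - Y)"
proof -
  define S where "S = (\<Sum>i<d. \<Sum>j<d. \<bar>stiff (e j) (e i)\<bar>)"
  define K where "K = \<delta> * S + L * sqrt (real d) / \<delta> + 1"
  have S: "S \<ge> 0" by (simp add: S_def sum_nonneg)
  have K: "K > 0" using \<delta> L S by (simp add: K_def add_nonneg_pos)
  have "\<bar>free_flux (comb (coord X)) (e i) - free_flux (comb (coord Y)) (e i)\<bar> \<le> K * dist X Y"
    if i: "i < d" for X Y :: "nat discrete \<Rightarrow>\<^sub>C real" and i
  proof -
    let ?u = "comb (coord X)" and ?w = "comb (coord Y)"
    have co: "\<bar>coord X j - coord Y j\<bar> \<le> dist X Y" for j
      using dist_bounded[of X "discrete j" Y] by (simp add: dist_real_def)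
    have [simp]: "?u \<in> bdm" "?w \<in> bdm" by auto
    have "stiff ?u (e i) - stiff ?w (e i) = (\<Sum>j<d. (coord X j - coord Y j) * stiff (e j) (e i))"
      using i by (simp add: stiff_coords ip_comb_basis sum_subtractf left_diff_distrib)
    also have "\<bar>\<dots>\<bar> \<le> (\<Sum>j<d. dist X Y * \<bar>stiff (e j) (e i)\<bar>)"
      by (rule order_trans[OF sum_abs]) (auto simp: abs_mult intro!: sum_mono mult_right_mono co)
    also have "\<dots> = dist X Y * (\<Sum>j<d. \<bar>stiff (e j) (e i)\<bar>)" by (simp add: sum_distrib_left)
    also have "\<dots> \<le> dist X Y * S"
      unfolding S_def using i
      by (intro mult_left_mono member_le_sum[of i "{..<d}" "\<lambda>i. \<Sum>j<d. \<bar>stiff (e j) (e i)\<bar>"]) (auto intro: sum_nonneg)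
    finally have 1: "\<bar>stiff ?u (e i) - stiff ?w (e i)\<bar> \<le> dist X Y * S" .
    have "\<bar>ip (\<lambda>x. V1 (?u x) - V1 (?w x)) (e i)\<bar> \<le> l2norm (\<lambda>x. V1 (?u x) - V1 (?w x)) * l2norm (e i)"
      using i by (intro Cauchy_Schwarz_ip) auto
    also have "l2norm (e i) = 1" using i orthonormal[of i i] by (simp add: l2norm_def)
    also have "l2norm (\<lambda>x. V1 (?u x) - V1 (?w x)) * 1 \<le> L * l2norm (\<lambda>x. ?u x - ?w x)"
      unfolding mult_1_right by (intro l2norm_mono) (use L V1_lipschitz in auto)
    also have "\<dots> \<le> L * (sqrt (real d) * dist X Y)"
    proof (rule mult_left_mono[OF power2_le_imp_le L])
      have "(l2norm (\<lambda>x. ?u x - ?w x))\<^sup>2 = (\<Sum>j<d. (coord X j - coord Y j)\<^sup>2)"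
      proof -
        have "?u \<in> fem_space M" "?w \<in> fem_space M" by (rule comb_fem)+
        then have "(l2norm (\<lambda>x. ?u x - ?w x))\<^sup>2 = (\<Sum>j<d. (ip (\<lambda>x. ?u x - ?w x) (e j))\<^sup>2)"
          unfolding l2norm_sq by (intro ip_self_coords fem_diff)
        also have "\<dots> = (\<Sum>j<d. (coord X j - coord Y j)\<^sup>2)"
          by (intro sum.cong refl) (simp add: ip_diff_left ip_comb_basis)
        finally show ?thesis .
      qed
      also have "\<dots> \<le> (\<Sum>j<d. (dist X Y)\<^sup>2)"
        using co by (intro sum_mono) (simp add: abs_le_square_iff[symmetric])
      finally show "(l2norm (\<lambda>x. ?u x - ?w x))\<^sup>2 \<le> (sqrt (real d) * dist X Y)\<^sup>2"
        by (simp add: power_mult_distrib)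
    qed simp
    finally have 2: "\<bar>ip (\<lambda>x. V1 (?u x)) (e i) - ip (\<lambda>x. V1 (?w x)) (e i)\<bar> \<le> L * sqrt (real d) * dist X Y"
      using i by (subst (asm) ip_diff_left) (auto simp: mult.assoc)
    have eq: "free_flux ?u (e i) - free_flux ?w (e i) =
        - (\<delta> * (stiff ?u (e i) - stiff ?w (e i))) - (ip (\<lambda>x. V1 (?u x)) (e i) - ip (\<lambda>x. V1 (?w x)) (e i)) / \<delta>"
      using i by (simp add: flux_eq diff_divide_distrib algebra_simps)
    have "\<bar>free_flux ?u (e i) - free_flux ?w (e i)\<bar> \<le> \<delta> * \<bar>stiff ?u (e i) - stiff ?w (e i)\<bar> + \<bar>ip (\<lambda>x. V1 (?u x)) (e i) - ip (\<lambda>x. V1 (?w x)) (e i)\<bar> / \<delta>"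
      unfolding eq by (rule order_trans[OF abs_triangle_ineq4]) (use \<delta> in \<open>simp add: abs_mult\<close>)
    also have "\<dots> \<le> \<delta> * (dist X Y * S) + L * sqrt (real d) * dist X Y / \<delta>"
      using \<delta> by (intro add_mono[OF mult_left_mono[OF 1] divide_right_mono[OF 2]]) simp_all
    also have "\<dots> \<le> \<delta> * (dist X Y * S) + L * sqrt (real d) * dist X Y / \<delta> + dist X Y"
      by simp
    also have "\<dots> = K * dist X Y"
      unfolding K_def by (simp add: algebra_simps)
    finally show ?thesis .
  qed
  then have *: "dist (coord (vec (\<lambda>i. free_flux (comb (coord X)) (e i))) j)
      (coord (vec (\<lambda>i. free_flux (comb (coord Y)) (e i))) j) \<le> K * dist X Y" for X Y j
    using K by (auto simp: vec_apply dist_real_def)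
  have "dist (vec (\<lambda>i. free_flux (comb (coord X)) (e i)))
      (vec (\<lambda>i. free_flux (comb (coord Y)) (e i))) \<le> K * dist X Y" for X Y
    by (rule dist_bound) (use *[of X "of_discrete _" Y] in \<open>simp only: of_discrete_inverse\<close>)
  then show ?thesis using K by (auto simp: dist_norm)
qed

text \<open>The coordinates solve the integral equation for the primitive \<open>b\<close> of the step control. Inside a
  time cell the primitive is differentiable, so that the differential equation holds there.\<close>

lemma step_control_state:
  assumes T: "T > 0" and N: "N \<ge> 1" and c: "c \<in> discrete_controls M N 0" and \<phi>0: "\<phi>0 \<in> fem_space M"
  shows "\<exists>\<phi>. \<phi> \<in> C_time M 0 T \<and>
    semidiscrete_state \<delta> T V M \<phi>0 0 (\<lambda>t. c (time_cell (T / real N) N t)) \<phi> \<and>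
    (\<forall>n<N. \<forall>t v. real n * (T / real N) < t \<longrightarrow> t < real (Suc n) * (T / real N) \<longrightarrow> v \<in> fem_space M \<longrightarrow>
      ((\<lambda>s. ip (\<phi> s) v) has_real_derivative flx (\<phi> t) (c (time_cell (T / real N) N t)) v) (at t))"
proof -
  define h where "h = T / real N"
  have h: "h > 0" and hN: "real N * h = T" using T N by (auto simp: h_def)
  have cfem: "c n \<in> fem_space M" if "n < N" for n using c that by (simp add: discrete_controls_def)
  define G where "G X = vec (\<lambda>i. free_flux (comb (coord X)) (e i))" for X
  define b where "b t = vec (\<lambda>i. ip \<phi>0 (e i)) + (\<Sum>n<N. elapsed h n t *\<^sub>R vec (\<lambda>i. ip (c n) (e i)))" for t
  obtain K where K: "K > 0" "\<And>X Y. norm (G X - G Y) \<le> K * norm (X - Y)"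
    using flux_coords_Lipschitz unfolding G_def by blast
  have contb: "continuous_on {0..T} b" unfolding b_def by (intro continuous_intros)
  have "\<exists>X. continuous_on {0..T} X \<and> (\<forall>t\<in>{0..T}. X t = b t + integral {0..t} (\<lambda>s. G (X s)))"
    by (rule Picard_global[where L = K]) (use T contb K in simp_all)
  then obtain X where contX: "continuous_on {0..T} X"
    and X: "\<And>t. t \<in> {0..T} \<Longrightarrow> X t = b t + integral {0..t} (\<lambda>s. G (X s))" by blast
  define \<phi> where "\<phi> t = comb (coord (X t))" for t
  have contXi: "continuous_on {0..T} (\<lambda>t. coord (X t) i)" for i
    using bounded_linear.continuous_on[OF bounded_linear_apply contX] .
  have \<phi>C: "\<phi> \<in> C_time M 0 T" unfolding \<phi>_def by (intro comb_C_time contXi)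
  have \<phi>fem: "\<phi> t \<in> fem_space M" for t by (simp add: \<phi>_def)
  have contf: "continuous_on {0..T} (\<lambda>s. free_flux (\<phi> s) v)" if "v \<in> fem_space M" for v
    by (rule continuous_flux[OF \<phi>C zero_C_time that])
  have contf': "continuous_on {0..t} (\<lambda>s. free_flux (\<phi> s) v)" if "v \<in> fem_space M" "t \<in> {0..T}" for v t
    using contf[OF that(1)] that(2) by (auto intro: continuous_on_subset)
  have contG: "continuous_on {0..T} (\<lambda>s. G (X s))"
    by (rule continuous_on_compose2[OF lipschitz_on_continuous_on[of K UNIV G] contX])
      (use K in \<open>auto simp: lipschitz_on_def dist_norm\<close>)
  have basis: "ip (\<phi> t) (e i) = ip \<phi>0 (e i) + (\<Sum>n<N. ip (c n) (e i) * elapsed h n t)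
      + integral {0..t} (\<lambda>s. free_flux (\<phi> s) (e i))" if t: "t \<in> {0..T}" and i: "i < d" for t i
  proof -
    interpret ev: bounded_linear "\<lambda>X :: nat discrete \<Rightarrow>\<^sub>C real. coord X i" by (rule bounded_linear_apply)
    have int: "(\<lambda>s. G (X s)) integrable_on {0..t}"
      using contG t by (intro integrable_continuous_real) (auto intro: continuous_on_subset)
    have "ip (\<phi> t) (e i) = coord (X t) i" using i by (simp add: \<phi>_def ip_comb_basis)
    also have "\<dots> = coord (b t) i + coord (integral {0..t} (\<lambda>s. G (X s))) i"
      unfolding X[OF t] by (rule ev.add)
    also have "coord (b t) i = ip \<phi>0 (e i) + (\<Sum>n<N. ip (c n) (e i) * elapsed h n t)"
      unfolding b_def ev.add ev.sum ev.scaleR using i by (simp add: vec_apply mult.commute)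
    also have "coord (integral {0..t} (\<lambda>s. G (X s))) i = integral {0..t} (\<lambda>s. free_flux (\<phi> s) (e i))"
      using integral_linear[OF int bounded_linear_apply[of i]] i
      by (simp add: o_def G_def vec_apply \<phi>_def)
    finally show ?thesis .
  qed
  have main: "ip (\<phi> t) v = ip \<phi>0 v + (\<Sum>n<N. ip (c n) v * elapsed h n t)
      + integral {0..t} (\<lambda>s. free_flux (\<phi> s) v)" if t: "t \<in> {0..T}" and v: "v \<in> fem_space M" for t v
  proof -
    have co: "ip w v = (\<Sum>i<d. ip v (e i) * ip w (e i))" if "w \<in> fem_space M" for w
      using ip_coords[OF v fem_bdm_M[OF that]] by (simp only: ip_commute[of _ w])
    have "integral {0..t} (\<lambda>s. free_flux (\<phi> s) v) =
        integral {0..t} (\<lambda>s. \<Sum>i<d. ip v (e i) * free_flux (\<phi> s) (e i))"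
      using flux_coords[OF \<phi>fem fem_zero v] by (intro integral_cong) simp
    also have "\<dots> = (\<Sum>i<d. integral {0..t} (\<lambda>s. ip v (e i) * free_flux (\<phi> s) (e i)))"
      by (intro integral_sum integrable_continuous_real continuous_intros contf' t basis_fem) auto
    also have "\<dots> = (\<Sum>i<d. ip v (e i) * integral {0..t} (\<lambda>s. free_flux (\<phi> s) (e i)))"
      by simp
    finally have 1: "integral {0..t} (\<lambda>s. free_flux (\<phi> s) v) =
      (\<Sum>i<d. ip v (e i) * integral {0..t} (\<lambda>s. free_flux (\<phi> s) (e i)))" .
    have "(\<Sum>n<N. ip (c n) v * elapsed h n t) = (\<Sum>n<N. \<Sum>i<d. ip v (e i) * (ip (c n) (e i) * elapsed h n t))"
      using co[OF cfem] by (intro sum.cong) (auto simp: sum_distrib_right mult.assoc)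
    also have "\<dots> = (\<Sum>i<d. \<Sum>n<N. ip v (e i) * (ip (c n) (e i) * elapsed h n t))"
      by (rule sum.swap)
    also have "\<dots> = (\<Sum>i<d. ip v (e i) * (\<Sum>n<N. ip (c n) (e i) * elapsed h n t))"
      by (simp add: sum_distrib_left)
    finally have 2: "(\<Sum>n<N. ip (c n) v * elapsed h n t) = (\<Sum>i<d. ip v (e i) * (\<Sum>n<N. ip (c n) (e i) * elapsed h n t))" .
    have "ip (\<phi> t) v = (\<Sum>i<d. ip v (e i) * ip (\<phi> t) (e i))" by (rule co[OF \<phi>fem])
    also have "\<dots> = (\<Sum>i<d. ip v (e i) * ip \<phi>0 (e i) + ip v (e i) * (\<Sum>n<N. ip (c n) (e i) * elapsed h n t)
        + ip v (e i) * integral {0..t} (\<lambda>s. free_flux (\<phi> s) (e i)))"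
      using basis[OF t] by (intro sum.cong) (auto simp: distrib_left)
    also have "\<dots> = ip \<phi>0 v + (\<Sum>n<N. ip (c n) v * elapsed h n t)
      + integral {0..t} (\<lambda>s. free_flux (\<phi> s) v)"
      unfolding 1 2 co[OF \<phi>0] by (simp add: sum.distrib)
    finally show ?thesis .
  qed
  have split: "flx (\<phi> s) (c (time_cell h N s)) v = free_flux (\<phi> s) v + ip (c (time_cell h N s)) v"
    if "v \<in> fem_space M" for s v
    using that by (intro flux_control \<phi>fem cfem time_cell_less[OF N]) simp
  have "X 0 = b 0" using X[of 0] T by simp
  then have "coord (X 0) i = (if i < d then ip \<phi>0 (e i) else 0)" for i
    using h by (simp add: b_def elapsed_zero vec_apply)
  then have "\<phi> 0 = comb (\<lambda>i. ip \<phi>0 (e i))" unfolding \<phi>_def comb_def by (intro ext sum.cong) auto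
  then have init: "\<phi> 0 = \<phi>0" by (simp add: comb_coords[OF \<phi>0])
  have "semidiscrete_state \<delta> T V M \<phi>0 0 (\<lambda>t. c (time_cell h N t)) \<phi>"
    unfolding semidiscrete_state_def
  proof (intro conjI ballI \<phi>C init)
    fix v t assume v: "v \<in> fem_space M" and t: "t \<in> {0..T}"
    have "(LINT s:{0..t}|lborel. flx (\<phi> s) (c (time_cell h N s)) v) =
        (LINT s:{0..t}|lborel. free_flux (\<phi> s) v + ip (c (time_cell h N s)) v)"
      by (simp only: split[OF v])
    also have "\<dots> = (LINT s:{0..t}|lborel. free_flux (\<phi> s) v) + (LINT s:{0..t}|lborel. ip (c (time_cell h N s)) v)"
      by (intro set_integral_add borel_integrable_atLeastAtMost' contf' v t set_integrable_time_cell[of 0 t "\<lambda>n. ip (c n) v"])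
    also have "(LINT s:{0..t}|lborel. free_flux (\<phi> s) v) = integral {0..t} (\<lambda>s. free_flux (\<phi> s) v)"
      by (intro set_borel_integral_eq_integral borel_integrable_atLeastAtMost' contf' v t)
    also have "(LINT s:{0..t}|lborel. ip (c (time_cell h N s)) v) = integral {0..t} (\<lambda>s. ip (c (time_cell h N s)) v)"
      by (rule set_borel_integral_eq_integral(2)[OF set_integrable_time_cell[of 0 t "\<lambda>n. ip (c n) v"]])
    also have "\<dots> = (\<Sum>n<N. ip (c n) v * elapsed h n t)"
      using t hN by (intro integral_unique has_integral_time_cell[OF h N]) auto
    finally show "ip (\<phi> t) v = ip \<phi>0 v + (LINT s:{0..t}|lborel. flx (\<phi> s) (c (time_cell h N s)) v)"
      using main[OF t v] by simp
  qed
  moreover have "((\<lambda>s. ip (\<phi> s) v) has_real_derivative flx (\<phi> t) (c (time_cell h N t)) v) (at t)"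
    if n: "n < N" and t: "real n * h < t" "t < real (Suc n) * h" and v: "v \<in> fem_space M" for n t v
  proof -
    have "real (Suc n) * h \<le> real N * h" using n h by (intro mult_right_mono) auto
    moreover have "0 \<le> real n * h" using h by simp
    ultimately have t': "0 < t" "t < T" using t hN by auto
    have "((\<lambda>s. integral {0..s} (\<lambda>s. free_flux (\<phi> s) v)) has_real_derivative free_flux (\<phi> t) v) (at t within {0..T})"
      using t' by (intro integral_has_real_derivative contf v) auto
    then have i: "((\<lambda>s. integral {0..s} (\<lambda>s. free_flux (\<phi> s) v)) has_real_derivative free_flux (\<phi> t) v) (at t)"
      using t' by (simp add: at_within_Icc_at)
    have "((\<lambda>s. ip \<phi>0 v + (\<Sum>n<N. ip (c n) v * elapsed h n s)
      + integral {0..s} (\<lambda>s. free_flux (\<phi> s) v)) has_real_derivative 0 + ip (c n) v + free_flux (\<phi> t) v) (at t)"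
      by (intro DERIV_add DERIV_const elapsed_sum_deriv[OF h n t] i)
    moreover have "0 + ip (c n) v + free_flux (\<phi> t) v = flx (\<phi> t) (c (time_cell h N t)) v"
      using split[OF v, of t] by (simp add: time_cell_eq[OF h n t])
    ultimately have "((\<lambda>s. ip \<phi>0 v + (\<Sum>n<N. ip (c n) v * elapsed h n s)
      + integral {0..s} (\<lambda>s. free_flux (\<phi> s) v)) has_real_derivative flx (\<phi> t) (c (time_cell h N t)) v) (at t)"
      by simp
    then show ?thesis
    proof (rule has_field_derivative_transform_within_open[of _ _ _ "{0<..<T}"])
      show "ip \<phi>0 v + (\<Sum>n<N. ip (c n) v * elapsed h n s) + integral {0..s} (\<lambda>s. free_flux (\<phi> s) v) = ip (\<phi> s) v"
        if "s \<in> {0<..<T}" for s using main[of s v] v that by simp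
    qed (use t' in auto)
  qed
  ultimately show ?thesis using \<phi>C unfolding h_def by blast
qed

end

section \<open>First-order optimality\<close>

text \<open>Testing with \<open>\<zeta> = p + \<integral>q + c\<close> itself turns the weak identity into
  the vanishing of an integral of a square.\<close>

lemma du_Bois_Reymond:
  fixes p q :: "real \<Rightarrow> real"
  assumes T: "T > 0" and p: "continuous_on {0..T} p" and q: "continuous_on {0..T} q"
    and weak: "\<And>\<zeta>. continuous_on {0..T} \<zeta> \<Longrightarrow>
      c * integral {0..T} \<zeta> + integral {0..T} (\<lambda>t. \<zeta> t * p t + integral {0..t} \<zeta> * q t) = 0"
    and t: "t \<in> {0..T}"
  shows "p t = - c - integral {t..T} q"
proof -
  define Q where "Q t = integral {t..T} q" for t
  define \<zeta> where "\<zeta> t = p t + Q t + c" for t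
  define \<eta> where "\<eta> t = integral {0..t} \<zeta>" for t
  have dQ: "(Q has_real_derivative - q t) (at t within {0..T})" if "t \<in> {0..T}" for t
    unfolding Q_def by (rule integral_has_real_derivative'[OF q that])
  have cQ: "continuous_on {0..T} Q"
    using dQ by (intro DERIV_continuous_on) auto
  have c\<zeta>: "continuous_on {0..T} \<zeta>" unfolding \<zeta>_def by (intro continuous_intros p cQ)
  have d\<eta>: "(\<eta> has_real_derivative \<zeta> t) (at t within {0..T})" if "t \<in> {0..T}" for t
    unfolding \<eta>_def by (rule integral_has_real_derivative[OF c\<zeta> that])
  have c\<eta>: "continuous_on {0..T} \<eta>"
    using d\<eta> by (intro DERIV_continuous_on) auto
  have "((\<lambda>t. \<zeta> t * Q t - \<eta> t * q t) has_integral (\<eta> T * Q T - \<eta> 0 * Q 0)) {0..T}"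
  proof (rule fundamental_theorem_of_calculus[OF less_imp_le[OF T]])
    fix t assume t: "t \<in> {0..T}"
    have "((\<lambda>t. \<eta> t * Q t) has_real_derivative (\<zeta> t * Q t + (- q t) * \<eta> t)) (at t within {0..T})"
      by (rule DERIV_mult[OF d\<eta>[OF t] dQ[OF t]])
    then show "((\<lambda>t. \<eta> t * Q t) has_vector_derivative \<zeta> t * Q t - \<eta> t * q t) (at t within {0..T})"
      by (simp add: has_real_derivative_iff_has_vector_derivative mult.commute)
  qed
  moreover have "\<eta> T * Q T - \<eta> 0 * Q 0 = 0" by (simp add: Q_def \<eta>_def)
  ultimately have 1: "((\<lambda>t. \<zeta> t * Q t - \<eta> t * q t) has_integral 0) {0..T}" by simp
  have 2: "((\<lambda>t. \<zeta> t * p t + \<eta> t * q t) has_integral integral {0..T} (\<lambda>t. \<zeta> t * p t + \<eta> t * q t)) {0..T}"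
    by (intro integrable_integral integrable_continuous_real continuous_intros c\<zeta> c\<eta> p q)
  have 3: "((\<lambda>t. c * \<zeta> t) has_integral c * integral {0..T} \<zeta>) {0..T}"
    by (intro has_integral_mult_right integrable_integral integrable_continuous_real c\<zeta>)
  have e1: "((\<lambda>t. c * \<zeta> t + (\<zeta> t * p t + \<eta> t * q t) + (\<zeta> t * Q t - \<eta> t * q t)) has_integral
      (c * integral {0..T} \<zeta> + integral {0..T} (\<lambda>t. \<zeta> t * p t + \<eta> t * q t) + 0)) {0..T}"
    by (intro has_integral_add 1 2 3)
  have e2: "c * integral {0..T} \<zeta> + integral {0..T} (\<lambda>t. \<zeta> t * p t + \<eta> t * q t) + 0 = 0"
    using weak[OF c\<zeta>] by (simp add: \<eta>_def)
  have e3: "c * \<zeta> t + (\<zeta> t * p t + \<eta> t * q t) + (\<zeta> t * Q t - \<eta> t * q t) = \<zeta> t * \<zeta> t" for t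
    unfolding \<zeta>_def by (simp add: algebra_simps)
  have "((\<lambda>t. \<zeta> t * \<zeta> t) has_integral
      (c * integral {0..T} \<zeta> + integral {0..T} (\<lambda>t. \<zeta> t * p t + \<eta> t * q t) + 0)) {0..T}"
    using e1 by (simp only: e3)
  then have "((\<lambda>t. \<zeta> t * \<zeta> t) has_integral 0) {0..T}" by (simp only: e2)
  then have i0: "integral {0..T} (\<lambda>t. \<zeta> t * \<zeta> t) = 0" by (rule integral_unique)
  have "continuous_on {0..T} (\<lambda>t. \<zeta> t * \<zeta> t)" by (intro continuous_intros c\<zeta>)
  then have "integral {0..T} (\<lambda>t. \<zeta> t * \<zeta> t) = 0 \<longleftrightarrow> (\<forall>t\<in>{0..T}. \<zeta> t * \<zeta> t = 0)"
    by (rule integral_eq_0_iff[OF _ T]) (rule zero_le_square)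
  with i0 have "\<zeta> t * \<zeta> t = 0" using t by blast
  then have "\<zeta> t = 0" by simp
  then show ?thesis by (simp add: \<zeta>_def Q_def)
qed

text \<open>The value
  \<open>\<epsilon> = - P / (\<bar>P\<bar> + C + 1)\<close> is admissible, and it makes the expression negative when \<open>P \<noteq> 0\<close>.\<close>

lemma linear_coefficient_zero:
  fixes P C :: real
  assumes "C \<ge> 0" "\<And>\<epsilon>. \<bar>\<epsilon>\<bar> \<le> 1 \<Longrightarrow> 0 \<le> \<epsilon> * P + C * \<epsilon>\<^sup>2"
  shows "P = 0"
proof (rule ccontr)
  assume P: "P \<noteq> 0"
  define k where "k = \<bar>P\<bar> + C + 1"
  have k: "k > 0" "k \<ge> \<bar>P\<bar>" "k > C" using assms(1) by (auto simp: k_def)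
  have "\<bar>- P / k\<bar> \<le> 1" using k by (simp add: abs_divide)
  then have "0 \<le> - P / k * P + C * (- P / k)\<^sup>2" by (rule assms(2))
  also have "\<dots> = P\<^sup>2 / k\<^sup>2 * (C - k)"
    using k(1) by (simp add: power2_eq_square field_simps)
  also have "\<dots> < 0" using P k by (intro mult_pos_neg) auto
  finally show False by simp
qed

context allen_cahn
begin

lemma state_integral:
  assumes "semidiscrete_state \<delta> T V M \<phi>0 0 \<alpha> \<phi>" "\<alpha> \<in> C_time M 0 T" "v \<in> fem_space M" "t \<in> {0..T}"
  shows "ip (\<phi> t) v = ip \<phi>0 v + integral {0..t} (\<lambda>s. flx (\<phi> s) (\<alpha> s) v)"
proof -
  have \<phi>: "\<phi> \<in> C_time M 0 T" using assms(1) by (simp add: semidiscrete_state_def)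
  have "continuous_on {0..t} (\<lambda>s. flx (\<phi> s) (\<alpha> s) v)"
    using continuous_flux[OF \<phi> assms(2,3)] assms(4) by (auto intro: continuous_on_subset)
  then have "(LINT s:{0..t}|lborel. flx (\<phi> s) (\<alpha> s) v) = integral {0..t} (\<lambda>s. flx (\<phi> s) (\<alpha> s) v)"
    by (intro set_borel_integral_eq_integral borel_integrable_atLeastAtMost')
  then show ?thesis using assms by (simp add: semidiscrete_state_def)
qed

lemma state_derivative:
  assumes "semidiscrete_state \<delta> T V M \<phi>0 0 \<alpha> \<phi>" "\<alpha> \<in> C_time M 0 T" "v \<in> fem_space M" "0 < t" "t < T"
  shows "((\<lambda>s. ip (\<phi> s) v) has_real_derivative flx (\<phi> t) (\<alpha> t) v) (at t)"
proof -
  have \<phi>: "\<phi> \<in> C_time M 0 T" using assms(1) by (simp add: semidiscrete_state_def)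
  have "((\<lambda>s. integral {0..s} (\<lambda>s. flx (\<phi> s) (\<alpha> s) v)) has_real_derivative flx (\<phi> t) (\<alpha> t) v) (at t within {0..T})"
    using assms(4,5) by (intro integral_has_real_derivative continuous_flux[OF \<phi> assms(2,3)]) auto
  then have "((\<lambda>s. integral {0..s} (\<lambda>s. flx (\<phi> s) (\<alpha> s) v)) has_real_derivative flx (\<phi> t) (\<alpha> t) v) (at t)"
    using assms(4,5) by (simp add: at_within_Icc_at)
  then have "((\<lambda>s. ip \<phi>0 v + integral {0..s} (\<lambda>s. flx (\<phi> s) (\<alpha> s) v)) has_real_derivative 0 + flx (\<phi> t) (\<alpha> t) v) (at t)"
    by (intro DERIV_add DERIV_const)
  then have "((\<lambda>s. ip \<phi>0 v + integral {0..s} (\<lambda>s. flx (\<phi> s) (\<alpha> s) v)) has_real_derivative flx (\<phi> t) (\<alpha> t) v) (at t)"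
    by simp
  then show ?thesis
  proof (rule has_field_derivative_transform_within_open[of _ _ _ "{0<..<T}"])
    show "ip \<phi>0 v + integral {0..s} (\<lambda>s. flx (\<phi> s) (\<alpha> s) v) = ip (\<phi> s) v" if "s \<in> {0<..<T}" for s
      using state_integral[OF assms(1-3), of s] that by simp
  qed (use assms(4,5) in auto)
qed

lemma u_bar_le:
  assumes "K > 0" "\<alpha> \<in> L2_time M 0 T" "semidiscrete_state \<delta> T V M \<phi>0 0 \<alpha> \<phi>"
  shows "u_bar \<delta> T K V \<phi>m M \<phi>0 0 \<le> semidiscrete_cost T K \<phi>m 0 \<alpha> \<phi>"
  unfolding u_bar_def
proof (rule cInf_lower)
  show "bdd_below {semidiscrete_cost T K \<phi>m 0 \<alpha> \<phi> |\<alpha> \<phi>. \<alpha> \<in> L2_time M 0 T \<and> semidiscrete_state \<delta> T V M \<phi>0 0 \<alpha> \<phi>}"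
  proof (rule bdd_belowI[of _ 0])
    have "0 \<le> semidiscrete_cost T K \<phi>m 0 \<alpha> \<phi>" for \<alpha> \<phi>
      unfolding semidiscrete_cost_def g_cost_def h_cost_def set_lebesgue_integral_def
      using assms(1) by (intro add_nonneg_nonneg integral_nonneg) auto
    then show "0 \<le> x" if "x \<in> {semidiscrete_cost T K \<phi>m 0 \<alpha> \<phi> |\<alpha> \<phi>. \<alpha> \<in> L2_time M 0 T \<and> semidiscrete_state \<delta> T V M \<phi>0 0 \<alpha> \<phi>}" for x
      using that by auto
  qed
qed (use assms in auto)

end

locale optimal_control = allen_cahn M d e \<delta> L V
  for M d :: nat and e :: "nat \<Rightarrow> real \<Rightarrow> real" and \<delta> L :: real and V :: "real \<Rightarrow> real" +
  fixes T K :: real and \<phi>m \<phi>0 :: "real \<Rightarrow> real" and \<alpha> \<phi> :: "real \<Rightarrow> real \<Rightarrow> real"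
  assumes T: "T > 0" and K: "K > 0" and \<phi>m [simp]: "\<phi>m \<in> bdm"
    and \<alpha>: "\<alpha> \<in> C_time M 0 T" and state: "semidiscrete_state \<delta> T V M \<phi>0 0 \<alpha> \<phi>"
    and optimal: "semidiscrete_cost T K \<phi>m 0 \<alpha> \<phi> = u_bar \<delta> T K V \<phi>m M \<phi>0 0"
begin

lemma \<phi>: "\<phi> \<in> C_time M 0 T" using state by (simp add: semidiscrete_state_def)

lemma \<phi>_fem: "t \<in> {0..T} \<Longrightarrow> \<phi> t \<in> fem_space M" by (rule C_time_fem[OF \<phi>])
lemma \<alpha>_fem: "t \<in> {0..T} \<Longrightarrow> \<alpha> t \<in> fem_space M" by (rule C_time_fem[OF \<alpha>])

text \<open>The linearization of the state equation at the optimal state, up to sign. As a form it is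
  symmetric, which is why the same form drives the adjoint equation.\<close>

definition adj :: "(real \<Rightarrow> real) \<Rightarrow> real \<Rightarrow> (real \<Rightarrow> real) \<Rightarrow> real" where
  "adj v t w = \<delta> * stiff v w + ip (\<lambda>x. V2 (\<phi> t x) * v x) w / \<delta>"

lemma adj_coords:
  assumes "v \<in> fem_space M" "w \<in> fem_space M" "t \<in> {0..T}"
  shows "adj v t w = (\<Sum>i<d. ip w (e i) * adj v t (e i))"
proof -
  let ?f = "\<lambda>x. V2 (\<phi> t x) * v x"
  have f: "?f \<in> bdm" using assms \<phi>_fem[OF assms(3)] by (intro bdm_mult V2_bdm) auto
  have 1: "stiff v w = (\<Sum>i<d. ip w (e i) * stiff v (e i))"
    using stiff_coords[OF assms(2,1)] by (simp only: stiff_commute[of _ v])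
  have 2: "ip ?f w = (\<Sum>i<d. ip w (e i) * ip ?f (e i))"
    using ip_coords[OF assms(2) f] by (simp only: ip_commute[of _ ?f])
  show ?thesis unfolding adj_def 1 2
    by (simp add: sum.distrib sum_distrib_left sum_divide_distrib distrib_left mult_ac)
qed

lemma adj_commute: "adj v t w = adj w t v"
  unfolding adj_def stiff_commute[of v w] by (simp add: ip_def mult_ac)

lemma adj_continuous:
  assumes "v \<in> fem_space M" "w \<in> fem_space M"
  shows "continuous_on {0..T} (\<lambda>t. adj v t w)"
proof -
  have "ip (\<lambda>x. V2 (\<phi> t x) * v x) w = ip (\<lambda>x. V2 (\<phi> t x)) (\<lambda>x. v x * w x)" for t
    by (simp add: ip_def mult.assoc)
  moreover have "continuous_on {0..T} (\<lambda>t. ip (\<lambda>x. V2 (\<phi> t x)) (\<lambda>x. v x * w x))"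
    using assms by (intro continuous_ip_comp[OF \<phi> _ L V2_lipschitz V2_bound]) auto
  ultimately show ?thesis unfolding adj_def using \<delta> by (intro continuous_intros) auto
qed

lemma adj_control_continuous:
  assumes "v \<in> fem_space M" shows "continuous_on {0..T} (\<lambda>t. adj v t (\<alpha> t))"
proof -
  have "continuous_on {0..T} (\<lambda>t. \<Sum>i<d. ip (\<alpha> t) (e i) * adj v t (e i))"
    using \<alpha> assms by (intro continuous_intros adj_continuous) (auto simp: C_time_iff)
  then show ?thesis
    using adj_coords[OF assms \<alpha>_fem] by (subst continuous_on_cong[OF refl]) auto
qed

text \<open>Varying the state rather than the control: every perturbation \<open>\<epsilon> \<eta>(t) v\<close> of the optimal
  state is again a state, for the control that is read off from the equation. This control is the
  optimal one plus the Riesz representer of the functional \<open>defect\<close>, so that the first variation of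
  the cost is explicit.\<close>

definition defect :: "(real \<Rightarrow> real) \<Rightarrow> (real \<Rightarrow> real) \<Rightarrow> real \<Rightarrow> real \<Rightarrow> (real \<Rightarrow> real) \<Rightarrow> real" where
  "defect v \<zeta> \<epsilon> t w = \<epsilon> * \<zeta> t * ip v w + \<delta> * (\<epsilon> * integral {0..t} \<zeta>) * stiff v w +
     (ip (\<lambda>x. V1 (\<phi> t x + \<epsilon> * integral {0..t} \<zeta> * v x)) w - ip (\<lambda>x. V1 (\<phi> t x)) w) / \<delta>"

definition varied_state :: "(real \<Rightarrow> real) \<Rightarrow> (real \<Rightarrow> real) \<Rightarrow> real \<Rightarrow> real \<Rightarrow> real \<Rightarrow> real" where
  "varied_state v \<zeta> \<epsilon> t = (\<lambda>x. \<phi> t x + \<epsilon> * integral {0..t} \<zeta> * v x)"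

definition varied_control :: "(real \<Rightarrow> real) \<Rightarrow> (real \<Rightarrow> real) \<Rightarrow> real \<Rightarrow> real \<Rightarrow> real \<Rightarrow> real" where
  "varied_control v \<zeta> \<epsilon> t = (\<lambda>x. \<alpha> t x + comb (\<lambda>i. defect v \<zeta> \<epsilon> t (e i)) x)"

context
  fixes v :: "real \<Rightarrow> real" and \<zeta> :: "real \<Rightarrow> real"
  assumes v [simp]: "v \<in> fem_space M" and \<zeta>: "continuous_on {0..T} \<zeta>"
begin

abbreviation (input) \<eta> :: "real \<Rightarrow> real" where "\<eta> t \<equiv> integral {0..t} \<zeta>"

lemma \<eta>_continuous: "continuous_on {0..T} \<eta>"
  by (intro indefinite_integral_continuous_1 integrable_continuous_real \<zeta>)

lemma varied_state_fem: "t \<in> {0..T} \<Longrightarrow> varied_state v \<zeta> \<epsilon> t \<in> fem_space M"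
  unfolding varied_state_def by (intro fem_lincomb \<phi>_fem v)

lemma varied_state_C_time: "varied_state v \<zeta> \<epsilon> \<in> C_time M 0 T"
  unfolding C_time_iff
proof (intro conjI ballI allI impI varied_state_fem)
  fix i assume i: "i < d"
  have "continuous_on {0..T} (\<lambda>t. ip (\<phi> t) (e i) + \<epsilon> * \<eta> t * ip v (e i))"
    using i by (intro continuous_intros continuous_ip[OF \<phi>] \<eta>_continuous) auto
  moreover have "ip (varied_state v \<zeta> \<epsilon> t) (e i) = ip (\<phi> t) (e i) + \<epsilon> * \<eta> t * ip v (e i)" if "t \<in> {0..T}" for t
    unfolding varied_state_def using \<phi>_fem[OF that] i
    by (subst ip_add_left) (auto simp only: ip_scale_left fem_bdm_M v basis_bdm intro!: bdm_mult bdm_const)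
  ultimately show "continuous_on {0..T} (\<lambda>t. ip (varied_state v \<zeta> \<epsilon> t) (e i))"
    by (subst continuous_on_cong[OF refl]) auto
qed

lemma defect_coords:
  assumes t: "t \<in> {0..T}" and w: "w \<in> fem_space M"
  shows "defect v \<zeta> \<epsilon> t w = (\<Sum>i<d. ip w (e i) * defect v \<zeta> \<epsilon> t (e i))"
proof -
  have co: "ip f w = (\<Sum>i<d. ip w (e i) * ip f (e i))" if "f \<in> bdm" for f
    using ip_coords[OF w that] by (simp only: ip_commute[of _ f])
  have b: "\<phi> t \<in> bdm" "(\<lambda>x. \<phi> t x + \<epsilon> * \<eta> t * v x) \<in> bdm"
    using fem_bdm_M[OF \<phi>_fem[OF t]] fem_bdm_M[OF varied_state_fem[OF t, of \<epsilon>]] by (simp_all add: varied_state_def)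
  have 1: "stiff v w = (\<Sum>i<d. ip w (e i) * stiff v (e i))"
    using stiff_coords[OF w v] by (simp only: stiff_commute[of _ v])
  show ?thesis
    unfolding defect_def 1 co[OF fem_bdm_M[OF v]] co[OF V1_bdm[OF b(1)]] co[OF V1_bdm[OF b(2)]]
    by (simp add: sum.distrib sum_subtractf sum_distrib_left sum_divide_distrib distrib_left
        right_diff_distrib diff_divide_distrib mult_ac)
qed

lemma defect_continuous:
  assumes "w \<in> fem_space M" shows "continuous_on {0..T} (\<lambda>t. defect v \<zeta> \<epsilon> t w)"
proof -
  have w: "w \<in> bdm" using assms by simp
  have 1: "continuous_on {0..T} (\<lambda>t. ip (\<lambda>x. V1 (\<phi> t x + \<epsilon> * \<eta> t * v x)) w)"
    using continuous_ip_comp[OF varied_state_C_time w L V1_lipschitz V1_bound, of \<epsilon>]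
    by (simp add: varied_state_def)
  have 2: "continuous_on {0..T} (\<lambda>t. ip (\<lambda>x. V1 (\<phi> t x)) w)"
    by (rule continuous_ip_comp[OF \<phi> w L V1_lipschitz V1_bound])
  show ?thesis unfolding defect_def using \<delta>
    by (intro continuous_intros 1 2 \<eta>_continuous \<zeta>) auto
qed

lemma varied_control_coords:
  assumes "t \<in> {0..T}" "w \<in> fem_space M"
  shows "ip (varied_control v \<zeta> \<epsilon> t) w = ip (\<alpha> t) w + defect v \<zeta> \<epsilon> t w"
proof -
  have "ip (varied_control v \<zeta> \<epsilon> t) w = ip (\<alpha> t) w + ip (comb (\<lambda>i. defect v \<zeta> \<epsilon> t (e i))) w"
    unfolding varied_control_def using assms \<alpha>_fem[OF assms(1)] by (intro ip_add_left) auto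
  then show ?thesis
    using ip_comb_eq_linear[of w "defect v \<zeta> \<epsilon> t"] assms(2) defect_coords[OF assms] by simp
qed

lemma varied_control_C_time: "varied_control v \<zeta> \<epsilon> \<in> C_time M 0 T"
  unfolding C_time_iff
proof (intro conjI ballI allI impI)
  show "varied_control v \<zeta> \<epsilon> t \<in> fem_space M" if "t \<in> {0..T}" for t
    unfolding varied_control_def by (intro fem_add \<alpha>_fem that comb_fem)
  fix i assume i: "i < d"
  have "continuous_on {0..T} (\<lambda>t. ip (\<alpha> t) (e i) + defect v \<zeta> \<epsilon> t (e i))"
    using i by (intro continuous_intros continuous_ip[OF \<alpha>] defect_continuous) auto
  then show "continuous_on {0..T} (\<lambda>t. ip (varied_control v \<zeta> \<epsilon> t) (e i))"
    using varied_control_coords i by (subst continuous_on_cong[OF refl]) auto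
qed

lemma varied_flux:
  assumes t: "t \<in> {0..T}" and w: "w \<in> fem_space M"
  shows "flx (varied_state v \<zeta> \<epsilon> t) (varied_control v \<zeta> \<epsilon> t) w =
    flx (\<phi> t) (\<alpha> t) w + \<epsilon> * \<zeta> t * ip v w"
proof -
  have s: "stiff (varied_state v \<zeta> \<epsilon> t) w = stiff (\<phi> t) w + \<epsilon> * \<eta> t * stiff v w"
    unfolding varied_state_def using \<phi>_fem[OF t] w by (intro stiff_lincomb_left[OF M]) auto
  have "flx (varied_state v \<zeta> \<epsilon> t) (varied_control v \<zeta> \<epsilon> t) w =
      - \<delta> * (stiff (\<phi> t) w + \<epsilon> * \<eta> t * stiff v w) - ip (\<lambda>x. V1 (varied_state v \<zeta> \<epsilon> t x)) w / \<delta>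
      + (ip (\<alpha> t) w + defect v \<zeta> \<epsilon> t w)"
    using flux_eq[OF varied_state_fem[OF t] C_time_fem[OF varied_control_C_time t] fem_bdm_M[OF w]]
    by (simp only: s varied_control_coords[OF t w])
  also have "\<dots> = (- \<delta> * stiff (\<phi> t) w - ip (\<lambda>x. V1 (\<phi> t x)) w / \<delta> + ip (\<alpha> t) w) + \<epsilon> * \<zeta> t * ip v w"
    by (simp add: defect_def varied_state_def diff_divide_distrib algebra_simps)
  finally show ?thesis using flux_eq[OF \<phi>_fem[OF t] \<alpha>_fem[OF t] fem_bdm_M[OF w]] by simp
qed

lemma varied_semidiscrete_state:
  "semidiscrete_state \<delta> T V M \<phi>0 0 (varied_control v \<zeta> \<epsilon>) (varied_state v \<zeta> \<epsilon>)"
  unfolding semidiscrete_state_def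
proof (intro conjI ballI varied_state_C_time)
  show "varied_state v \<zeta> \<epsilon> 0 = \<phi>0"
    using state by (simp add: varied_state_def semidiscrete_state_def)
  fix w t assume w: "w \<in> fem_space M" and t: "t \<in> {0..T}"
  have c1: "continuous_on {0..t} (\<lambda>s. flx (\<phi> s) (\<alpha> s) w)"
    using continuous_flux[OF \<phi> \<alpha> w] t by (auto intro: continuous_on_subset)
  have c2: "continuous_on {0..t} \<zeta>" using \<zeta> t by (auto intro: continuous_on_subset)
  have "(LINT s:{0..t}|lborel. flx (varied_state v \<zeta> \<epsilon> s) (varied_control v \<zeta> \<epsilon> s) w) =
      (LINT s:{0..t}|lborel. flx (\<phi> s) (\<alpha> s) w + \<epsilon> * ip v w * \<zeta> s)"
    by (rule set_lebesgue_integral_cong) (use t in \<open>auto simp: varied_flux[OF _ w] mult_ac\<close>)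
  also have "\<dots> = integral {0..t} (\<lambda>s. flx (\<phi> s) (\<alpha> s) w + \<epsilon> * ip v w * \<zeta> s)"
    by (intro set_borel_integral_eq_integral borel_integrable_atLeastAtMost' continuous_intros c1 c2)
  also have "\<dots> = integral {0..t} (\<lambda>s. flx (\<phi> s) (\<alpha> s) w) + integral {0..t} (\<lambda>s. \<epsilon> * ip v w * \<zeta> s)"
    by (intro integral_add integrable_continuous_real continuous_intros c1 c2)
  also have "integral {0..t} (\<lambda>s. \<epsilon> * ip v w * \<zeta> s) = \<epsilon> * ip v w * \<eta> t" by simp
  finally have "(LINT s:{0..t}|lborel. flx (varied_state v \<zeta> \<epsilon> s) (varied_control v \<zeta> \<epsilon> s) w) =
    integral {0..t} (\<lambda>s. flx (\<phi> s) (\<alpha> s) w) + \<epsilon> * ip v w * \<eta> t" .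
  moreover have "ip (varied_state v \<zeta> \<epsilon> t) w = ip (\<phi> t) w + \<epsilon> * \<eta> t * ip v w"
    unfolding varied_state_def using \<phi>_fem[OF t] w
    by (subst ip_add_left) (auto simp only: ip_scale_left fem_bdm_M v intro!: bdm_mult bdm_const)
  ultimately show "ip (varied_state v \<zeta> \<epsilon> t) w = ip \<phi>0 w +
      (LINT s:{0..t}|lborel. flx (varied_state v \<zeta> \<epsilon> s) (varied_control v \<zeta> \<epsilon> s) w)"
    using state_integral[OF state \<alpha> w t] by (simp add: mult_ac)
qed

text \<open>Second-order Taylor remainder of the control in one coordinate.\<close>

lemma defect_expansion:
  assumes t: "t \<in> {0..T}" and i: "i < d" and H: "\<bar>\<eta> t\<bar> \<le> H"
  shows "\<bar>defect v \<zeta> \<epsilon> t (e i) - \<epsilon> * (\<zeta> t * ip v (e i) + \<eta> t * adj v t (e i))\<bar> \<le> L * H\<^sup>2 * stiff v v / \<delta> * \<epsilon>\<^sup>2"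
proof -
  let ?y = "\<lambda>x. \<epsilon> * \<eta> t * v x"
  let ?r = "\<lambda>x. V1 (\<phi> t x + ?y x) - V1 (\<phi> t x) - ?y x * V2 (\<phi> t x)"
  have [simp]: "\<phi> t \<in> bdm" using fem_bdm_M[OF \<phi>_fem[OF t]] .
  have yb [simp]: "?y \<in> bdm" by (intro bdm_mult bdm_const fem_bdm_M v)
  have b1 [simp]: "(\<lambda>x. V1 (\<phi> t x + ?y x)) \<in> bdm" by (intro V1_bdm bdm_add yb) simp
  have b2 [simp]: "(\<lambda>x. ?y x * V2 (\<phi> t x)) \<in> bdm" by (intro bdm_mult[OF yb] V2_bdm) simp
  have ri: "ip ?r (e i) = ip (\<lambda>x. V1 (\<phi> t x + ?y x)) (e i) - ip (\<lambda>x. V1 (\<phi> t x)) (e i)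
      - \<epsilon> * \<eta> t * ip (\<lambda>x. V2 (\<phi> t x) * v x) (e i)"
  proof -
    have "ip (\<lambda>x. ?y x * V2 (\<phi> t x)) (e i) = \<epsilon> * \<eta> t * ip (\<lambda>x. V2 (\<phi> t x) * v x) (e i)"
      unfolding ip_scale_left[symmetric] by (simp add: mult_ac)
    then show ?thesis using i b1 b2 by (subst ip_diff_left) (auto simp only: ip_diff_left bdm_diff V1_bdm \<open>\<phi> t \<in> bdm\<close> basis_bdm)
  qed
  have "\<bar>ip ?r (e i)\<bar> \<le> l2norm ?r * l2norm (e i)"
    using i by (intro Cauchy_Schwarz_ip bdm_diff b1 b2 V1_bdm) auto
  also have "l2norm (e i) = 1" using i orthonormal[of i i] by (simp add: l2norm_def)
  also have "l2norm ?r * 1 \<le> L * (\<epsilon>\<^sup>2 * H\<^sup>2 * stiff v v)"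
    unfolding mult_1_right
  proof (rule l2norm_le_const)
    fix x :: real assume x: "x \<in> {0..1}"
    have "\<bar>?r x\<bar> \<le> L * (?y x)\<^sup>2" using V1_Taylor[of "\<phi> t x" "?y x"] by simp
    also have "(?y x)\<^sup>2 = \<epsilon>\<^sup>2 * \<bar>\<eta> t\<bar>\<^sup>2 * (v x)\<^sup>2" by (simp add: power_mult_distrib)
    also have "\<dots> \<le> \<epsilon>\<^sup>2 * H\<^sup>2 * stiff v v"
      by (rule mult_mono[OF mult_left_mono[OF power_mono[OF H abs_ge_zero] zero_le_power2] fem_sup_bound[OF M v x]])
        simp_all
    finally show "\<bar>?r x\<bar> \<le> L * (\<epsilon>\<^sup>2 * H\<^sup>2 * stiff v v)" using L by (simp add: mult_left_mono)
  qed (use L in \<open>auto intro!: bdm_diff b1 b2 V1_bdm mult_nonneg_nonneg\<close>)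
  finally have "\<bar>ip ?r (e i)\<bar> / \<delta> \<le> L * (\<epsilon>\<^sup>2 * H\<^sup>2 * stiff v v) / \<delta>"
    using \<delta> by (intro divide_right_mono) auto
  moreover have "defect v \<zeta> \<epsilon> t (e i) - \<epsilon> * (\<zeta> t * ip v (e i) + \<eta> t * adj v t (e i)) = ip ?r (e i) / \<delta>"
    unfolding ri defect_def adj_def by (simp add: diff_divide_distrib add_divide_distrib algebra_simps)
  ultimately show ?thesis using \<delta> by (simp add: abs_divide mult_ac)
qed

end

end

lemma continuous_bounded_on_interval:
  fixes f :: "real \<Rightarrow> real"
  assumes "continuous_on {a..b} f"
  shows "\<exists>B\<ge>0. \<forall>t\<in>{a..b}. \<bar>f t\<bar> \<le> B"
proof -
  have "bounded (f ` {a..b})" by (intro compact_imp_bounded compact_continuous_image assms) simp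
  then obtain B where "\<forall>t\<in>{a..b}. \<bar>f t\<bar> \<le> B" by (auto simp: bounded_iff)
  then show ?thesis by (intro exI[of _ "\<bar>B\<bar>"]) (auto intro: order_trans)
qed

text \<open>Running cost of a varied control in one coordinate, with \<open>r\<close> the Taylor remainder.\<close>

lemma half_square_expansion:
  fixes a B r :: real
  assumes "\<bar>a\<bar> \<le> A" "\<bar>B\<bar> \<le> Bm" "\<bar>r\<bar> \<le> R * \<epsilon>\<^sup>2" "\<bar>\<epsilon>\<bar> \<le> 1" "R \<ge> 0"
  shows "(a + (\<epsilon> * B + r))\<^sup>2 / 2 \<le> a\<^sup>2 / 2 + \<epsilon> * (a * B) + (A * R + (Bm + R)\<^sup>2 / 2) * \<epsilon>\<^sup>2"
proof -
  have "A \<ge> 0" using assms(1) by linarith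
  have "a * r \<le> \<bar>a\<bar> * \<bar>r\<bar>" by (metis abs_ge_self abs_mult)
  also have "\<dots> \<le> A * (R * \<epsilon>\<^sup>2)" using assms(1,3) \<open>A \<ge> 0\<close> by (intro mult_mono) auto
  finally have 1: "a * r \<le> A * R * \<epsilon>\<^sup>2" by simp
  have e: "\<epsilon>\<^sup>2 \<le> \<bar>\<epsilon>\<bar>" using mult_left_mono[OF assms(4), of "\<bar>\<epsilon>\<bar>"] by (simp add: power2_eq_square)
  have "\<bar>\<epsilon> * B + r\<bar> \<le> \<bar>\<epsilon>\<bar> * \<bar>B\<bar> + \<bar>r\<bar>" by (metis abs_mult abs_triangle_ineq)
  also have "\<dots> \<le> \<bar>\<epsilon>\<bar> * Bm + R * \<bar>\<epsilon>\<bar>"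
    using assms(2,3) mult_left_mono[OF e assms(5)] by (intro add_mono mult_left_mono) auto
  finally have "\<bar>\<epsilon> * B + r\<bar> \<le> \<bar>\<epsilon>\<bar> * (Bm + R)" by (simp add: algebra_simps)
  then have "\<bar>\<epsilon> * B + r\<bar>\<^sup>2 \<le> (\<bar>\<epsilon>\<bar> * (Bm + R))\<^sup>2" by (intro power_mono) auto
  then have 2: "(\<epsilon> * B + r)\<^sup>2 \<le> \<epsilon>\<^sup>2 * (Bm + R)\<^sup>2" by (simp add: power_mult_distrib)
  have "(a + (\<epsilon> * B + r))\<^sup>2 / 2 = a\<^sup>2 / 2 + \<epsilon> * (a * B) + a * r + (\<epsilon> * B + r)\<^sup>2 / 2"
    by (simp add: power2_eq_square field_simps)
  also have "\<dots> \<le> a\<^sup>2 / 2 + \<epsilon> * (a * B) + A * R * \<epsilon>\<^sup>2 + (\<epsilon>\<^sup>2 * (Bm + R)\<^sup>2) / 2"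
    using 1 2 by (intro add_mono divide_right_mono) auto
  also have "\<dots> = a\<^sup>2 / 2 + \<epsilon> * (a * B) + (A * R + (Bm + R)\<^sup>2 / 2) * \<epsilon>\<^sup>2"
    by (simp add: field_simps)
  finally show ?thesis .
qed

context optimal_control
begin

lemma h_cost_coords: "u \<in> fem_space M \<Longrightarrow> h_cost u = (\<Sum>i<d. (ip u (e i))\<^sup>2 / 2)"
  by (simp add: h_cost_def l2norm_sq ip_self_coords sum_divide_distrib)

lemma h_cost_integral:
  assumes "\<beta> \<in> C_time M 0 T"
  shows "(LINT s:{0..T}|lborel. h_cost (\<beta> s)) = integral {0..T} (\<lambda>s. h_cost (\<beta> s))"
    and "continuous_on {0..T} (\<lambda>s. h_cost (\<beta> s))"
proof -
  show c: "continuous_on {0..T} (\<lambda>s. h_cost (\<beta> s))"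
    unfolding h_cost_def l2norm_sq by (intro continuous_intros continuous_ip_self assms) simp
  show "(LINT s:{0..T}|lborel. h_cost (\<beta> s)) = integral {0..T} (\<lambda>s. h_cost (\<beta> s))"
    by (intro set_borel_integral_eq_integral borel_integrable_atLeastAtMost' c)
qed

text \<open>On the bounded time interval all coordinates are bounded, so the cost of the varied pair is at most a
  quadratic polynomial in \<open>\<epsilon>\<close> whose linear coefficient is the left-hand side. The bounds may depend on
  the mesh, since they disappear with the quadratic term.\<close>

lemma first_variation:
  assumes v: "v \<in> fem_space M" and \<zeta>: "continuous_on {0..T} \<zeta>"
  shows "2 * K * ip (\<lambda>x. \<phi> T x - \<phi>m x) v * integral {0..T} \<zeta> +
    integral {0..T} (\<lambda>t. \<zeta> t * ip (\<alpha> t) v + integral {0..t} \<zeta> * adj v t (\<alpha> t)) = 0"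
proof -
  define \<eta> where "\<eta> t = integral {0..t} \<zeta>" for t
  define a where "a i t = ip (\<alpha> t) (e i)" for i t
  define B where "B i t = \<zeta> t * ip v (e i) + \<eta> t * adj v t (e i)" for i t
  define S where "S t = (\<Sum>i<d. a i t * B i t)" for t
  have T0: "T \<in> {0..T}" using T by simp
  have c\<eta>: "continuous_on {0..T} \<eta>" unfolding \<eta>_def by (rule \<eta>_continuous[OF v \<zeta>])
  have ca: "continuous_on {0..T} (a i)" if "i < d" for i
    unfolding a_def using that by (intro continuous_ip[OF \<alpha>]) simp
  have cB: "continuous_on {0..T} (B i)" if "i < d" for i
    unfolding B_def using that by (intro continuous_intros \<zeta> c\<eta> adj_continuous v) simp
  have cS: "continuous_on {0..T} S"
    unfolding S_def by (intro continuous_intros ca cB) auto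
  obtain H where H: "H \<ge> 0" "\<forall>t\<in>{0..T}. \<bar>\<eta> t\<bar> \<le> H"
    using continuous_bounded_on_interval[OF c\<eta>] by blast
  have fam: "\<exists>A\<ge>0. \<forall>t\<in>{0..T}. \<forall>i<d. \<bar>f i t\<bar> \<le> A" if "\<And>i. i < d \<Longrightarrow> continuous_on {0..T} (f i)"
    for f :: "nat \<Rightarrow> real \<Rightarrow> real"
  proof -
    have "continuous_on {0..T} (\<lambda>t. \<Sum>i<d. \<bar>f i t\<bar>)" by (intro continuous_intros that) auto
    then obtain A where A: "A \<ge> 0" "\<forall>t\<in>{0..T}. \<bar>\<Sum>i<d. \<bar>f i t\<bar>\<bar> \<le> A"
      using continuous_bounded_on_interval by blast
    have "\<bar>f i t\<bar> \<le> A" if "t \<in> {0..T}" "i < d" for i t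
    proof -
      have "\<bar>f i t\<bar> \<le> (\<Sum>i<d. \<bar>f i t\<bar>)" using that(2) by (intro member_le_sum) auto
      also have "\<dots> \<le> A" using A(2) that(1) abs_ge_self order_trans by blast
      finally show ?thesis .
    qed
    then show ?thesis using A(1) by blast
  qed
  obtain A where A: "A \<ge> 0" "\<forall>t\<in>{0..T}. \<forall>i<d. \<bar>a i t\<bar> \<le> A" using fam[of a, OF ca] by blast
  obtain Bm where Bm: "Bm \<ge> 0" "\<forall>t\<in>{0..T}. \<forall>i<d. \<bar>B i t\<bar> \<le> Bm" using fam[of B, OF cB] by blast
  define R where "R = L * H\<^sup>2 * stiff v v / \<delta>"
  have R: "R \<ge> 0" unfolding R_def using L \<delta> by (intro divide_nonneg_pos mult_nonneg_nonneg) auto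
  define c where "c = real d * (A * R + (Bm + R)\<^sup>2 / 2)"
  have c0: "c \<ge> 0" unfolding c_def using A R by (intro mult_nonneg_nonneg add_nonneg_nonneg) auto
  have h_bound: "h_cost (varied_control v \<zeta> \<epsilon> t) \<le> h_cost (\<alpha> t) + \<epsilon> * S t + c * \<epsilon>\<^sup>2"
    if \<epsilon>: "\<bar>\<epsilon>\<bar> \<le> 1" and t: "t \<in> {0..T}" for \<epsilon> t
  proof -
    have "h_cost (varied_control v \<zeta> \<epsilon> t) = (\<Sum>i<d. (ip (varied_control v \<zeta> \<epsilon> t) (e i))\<^sup>2 / 2)"
      by (rule h_cost_coords[OF C_time_fem[OF varied_control_C_time[OF v \<zeta>] t]])
    also have "\<dots> \<le> (\<Sum>i<d. (a i t)\<^sup>2 / 2 + \<epsilon> * (a i t * B i t) + (A * R + (Bm + R)\<^sup>2 / 2) * \<epsilon>\<^sup>2)"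
    proof (rule sum_mono)
      fix i assume "i \<in> {..<d}"
      then have i: "i < d" by simp
      define r where "r = defect v \<zeta> \<epsilon> t (e i) - \<epsilon> * B i t"
      have eq: "ip (varied_control v \<zeta> \<epsilon> t) (e i) = a i t + (\<epsilon> * B i t + r)"
        by (simp add: varied_control_coords[OF v \<zeta> t basis_fem[OF i]] a_def r_def)
      have "\<bar>r\<bar> \<le> R * \<epsilon>\<^sup>2"
        unfolding r_def R_def B_def \<eta>_def
        by (rule defect_expansion[OF v \<zeta> t i]) (use H(2) t in \<open>auto simp: \<eta>_def\<close>)
      then show "(ip (varied_control v \<zeta> \<epsilon> t) (e i))\<^sup>2 / 2 \<le>
          (a i t)\<^sup>2 / 2 + \<epsilon> * (a i t * B i t) + (A * R + (Bm + R)\<^sup>2 / 2) * \<epsilon>\<^sup>2"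
        unfolding eq using A(2) Bm(2) t i \<epsilon> R by (intro half_square_expansion) auto
    qed
    also have "\<dots> = h_cost (\<alpha> t) + \<epsilon> * S t + c * \<epsilon>\<^sup>2"
      unfolding h_cost_coords[OF \<alpha>_fem[OF t]] S_def c_def
      by (simp add: sum.distrib sum_distrib_left a_def)
    finally show ?thesis .
  qed
  define D where "D = (\<lambda>x. \<phi> T x - \<phi>m x)"
  have Db [simp]: "D \<in> bdm" unfolding D_def using fem_bdm_M[OF \<phi>_fem[OF T0]] by simp
  have vb [simp]: "v \<in> bdm" using v by simp
  have g: "g_cost K \<phi>m (varied_state v \<zeta> \<epsilon> T) =
      g_cost K \<phi>m (\<phi> T) + \<epsilon> * (2 * K * ip D v * \<eta> T) + K * (\<eta> T)\<^sup>2 * ip v v * \<epsilon>\<^sup>2" for \<epsilon>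
  proof -
    define k where "k = \<epsilon> * \<eta> T"
    have "(\<lambda>x. varied_state v \<zeta> \<epsilon> T x - \<phi>m x) = (\<lambda>x. D x + k * v x)"
      by (auto simp: varied_state_def D_def \<eta>_def k_def)
    then have "g_cost K \<phi>m (varied_state v \<zeta> \<epsilon> T) = K * ip (\<lambda>x. D x + k * v x) (\<lambda>x. D x + k * v x)"
      by (simp add: g_cost_def l2norm_sq)
    also have "ip (\<lambda>x. D x + k * v x) (\<lambda>x. D x + k * v x) = ip D D + 2 * k * ip D v + k\<^sup>2 * ip v v"
      by (simp add: ip_linear ip_commute[of v D] power2_eq_square algebra_simps)
    also have "ip D D = (l2norm D)\<^sup>2" by (simp add: l2norm_sq)
    finally show ?thesis
      by (simp add: g_cost_def D_def[symmetric] k_def power_mult_distrib algebra_simps)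
  qed
  define P where "P = 2 * K * ip D v * \<eta> T + integral {0..T} S"
  have "P = 0"
  proof (rule linear_coefficient_zero)
    show "0 \<le> K * (\<eta> T)\<^sup>2 * ip v v + c * T" using K T c0 by simp
    fix \<epsilon> :: real assume \<epsilon>: "\<bar>\<epsilon>\<bar> \<le> 1"
    have "semidiscrete_cost T K \<phi>m 0 \<alpha> \<phi> \<le> semidiscrete_cost T K \<phi>m 0 (varied_control v \<zeta> \<epsilon>) (varied_state v \<zeta> \<epsilon>)"
      unfolding optimal
      by (rule u_bar_le[OF K C_time_imp_L2_time[OF varied_control_C_time[OF v \<zeta>]] varied_semidiscrete_state[OF v \<zeta>]])
    also have "\<dots> \<le> g_cost K \<phi>m (varied_state v \<zeta> \<epsilon> T) + integral {0..T} (\<lambda>t. h_cost (\<alpha> t) + \<epsilon> * S t + c * \<epsilon>\<^sup>2)"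
      unfolding semidiscrete_cost_def h_cost_integral(1)[OF varied_control_C_time[OF v \<zeta>]]
      by (intro add_left_mono integral_le integrable_continuous_real continuous_intros
          h_cost_integral(2) varied_control_C_time v \<zeta> \<alpha> cS h_bound \<epsilon>) auto
    also have "integral {0..T} (\<lambda>t. h_cost (\<alpha> t) + \<epsilon> * S t + c * \<epsilon>\<^sup>2) =
        integral {0..T} (\<lambda>t. h_cost (\<alpha> t)) + \<epsilon> * integral {0..T} S + c * T * \<epsilon>\<^sup>2"
    proof -
      have cc: "((\<lambda>t. c * \<epsilon>\<^sup>2) has_integral (T * (c * \<epsilon>\<^sup>2))) {0..T}"
        using has_integral_const_real[of "c * \<epsilon>\<^sup>2" 0 T] T by simp
      have "((\<lambda>t. h_cost (\<alpha> t) + \<epsilon> * S t + c * \<epsilon>\<^sup>2) has_integral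
          (integral {0..T} (\<lambda>t. h_cost (\<alpha> t)) + \<epsilon> * integral {0..T} S + T * (c * \<epsilon>\<^sup>2))) {0..T}"
        by (intro has_integral_add[OF _ cc] has_integral_add has_integral_mult_right integrable_integral
          integrable_continuous_real h_cost_integral(2)[OF \<alpha>] cS)
      then show ?thesis by (simp add: integral_unique mult_ac)
    qed
    finally have "semidiscrete_cost T K \<phi>m 0 \<alpha> \<phi> \<le> semidiscrete_cost T K \<phi>m 0 \<alpha> \<phi> + (\<epsilon> * P + (K * (\<eta> T)\<^sup>2 * ip v v + c * T) * \<epsilon>\<^sup>2)"
      unfolding g semidiscrete_cost_def h_cost_integral(1)[OF \<alpha>] P_def by (simp add: algebra_simps)
    then show "0 \<le> \<epsilon> * P + (K * (\<eta> T)\<^sup>2 * ip v v + c * T) * \<epsilon>\<^sup>2" by simp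
  qed
  moreover have "integral {0..T} S = integral {0..T} (\<lambda>t. \<zeta> t * ip (\<alpha> t) v + \<eta> t * adj v t (\<alpha> t))"
  proof (rule integral_cong)
    fix t assume t: "t \<in> {0..T}"
    have "ip (\<alpha> t) v = (\<Sum>i<d. ip (\<alpha> t) (e i) * ip v (e i))"
      using ip_coords[OF \<alpha>_fem[OF t] vb] by (simp only: ip_commute[of _ v])
    then show "S t = \<zeta> t * ip (\<alpha> t) v + \<eta> t * adj v t (\<alpha> t)"
      unfolding S_def a_def B_def adj_coords[OF v \<alpha>_fem[OF t] t]
      by (simp only: distrib_left sum.distrib sum_distrib_left mult_ac)
  qed
  ultimately show ?thesis unfolding P_def D_def \<eta>_def by simp
qed

text \<open>The optimal control is minus the adjoint state, here in integrated form.\<close>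

lemma adjoint_equation:
  assumes v: "v \<in> fem_space M" and t: "t \<in> {0..T}"
  shows "ip (\<alpha> t) v = - (2 * K * ip (\<lambda>x. \<phi> T x - \<phi>m x) v) - integral {t..T} (\<lambda>s. adj v s (\<alpha> s))"
proof (rule du_Bois_Reymond[OF T _ adj_control_continuous[OF v] first_variation[OF v] t])
  show "continuous_on {0..T} (\<lambda>t. ip (\<alpha> t) v)" using v by (intro continuous_ip[OF \<alpha>]) simp
qed

lemma control_derivative:
  assumes v: "v \<in> fem_space M" and t: "0 < t" "t < T"
  shows "((\<lambda>s. ip (\<alpha> s) v) has_real_derivative adj v t (\<alpha> t)) (at t)"
proof -
  let ?c = "- (2 * K * ip (\<lambda>x. \<phi> T x - \<phi>m x) v)"
  have "((\<lambda>s. integral {s..T} (\<lambda>s. adj v s (\<alpha> s))) has_real_derivative - adj v t (\<alpha> t)) (at t within {0..T})"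
    using t by (intro integral_has_real_derivative' adj_control_continuous[OF v]) auto
  then have "((\<lambda>s. integral {s..T} (\<lambda>s. adj v s (\<alpha> s))) has_real_derivative - adj v t (\<alpha> t)) (at t)"
    using t by (simp add: at_within_Icc_at)
  then have "((\<lambda>s. ?c - integral {s..T} (\<lambda>s. adj v s (\<alpha> s))) has_real_derivative 0 - (- adj v t (\<alpha> t))) (at t)"
    by (intro DERIV_diff DERIV_const)
  then have "((\<lambda>s. ?c - integral {s..T} (\<lambda>s. adj v s (\<alpha> s))) has_real_derivative adj v t (\<alpha> t)) (at t)"
    by simp
  then show ?thesis
  proof (rule has_field_derivative_transform_within_open[of _ _ _ "{0<..<T}"])
    show "?c - integral {s..T} (\<lambda>s. adj v s (\<alpha> s)) = ip (\<alpha> s) v" if "s \<in> {0<..<T}" for s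
      using adjoint_equation[OF v, of s] that by simp
  qed (use t in auto)
qed

section \<open>Regularity of the optimal control\<close>

lemma V2_form_bound:
  assumes "v \<in> fem_space M" "w \<in> fem_space M" "t \<in> {0..T}"
  shows "\<bar>ip (\<lambda>x. V2 (\<phi> t x) * v x) w\<bar> \<le> L * l2norm v * l2norm w"
proof -
  have b: "(\<lambda>x. V2 (\<phi> t x) * v x) \<in> bdm"
    using assms \<phi>_fem[OF assms(3)] by (intro bdm_mult V2_bdm) auto
  have "\<bar>ip (\<lambda>x. V2 (\<phi> t x) * v x) w\<bar> \<le> l2norm (\<lambda>x. V2 (\<phi> t x) * v x) * l2norm w"
    using assms by (intro Cauchy_Schwarz_ip b) simp
  also have "\<dots> \<le> L * l2norm v * l2norm w"
    using assms(1) L V2_bound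
    by (intro mult_right_mono l2norm_mono b) (auto simp: abs_mult intro!: mult_right_mono)
  finally show ?thesis .
qed

lemma adj_coercive:
  assumes "w \<in> fem_space M" "t \<in> {0..T}"
  shows "\<delta> * stiff w w - L / \<delta> * ip w w \<le> adj w t w"
proof -
  have "- (L * ip w w) \<le> ip (\<lambda>x. V2 (\<phi> t x) * w x) w"
    using abs_le_D2[OF V2_form_bound[OF assms(1,1,2)]] l2norm_sq[of w]
    by (simp add: power2_eq_square mult.assoc)
  then have "- (L * ip w w) / \<delta> \<le> ip (\<lambda>x. V2 (\<phi> t x) * w x) w / \<delta>"
    using \<delta> by (intro divide_right_mono) auto
  then show ?thesis by (simp add: adj_def)
qed

lemma adj_bound:
  assumes "v \<in> fem_space M" "w \<in> fem_space M" "t \<in> {0..T}"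
  shows "\<bar>adj v t w\<bar> \<le> sqrt (stiff v v) * (\<delta> * sqrt (stiff w w) + L / \<delta> * l2norm w)"
proof -
  have 1: "\<bar>stiff v w\<bar> \<le> sqrt (stiff v v) * sqrt (stiff w w)"
    using Cauchy_Schwarz_ip[of "deriv v" "deriv w"] assms by (simp add: l2norm_def)
  have "l2norm v \<le> sqrt (stiff v v)"
    unfolding l2norm_def using Poincare_fem[OF M assms(1)] by simp
  then have "L * l2norm v * l2norm w \<le> L * sqrt (stiff v v) * l2norm w"
    using L by (intro mult_right_mono mult_left_mono) auto
  then have 2: "\<bar>ip (\<lambda>x. V2 (\<phi> t x) * v x) w\<bar> \<le> L * sqrt (stiff v v) * l2norm w"
    using V2_form_bound[OF assms] by (rule order_trans[rotated])
  have "\<bar>adj v t w\<bar> \<le> \<delta> * \<bar>stiff v w\<bar> + \<bar>ip (\<lambda>x. V2 (\<phi> t x) * v x) w\<bar> / \<delta>"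
    unfolding adj_def using \<delta> by (intro order_trans[OF abs_triangle_ineq]) (simp add: abs_mult)
  also have "\<dots> \<le> \<delta> * (sqrt (stiff v v) * sqrt (stiff w w)) + L * sqrt (stiff v v) * l2norm w / \<delta>"
    using \<delta> by (intro add_mono[OF mult_left_mono[OF 1] divide_right_mono[OF 2]]) simp_all
  also have "\<dots> = sqrt (stiff v v) * (\<delta> * sqrt (stiff w w) + L / \<delta> * l2norm w)"
    by (simp add: distrib_left mult_ac)
  finally show ?thesis .
qed

lemma control_energy_derivative:
  assumes t: "0 < t" "t < T"
  shows "((\<lambda>s. ip (\<alpha> s) (\<alpha> s)) has_real_derivative 2 * adj (\<alpha> t) t (\<alpha> t)) (at t)"
proof -
  have tt: "t \<in> {0..T}" using t by simp
  have "((\<lambda>s. \<Sum>i<d. (ip (\<alpha> s) (e i))\<^sup>2) has_real_derivative (\<Sum>i<d. 2 * ip (\<alpha> t) (e i) * adj (e i) t (\<alpha> t))) (at t)"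
    using control_derivative[OF basis_fem t]
    by (intro DERIV_sum) (auto intro!: derivative_eq_intros)
  also have "(\<Sum>i<d. 2 * ip (\<alpha> t) (e i) * adj (e i) t (\<alpha> t)) = 2 * adj (\<alpha> t) t (\<alpha> t)"
    unfolding adj_coords[OF \<alpha>_fem[OF tt] \<alpha>_fem[OF tt] tt]
    by (simp add: sum_distrib_left adj_commute[of "e _" t "\<alpha> t"] mult.assoc)
  finally show ?thesis
  proof (rule has_field_derivative_transform_within_open[of _ _ _ "{0<..<T}"])
    show "(\<Sum>i<d. (ip (\<alpha> s) (e i))\<^sup>2) = ip (\<alpha> s) (\<alpha> s)" if "s \<in> {0<..<T}" for s
      using ip_self_coords[OF \<alpha>_fem[of s]] that by simp
  qed (use t in auto)
qed

text \<open>The terminal condition of the adjoint equation bounds the control at the final time by the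
  distance to the target, and coercivity propagates the bound backwards in time.\<close>

lemma control_bound:
  assumes B: "l2norm (\<lambda>x. \<phi> T x - \<phi>m x) \<le> B" and t: "t \<in> {0..T}"
  shows "ip (\<alpha> t) (\<alpha> t) \<le> exp (2 * L / \<delta> * T) * (2 * K * B)\<^sup>2"
proof -
  define \<Lambda> where "\<Lambda> = 2 * L / \<delta>"
  have \<Lambda>: "\<Lambda> \<ge> 0" using L \<delta> by (simp add: \<Lambda>_def)
  have T0: "T \<in> {0..T}" using T by simp
  let ?D = "\<lambda>x. \<phi> T x - \<phi>m x"
  have D: "?D \<in> bdm" using fem_bdm_M[OF \<phi>_fem[OF T0]] by simp
  define n where "n = l2norm (\<alpha> T)"
  have n0: "n \<ge> 0" by (simp add: n_def)
  have B0: "B \<ge> 0" using B l2norm_nonneg order_trans by blast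
  have "n * n = - (2 * K * ip ?D (\<alpha> T))"
    using adjoint_equation[OF \<alpha>_fem[OF T0] T0] l2norm_sq[of "\<alpha> T"] by (simp add: n_def power2_eq_square)
  also have "\<dots> \<le> 2 * K * \<bar>ip ?D (\<alpha> T)\<bar>"
    using mult_left_mono[OF abs_ge_minus_self[of "ip ?D (\<alpha> T)"], of "2 * K"] K by simp
  also have "\<dots> \<le> 2 * K * (B * n)"
  proof (rule mult_left_mono)
    have "\<bar>ip ?D (\<alpha> T)\<bar> \<le> l2norm ?D * n"
      unfolding n_def by (intro Cauchy_Schwarz_ip D fem_bdm_M \<alpha>_fem T0)
    also have "\<dots> \<le> B * n" by (intro mult_right_mono B n0)
    finally show "\<bar>ip ?D (\<alpha> T)\<bar> \<le> B * n" .
  qed (use K in simp)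
  finally have "n * n \<le> (2 * K * B) * n" by simp
  then have nB: "n \<le> 2 * K * B"
  proof (cases "n = 0")
    case True
    then show ?thesis using K B0 by simp
  next
    case False
    then show ?thesis using \<open>n * n \<le> (2 * K * B) * n\<close> n0 by (simp add: mult_le_cancel_right)
  qed
  have AT: "ip (\<alpha> T) (\<alpha> T) \<le> (2 * K * B)\<^sup>2"
    using power_mono[OF nB n0, of 2] by (simp add: n_def l2norm_sq)
  have "exp (\<Lambda> * t) * ip (\<alpha> t) (\<alpha> t) \<le> exp (\<Lambda> * T) * ip (\<alpha> T) (\<alpha> T)"
  proof (rule DERIV_nonneg_imp_increasing_open[where f = "\<lambda>t. exp (\<Lambda> * t) * ip (\<alpha> t) (\<alpha> t)"])
    show "t \<le> T" using t by simp
    show "continuous_on {t..T} (\<lambda>t. exp (\<Lambda> * t) * ip (\<alpha> t) (\<alpha> t))"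
      using t by (intro continuous_intros continuous_on_subset[OF continuous_ip_self[OF \<alpha>]]) auto
    fix s assume s: "t < s" "s < T"
    then have s': "0 < s" "s < T" "s \<in> {0..T}" using t by auto
    have "((\<lambda>t. exp (\<Lambda> * t) * ip (\<alpha> t) (\<alpha> t)) has_real_derivative
        (exp (\<Lambda> * s) * (2 * adj (\<alpha> s) s (\<alpha> s) + \<Lambda> * ip (\<alpha> s) (\<alpha> s)))) (at s)"
      using control_energy_derivative[OF s'(1,2)]
      by (auto intro!: derivative_eq_intros simp: algebra_simps)
    moreover have "0 \<le> 2 * adj (\<alpha> s) s (\<alpha> s) + \<Lambda> * ip (\<alpha> s) (\<alpha> s)"
    proof -
      have "0 \<le> \<delta> * stiff (\<alpha> s) (\<alpha> s)" using \<delta> by simp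
      then have "- (L / \<delta> * ip (\<alpha> s) (\<alpha> s)) \<le> adj (\<alpha> s) s (\<alpha> s)"
        using adj_coercive[OF \<alpha>_fem[OF s'(3)] s'(3)] by simp
      then show ?thesis by (simp add: \<Lambda>_def)
    qed
    ultimately show "\<exists>y. ((\<lambda>t. exp (\<Lambda> * t) * ip (\<alpha> t) (\<alpha> t)) has_real_derivative y) (at s) \<and> 0 \<le> y"
      by (intro exI conjI) (assumption, simp)
  qed
  also have "\<dots> \<le> exp (\<Lambda> * T) * (2 * K * B)\<^sup>2" by (intro mult_left_mono AT) simp
  finally have "exp (\<Lambda> * t) * ip (\<alpha> t) (\<alpha> t) \<le> exp (\<Lambda> * T) * (2 * K * B)\<^sup>2" .
  moreover have "1 * ip (\<alpha> t) (\<alpha> t) \<le> exp (\<Lambda> * t) * ip (\<alpha> t) (\<alpha> t)"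
    using \<Lambda> t by (intro mult_right_mono) auto
  ultimately show ?thesis by (simp add: \<Lambda>_def)
qed

text \<open>The energy of the control, corrected by a linear term so that it is nondecreasing; its growth
  bounds \<open>2 \<delta>\<close> times the time integral of the squared gradient of the control. It is additive over
  time cells, and it controls the modulus of continuity of the control in the dual \<open>H\<^sup>1\<close> norm.\<close>

definition growth :: "real \<Rightarrow> real \<Rightarrow> real" where
  "growth Am t = ip (\<alpha> t) (\<alpha> t) + 2 * L / \<delta> * Am * t"

lemma growth_derivative:
  assumes t: "0 < t" "t < T" and Am: "ip (\<alpha> t) (\<alpha> t) \<le> Am"
  shows "\<exists>g. (growth Am has_real_derivative g) (at t) \<and> 2 * \<delta> * stiff (\<alpha> t) (\<alpha> t) \<le> g"
proof -
  have tt: "t \<in> {0..T}" using t by simp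
  have d: "(growth Am has_real_derivative (2 * adj (\<alpha> t) t (\<alpha> t) + 2 * L / \<delta> * Am)) (at t)"
    unfolding growth_def using control_energy_derivative[OF t] \<delta>
    by (auto intro!: derivative_eq_intros)
  have "L / \<delta> * ip (\<alpha> t) (\<alpha> t) \<le> L / \<delta> * Am" using L \<delta> Am by (intro mult_left_mono) auto
  then have "\<delta> * stiff (\<alpha> t) (\<alpha> t) \<le> adj (\<alpha> t) t (\<alpha> t) + L / \<delta> * Am"
    using adj_coercive[OF \<alpha>_fem[OF tt] tt] by linarith
  from mult_left_mono[OF this, of 2]
  have "2 * \<delta> * stiff (\<alpha> t) (\<alpha> t) \<le> 2 * adj (\<alpha> t) t (\<alpha> t) + 2 * L / \<delta> * Am"
    by (simp add: algebra_simps)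
  with d show ?thesis by blast
qed

lemma growth_continuous: "continuous_on {0..T} (growth Am)"
  unfolding growth_def by (intro continuous_intros continuous_ip_self[OF \<alpha>])

lemma growth_mono:
  assumes Am: "\<And>t. t \<in> {0..T} \<Longrightarrow> ip (\<alpha> t) (\<alpha> t) \<le> Am" and st: "0 \<le> s" "s \<le> t" "t \<le> T"
  shows "growth Am s \<le> growth Am t"
proof (rule DERIV_nonneg_imp_increasing_open[OF st(2)])
  show "continuous_on {s..t} (growth Am)"
    using st by (intro continuous_on_subset[OF growth_continuous]) auto
  fix \<tau> assume \<tau>: "s < \<tau>" "\<tau> < t"
  have "\<exists>g. (growth Am has_real_derivative g) (at \<tau>) \<and> 2 * \<delta> * stiff (\<alpha> \<tau>) (\<alpha> \<tau>) \<le> g"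
    using \<tau> st by (intro growth_derivative Am) auto
  moreover have "0 \<le> 2 * \<delta> * stiff (\<alpha> \<tau>) (\<alpha> \<tau>)" using \<delta> by simp
  ultimately show "\<exists>y. (growth Am has_real_derivative y) (at \<tau>) \<and> 0 \<le> y"
    using order_trans by blast
qed

text \<open>The time derivative of \<open>(\<alpha>, v)\<close> is at most \<open>\<delta> m + b\<close> times the \<open>H\<^sup>1\<close> seminorm of \<open>v\<close>, where \<open>m\<close> is that of
  \<open>\<alpha>\<close>. By Cauchy--Schwarz in time, the square of its integral is bounded by the length of the interval times
  the integral of \<open>(\<delta> m + b)\<^sup>2\<close>, and \<open>growth\<close> bounds the latter. The Cauchy--Schwarz step is carried out
  pointwise, with a multiplier \<open>\<mu>\<close> that is optimized at the end.\<close>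

lemma control_modulus:
  assumes Am: "\<And>t. t \<in> {0..T} \<Longrightarrow> ip (\<alpha> t) (\<alpha> t) \<le> Am" and st: "0 \<le> s" "s \<le> t" "t \<le> T"
    and v: "v \<in> fem_space M"
  shows "(ip (\<lambda>x. \<alpha> t x - \<alpha> s x) v)\<^sup>2 \<le>
    (t - s) * (\<delta> * (growth Am t - growth Am s) + 2 * ((L / \<delta>)\<^sup>2 * Am) * (t - s)) * stiff v v"
proof -
  define b where "b = L / \<delta> * sqrt Am"
  have Am0: "Am \<ge> 0" using order_trans[OF ip_self_nonneg Am[of t]] st by simp
  have b2: "b\<^sup>2 = (L / \<delta>)\<^sup>2 * Am" using Am0 unfolding b_def power_mult_distrib by simp
  let ?S = "stiff v v"
  define X where "X = \<delta> * (growth Am t - growth Am s) + 2 * b\<^sup>2 * (t - s)"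
  have X0: "X \<ge> 0" unfolding X_def using \<delta> growth_mono[OF Am st] st by simp
  let ?p = "\<lambda>\<tau>. ip (\<alpha> \<tau>) v"
  have cp: "continuous_on {s..t} ?p"
    using st v by (intro continuous_on_subset[OF continuous_ip[OF \<alpha>]]) auto
  have cg: "continuous_on {s..t} (growth Am)"
    using st by (intro continuous_on_subset[OF growth_continuous]) auto
  \<comment> \<open>the sign \<open>\<sigma>\<close> treats both directions of the absolute value at once\<close>
  have one_sided: "2 * (\<sigma> * (?p t - ?p s)) \<le> \<mu> * X + (t - s) * ?S / \<mu>"
    if \<mu>: "\<mu> > 0" and \<sigma>: "\<bar>\<sigma>\<bar> = 1" for \<mu> \<sigma>
  proof -
    define W where "W \<tau> = \<mu> * (\<delta> * growth Am \<tau> + 2 * b\<^sup>2 * \<tau>) + \<tau> * ?S / \<mu> - 2 * (\<sigma> * ?p \<tau>)" for \<tau>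
    have "W s \<le> W t"
    proof (rule DERIV_nonneg_imp_increasing_open[OF st(2)])
      show "continuous_on {s..t} W"
        unfolding W_def using \<mu> by (intro continuous_intros cp cg) auto
      fix \<tau> assume \<tau>: "s < \<tau>" "\<tau> < t"
      then have \<tau>': "0 < \<tau>" "\<tau> < T" "\<tau> \<in> {0..T}" using st by auto
      define m where "m = sqrt (stiff (\<alpha> \<tau>) (\<alpha> \<tau>))"
      obtain g where g: "(growth Am has_real_derivative g) (at \<tau>)" "2 * \<delta> * stiff (\<alpha> \<tau>) (\<alpha> \<tau>) \<le> g"
        using growth_derivative[OF \<tau>'(1,2) Am[OF \<tau>'(3)]] by blast
      have dW: "(W has_real_derivative (\<mu> * (\<delta> * g + 2 * b\<^sup>2) + ?S / \<mu> - 2 * (\<sigma> * adj v \<tau> (\<alpha> \<tau>)))) (at \<tau>)"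
        unfolding W_def using g(1) control_derivative[OF v \<tau>'(1,2)] \<mu>
        by (auto intro!: derivative_eq_intros)
      have "l2norm (\<alpha> \<tau>) \<le> sqrt Am" unfolding l2norm_def using Am[OF \<tau>'(3)] by simp
      then have lb: "\<delta> * m + L / \<delta> * l2norm (\<alpha> \<tau>) \<le> \<delta> * m + b"
        unfolding b_def using L \<delta> by (intro add_left_mono mult_left_mono) auto
      have "\<sigma> * adj v \<tau> (\<alpha> \<tau>) \<le> \<bar>\<sigma> * adj v \<tau> (\<alpha> \<tau>)\<bar>" by simp
      also have "\<dots> = \<bar>adj v \<tau> (\<alpha> \<tau>)\<bar>" using \<sigma> by (simp add: abs_mult)
      also have "\<dots> \<le> sqrt ?S * (\<delta> * m + L / \<delta> * l2norm (\<alpha> \<tau>))"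
        unfolding m_def by (rule adj_bound[OF v \<alpha>_fem[OF \<tau>'(3)] \<tau>'(3)])
      also have "\<dots> \<le> sqrt ?S * (\<delta> * m + b)" by (intro mult_left_mono lb) simp
      finally have 1: "\<sigma> * adj v \<tau> (\<alpha> \<tau>) \<le> sqrt ?S * (\<delta> * m + b)" .
      have "2 * (sqrt ?S * (\<delta> * m + b)) \<le> \<mu> * (\<delta> * m + b)\<^sup>2 + ?S / \<mu>"
      proof -
        have "0 \<le> (\<mu> * (\<delta> * m + b) - sqrt ?S)\<^sup>2 / \<mu>" using \<mu> by simp
        also have "\<dots> = \<mu> * (\<delta> * m + b)\<^sup>2 + (sqrt ?S)\<^sup>2 / \<mu> - 2 * (sqrt ?S * (\<delta> * m + b))"
          using \<mu> by (simp add: power2_eq_square field_simps)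
        finally show ?thesis by simp
      qed
      also have "\<mu> * (\<delta> * m + b)\<^sup>2 \<le> \<mu> * (\<delta> * g + 2 * b\<^sup>2)"
      proof (rule mult_left_mono)
        have "0 \<le> (\<delta> * m - b)\<^sup>2" by simp
        then have "(\<delta> * m + b)\<^sup>2 \<le> 2 * (\<delta> * m)\<^sup>2 + 2 * b\<^sup>2" by (simp add: power2_eq_square algebra_simps)
        also have "2 * (\<delta> * m)\<^sup>2 = \<delta> * (2 * \<delta> * stiff (\<alpha> \<tau>) (\<alpha> \<tau>))"
          by (simp add: m_def power_mult_distrib power2_eq_square)
        also have "\<dots> \<le> \<delta> * g" using g(2) \<delta> by (intro mult_left_mono) auto
        finally show "(\<delta> * m + b)\<^sup>2 \<le> \<delta> * g + 2 * b\<^sup>2" by simp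
      qed (use \<mu> in simp)
      finally have "2 * (\<sigma> * adj v \<tau> (\<alpha> \<tau>)) \<le> \<mu> * (\<delta> * g + 2 * b\<^sup>2) + ?S / \<mu>"
        using mult_left_mono[OF 1, of 2] by simp
      then show "\<exists>y. (W has_real_derivative y) (at \<tau>) \<and> 0 \<le> y" using dW by (intro exI conjI) (assumption, simp)
    qed
    then show ?thesis by (simp add: W_def X_def algebra_simps diff_divide_distrib)
  qed
  have "2 * \<bar>?p t - ?p s\<bar> \<le> \<mu> * X + (t - s) * ?S / \<mu>" if "\<mu> > 0" for \<mu>
    using one_sided[OF that, of 1] one_sided[OF that, of "-1"] by (simp add: abs_le_iff abs_if)
  then have "\<bar>?p t - ?p s\<bar>\<^sup>2 \<le> X * ((t - s) * ?S)"
    using X0 st by (intro sq_le_of_scaled) auto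
  moreover have "ip (\<lambda>x. \<alpha> t x - \<alpha> s x) v = ?p t - ?p s"
    using st v \<alpha>_fem[of t] \<alpha>_fem[of s] by (intro ip_diff_left) auto
  ultimately show ?thesis by (simp add: X_def b2 mult_ac)
qed

text \<open>The left end point of each time cell has the smallest \<open>growth\<close> on it, hence up to the linear
  correction the smallest cost.\<close>

lemma control_cost_quadrature:
  fixes N :: nat
  assumes Am: "\<And>t. t \<in> {0..T} \<Longrightarrow> ip (\<alpha> t) (\<alpha> t) \<le> Am" and N: "N \<ge> 1"
  shows "T / N * (\<Sum>n<N. h_cost (\<alpha> (real n * (T / N)))) \<le>
    (LINT s:{0..T}|lborel. h_cost (\<alpha> s)) + L / \<delta> * Am * T * (T / N)"
proof -
  define h where "h = T / N"
  have h: "h > 0" and hN: "real N * h = T" using T N by (auto simp: h_def)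
  define k where "k = L / \<delta> * Am * h"
  have Am0: "Am \<ge> 0" using order_trans[OF ip_self_nonneg Am[of 0]] T by simp
  have ch: "continuous_on {0..T} (\<lambda>s. h_cost (\<alpha> s))" by (rule h_cost_integral(2)[OF \<alpha>])
  have "h * (\<Sum>j<n. h_cost (\<alpha> (real j * h))) \<le> integral {0..real n * h} (\<lambda>s. h_cost (\<alpha> s)) + real n * (h * k)"
    if "n \<le> N" for n
    using that
  proof (induction n)
    case 0
    then show ?case by simp
  next
    case (Suc n)
    have nT: "real (Suc n) * h \<le> T" using Suc.prems h hN mult_right_mono[of "real (Suc n)" "real N" h] by simp
    have le: "real n * h \<le> real (Suc n) * h" using h by simp
    have n0: "0 \<le> real n * h" using h by simp
    have int: "(\<lambda>s. h_cost (\<alpha> s)) integrable_on {a..b}" if "0 \<le> a" "b \<le> T" for a b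
      using that by (intro integrable_continuous_real continuous_on_subset[OF ch]) auto
    have low: "h_cost (\<alpha> (real n * h)) - k \<le> h_cost (\<alpha> s)" if s: "s \<in> {real n * h..real (Suc n) * h}" for s
    proof -
      have "growth Am (real n * h) \<le> growth Am s" using s n0 nT by (intro growth_mono Am) auto
      then have "ip (\<alpha> (real n * h)) (\<alpha> (real n * h)) \<le> ip (\<alpha> s) (\<alpha> s) + 2 * L / \<delta> * Am * (s - real n * h)"
        by (simp add: growth_def right_diff_distrib diff_divide_distrib)
      also have "2 * L / \<delta> * Am * (s - real n * h) \<le> 2 * L / \<delta> * Am * h"
        using s L \<delta> Am0 by (intro mult_left_mono) (auto simp: algebra_simps)
      finally show ?thesis by (simp add: h_cost_def l2norm_sq k_def)
    qed
    have "h * (h_cost (\<alpha> (real n * h)) - k) = integral {real n * h..real (Suc n) * h} (\<lambda>_. h_cost (\<alpha> (real n * h)) - k)"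
      using h by (simp add: algebra_simps)
    also have "\<dots> \<le> integral {real n * h..real (Suc n) * h} (\<lambda>s. h_cost (\<alpha> s))"
      using low n0 nT by (intro integral_le int) auto
    finally have step: "h * h_cost (\<alpha> (real n * h)) \<le> integral {real n * h..real (Suc n) * h} (\<lambda>s. h_cost (\<alpha> s)) + h * k"
      by (simp add: algebra_simps)
    have "integral {0..real n * h} (\<lambda>s. h_cost (\<alpha> s)) + integral {real n * h..real (Suc n) * h} (\<lambda>s. h_cost (\<alpha> s))
        = integral {0..real (Suc n) * h} (\<lambda>s. h_cost (\<alpha> s))"
      by (rule Henstock_Kurzweil_Integration.integral_combine[OF n0 le int[OF order_refl nT]])
    moreover have "h * (\<Sum>j<Suc n. h_cost (\<alpha> (real j * h))) = h * (\<Sum>j<n. h_cost (\<alpha> (real j * h))) + h * h_cost (\<alpha> (real n * h))"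
      by (simp add: distrib_left)
    moreover have "real (Suc n) * (h * k) = real n * (h * k) + h * k" by (simp add: algebra_simps)
    ultimately show ?case using step Suc by simp
  qed
  from this[of N] have "h * (\<Sum>j<N. h_cost (\<alpha> (real j * h))) \<le> integral {0..T} (\<lambda>s. h_cost (\<alpha> s)) + T * k"
    using hN by (simp add: mult.assoc[symmetric])
  then show ?thesis
    unfolding h_cost_integral(1)[OF \<alpha>] k_def h_def by (simp add: mult_ac)
qed

end

section \<open>Comparing the value functions\<close>

lemma g_cost_le:
  assumes b: "u \<in> bdm" "w \<in> bdm" "\<phi>m \<in> bdm" and K: "K > 0"
    and B: "l2norm (\<lambda>x. w x - \<phi>m x) \<le> B" and E: "l2norm (\<lambda>x. u x - w x) \<le> E"
  shows "g_cost K \<phi>m u \<le> g_cost K \<phi>m w + K * (2 * B * E + E\<^sup>2)"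
proof -
  define n where "n = l2norm (\<lambda>x. w x - \<phi>m x)"
  have E0: "E \<ge> 0" using E l2norm_nonneg order_trans by blast
  have "l2norm (\<lambda>x. u x - \<phi>m x) = l2norm (\<lambda>x. (w x - \<phi>m x) + (u x - w x))" by simp
  also have "\<dots> \<le> n + l2norm (\<lambda>x. u x - w x)"
    unfolding n_def by (intro l2norm_triangle bdm_diff b)
  also have "\<dots> \<le> n + E" using E by simp
  finally have "(l2norm (\<lambda>x. u x - \<phi>m x))\<^sup>2 \<le> (n + E)\<^sup>2" by (intro power_mono) auto
  also have "\<dots> = n\<^sup>2 + 2 * n * E + E\<^sup>2" by (simp add: power2_sum)
  also have "\<dots> \<le> n\<^sup>2 + 2 * B * E + E\<^sup>2"
    using B E0 by (intro add_mono mult_right_mono order_refl) (auto simp: n_def)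
  finally have "K * (l2norm (\<lambda>x. u x - \<phi>m x))\<^sup>2 \<le> K * (n\<^sup>2 + 2 * B * E + E\<^sup>2)"
    using K by (intro mult_left_mono) auto
  then show ?thesis by (simp add: g_cost_def n_def algebra_simps)
qed

lemma u_tilde_le:
  assumes "K > 0" "T > 0" "c \<in> discrete_controls M N 0" "euler_state \<delta> T V M N \<phi>0 0 c y"
  shows "u_tilde \<delta> T K V \<phi>m M N \<phi>0 0 \<le> discrete_cost T K \<phi>m N 0 c y"
  unfolding u_tilde_def
proof (rule cInf_lower)
  show "bdd_below {discrete_cost T K \<phi>m N 0 \<alpha> \<phi> |\<alpha> \<phi>. \<alpha> \<in> discrete_controls M N 0 \<and> euler_state \<delta> T V M N \<phi>0 0 \<alpha> \<phi>}"
  proof (rule bdd_belowI[of _ 0])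
    have "0 \<le> discrete_cost T K \<phi>m N 0 \<alpha> \<phi>" for \<alpha> \<phi>
      unfolding discrete_cost_def g_cost_def h_cost_def
      using assms(1,2) by (intro add_nonneg_nonneg mult_nonneg_nonneg sum_nonneg) auto
    then show "0 \<le> x" if "x \<in> {discrete_cost T K \<phi>m N 0 \<alpha> \<phi> |\<alpha> \<phi>. \<alpha> \<in> discrete_controls M N 0 \<and> euler_state \<delta> T V M N \<phi>0 0 \<alpha> \<phi>}" for x
      using that by auto
  qed
qed (use assms in auto)

lemma l2norm_le_of_g_cost_le:
  assumes "K > 0" "g_cost K \<phi>m u \<le> g_cost K \<phi>m w" "l2norm (\<lambda>x. w x - \<phi>m x) \<le> B"
  shows "l2norm (\<lambda>x. u x - \<phi>m x) \<le> B"
proof -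
  have "(l2norm (\<lambda>x. u x - \<phi>m x))\<^sup>2 \<le> (l2norm (\<lambda>x. w x - \<phi>m x))\<^sup>2"
    using assms(1,2) by (simp add: g_cost_def)
  then have "l2norm (\<lambda>x. u x - \<phi>m x) \<le> l2norm (\<lambda>x. w x - \<phi>m x)"
    by (rule power2_le_imp_le) simp
  then show ?thesis using assms(3) by simp
qed

context allen_cahn
begin

text \<open>A discrete stationary state is a state for the zero control of both problems. This bounds both
  value functions, and hence the final states of optimal pairs, uniformly in the mesh.\<close>

lemma stationary_flux:
  assumes "discrete_stationary \<delta> V M u" "v \<in> fem_space M"
  shows "flx u (\<lambda>_. 0) v = 0"
proof -
  have u: "u \<in> fem_space M" and "\<delta> * stiff u v + ip (\<lambda>x. V1 (u x)) v / \<delta> = 0"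
    using assms by (auto simp: discrete_stationary_def)
  then show ?thesis using flux_eq[OF u fem_zero fem_bdm_M[OF assms(2)]] by simp
qed

lemma stationary_bound:
  assumes "discrete_stationary \<delta> V M u"
  shows "l2norm u \<le> L / \<delta>\<^sup>2"
proof -
  have u: "u \<in> fem_space M" using assms by (simp add: discrete_stationary_def)
  have ub [simp]: "u \<in> bdm" using u by simp
  define n where "n = l2norm u"
  have n: "n \<ge> 0" by (simp add: n_def)
  have "\<delta> * stiff u u = - (ip (\<lambda>x. V1 (u x)) u) / \<delta>"
    using stationary_flux[OF assms u] flux_eq[OF u fem_zero ub] by simp
  also have "\<dots> \<le> (L * n) / \<delta>"
  proof (rule divide_right_mono)
    have "\<bar>ip (\<lambda>x. V1 (u x)) u\<bar> \<le> l2norm (\<lambda>x. V1 (u x)) * n"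
      unfolding n_def by (intro Cauchy_Schwarz_ip V1_bdm ub)
    also have "\<dots> \<le> L * n"
      using n by (intro mult_right_mono l2norm_le_const V1_bdm ub L V1_bound)
    finally show "- (ip (\<lambda>x. V1 (u x)) u) \<le> L * n" by (rule abs_le_D2)
  qed (use \<delta> in simp)
  finally have "\<delta> * stiff u u \<le> (L * n) / \<delta>" .
  moreover have "\<delta> * (n * n) \<le> \<delta> * stiff u u"
    using Poincare_fem[OF M u] \<delta> l2norm_sq[of u] by (simp add: n_def power2_eq_square)
  ultimately have "\<delta> * (n * n) \<le> (L * n) / \<delta>" by simp
  then have "n * (\<delta> * \<delta>) * n \<le> L * n" using \<delta> by (simp add: pos_le_divide_eq mult_ac)
  then have "n = 0 \<or> n * (\<delta> * \<delta>) \<le> L" using n by (auto simp: mult_le_cancel_right)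
  then show ?thesis
    using \<delta> L by (auto simp: n_def[symmetric] pos_le_divide_eq power2_eq_square)
qed

lemma stationary_values:
  assumes st: "discrete_stationary \<delta> V M u" and K: "K > 0" and T: "T > 0"
  shows "u_bar \<delta> T K V \<phi>m M u 0 \<le> g_cost K \<phi>m u" "u_tilde \<delta> T K V \<phi>m M N u 0 \<le> g_cost K \<phi>m u"
proof -
  have u: "u \<in> fem_space M" using st by (simp add: discrete_stationary_def)
  have "semidiscrete_state \<delta> T V M u 0 (\<lambda>_ _. 0) (\<lambda>_. u)"
    unfolding semidiscrete_state_def using u by (simp add: stationary_flux[OF st] C_time_iff)
  from u_bar_le[OF K C_time_imp_L2_time[OF zero_C_time] this]
  show "u_bar \<delta> T K V \<phi>m M u 0 \<le> g_cost K \<phi>m u"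
    by (simp add: semidiscrete_cost_def h_cost_def l2norm_def)
  have "euler_state \<delta> T V M N u 0 (\<lambda>_ _. 0) (\<lambda>_. u)"
    unfolding euler_state_def using u by (simp add: stationary_flux[OF st])
  from u_tilde_le[OF K T _ this]
  show "u_tilde \<delta> T K V \<phi>m M N u 0 \<le> g_cost K \<phi>m u"
    by (simp add: discrete_cost_def h_cost_def l2norm_def discrete_controls_def)
qed

text \<open>The piecewise constant control has exactly the discrete running cost, so only the final states
  need to be compared.\<close>

lemma u_bar_le_u_tilde:
  fixes N :: nat
  assumes T: "T > 0" and K: "K > 0" and N: "N \<ge> 1" and \<phi>0: "\<phi>0 \<in> fem_space M" and \<phi>m: "\<phi>m \<in> bdm"
    and opt: "optimal_discrete_pair \<delta> T K V \<phi>m M N \<phi>0 0 c y"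
    and B: "l2norm (\<lambda>x. y N x - \<phi>m x) \<le> B"
    and incr: "\<And>n. n < N \<Longrightarrow> stiff (\<lambda>x. y (Suc n) x - y n x) (\<lambda>x. y (Suc n) x - y n x) \<le> (C * (T / N))\<^sup>2"
    and X: "exp (3 * L / \<delta> * T) * ((2 * \<delta> + L / \<delta>) * C\<^sup>2 * T) \<le> X"
  shows "u_bar \<delta> T K V \<phi>m M \<phi>0 0 \<le> u_tilde \<delta> T K V \<phi>m M N \<phi>0 0 + K * (2 * B * (sqrt X * (T / N)) + (sqrt X * (T / N))\<^sup>2)"
proof -
  define h where "h = T / N"
  have h: "h > 0" and hN: "real N * h = T" using T N by (auto simp: h_def)
  have c: "c \<in> discrete_controls M N 0" and eu: "euler_state \<delta> T V M N \<phi>0 0 c y"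
    and cost: "discrete_cost T K \<phi>m N 0 c y = u_tilde \<delta> T K V \<phi>m M N \<phi>0 0"
    using opt by (auto simp: optimal_discrete_pair_def)
  let ?\<beta> = "\<lambda>t. c (time_cell (T / real N) N t)"
  obtain \<psi> where \<psi>: "\<psi> \<in> C_time M 0 T" "semidiscrete_state \<delta> T V M \<phi>0 0 ?\<beta> \<psi>"
    and ode: "\<forall>n<N. \<forall>t v. real n * (T / real N) < t \<longrightarrow> t < real (Suc n) * (T / real N) \<longrightarrow> v \<in> fem_space M \<longrightarrow>
      ((\<lambda>s. ip (\<psi> s) v) has_real_derivative flx (\<psi> t) (?\<beta> t) v) (at t)"
    using step_control_state[OF T N c \<phi>0] by blast
  have \<psi>0: "\<psi> 0 = \<phi>0" using \<psi>(2) by (simp add: semidiscrete_state_def)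
  have X0: "X \<ge> 0" using order_trans[OF _ X] \<delta> L T by simp
  have "(l2norm (\<lambda>x. \<psi> T x - y N x))\<^sup>2 \<le>
    exp (3 * L / \<delta> * T) * (\<Sum>n<N. ((2 * \<delta> + L / \<delta>) * (C * (T / N))\<^sup>2 + 2 * 0 / \<delta>) * (T / N))"
  proof (rule euler_error[OF T N \<psi>(1), where \<alpha> = ?\<beta> and c = c and R = "\<lambda>_. 0"])
    show "?\<beta> t \<in> fem_space M" for t
      using c time_cell_less[OF N] by (simp add: discrete_controls_def)
    show "euler_state \<delta> T V M N (\<psi> 0) 0 c y" using eu by (simp add: \<psi>0)
    show "(ip (\<lambda>x. ?\<beta> t x - c n x) v)\<^sup>2 \<le> 0 * stiff v v"
      if "n < N" "real n * (T / N) < t" "t < real (Suc n) * (T / N)" for n t v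
      using time_cell_eq[of "T / N" n N t] that h by (simp add: h_def)
  qed (use ode c incr in auto)
  also have "\<dots> = exp (3 * L / \<delta> * T) * ((2 * \<delta> + L / \<delta>) * C\<^sup>2 * T) * h\<^sup>2"
  proof -
    have "(\<Sum>n<N. ((2 * \<delta> + L / \<delta>) * (C * (T / N))\<^sup>2 + 2 * 0 / \<delta>) * (T / N)) = (2 * \<delta> + L / \<delta>) * (C * h)\<^sup>2 * (real N * h)"
      by (simp add: h_def)
    then show ?thesis unfolding hN by (simp add: power_mult_distrib mult_ac)
  qed
  also have "\<dots> \<le> X * h\<^sup>2" by (intro mult_right_mono X) simp
  also have "\<dots> = (sqrt X * h)\<^sup>2" using X0 by (simp add: power_mult_distrib)
  finally have err: "l2norm (\<lambda>x. \<psi> T x - y N x) \<le> sqrt X * h"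
    by (rule power2_le_imp_le) (use X0 h in simp)
  have yN: "y N \<in> bdm" using eu by (simp add: euler_state_def)
  have \<psi>T: "\<psi> T \<in> bdm" using C_time_fem[OF \<psi>(1)] T by simp
  have "u_bar \<delta> T K V \<phi>m M \<phi>0 0 \<le> semidiscrete_cost T K \<phi>m 0 ?\<beta> \<psi>"
    by (rule u_bar_le[OF K step_control_L2_time[OF N c] \<psi>(2)])
  also have "\<dots> = g_cost K \<phi>m (\<psi> T) + T / N * (\<Sum>n<N. h_cost (c n))"
    by (simp add: semidiscrete_cost_def step_control_cost[OF N T])
  also have "\<dots> \<le> (g_cost K \<phi>m (y N) + K * (2 * B * (sqrt X * h) + (sqrt X * h)\<^sup>2)) + T / N * (\<Sum>n<N. h_cost (c n))"
    by (intro add_right_mono g_cost_le[OF \<psi>T yN \<phi>m K B err])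
  also have "\<dots> = discrete_cost T K \<phi>m N 0 c y + K * (2 * B * (sqrt X * h) + (sqrt X * h)\<^sup>2)"
    by (simp add: discrete_cost_def atLeast0LessThan)
  finally show ?thesis unfolding cost h_def .
qed

end

context optimal_control
begin

text \<open>Sampling the optimal control at the time nodes. The constant \<open>X\<close> collects the increments of the
  Euler state and the telescoped control defects.\<close>

lemma u_tilde_le_u_bar:
  fixes N :: nat
  assumes N: "N \<ge> 1" and B: "l2norm (\<lambda>x. \<phi> T x - \<phi>m x) \<le> B"
    and Am: "Am = exp (2 * L / \<delta> * T) * (2 * K * B)\<^sup>2"
    and euler: "euler_state \<delta> T V M N \<phi>0 0 (\<lambda>n. \<alpha> (real n * (T / N))) y"
    and incr: "\<And>n. n < N \<Longrightarrow> stiff (\<lambda>x. y (Suc n) x - y n x) (\<lambda>x. y (Suc n) x - y n x) \<le> (C * (T / N))\<^sup>2"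
    and X: "X = exp (3 * L / \<delta> * T) * ((2 * \<delta> + L / \<delta>) * C\<^sup>2 * T +
      2 / \<delta> * (\<delta> * (Am + 2 * L / \<delta> * Am * T) + 2 * ((L / \<delta>)\<^sup>2 * Am) * T))"
  shows "u_tilde \<delta> T K V \<phi>m M N \<phi>0 0 \<le> u_bar \<delta> T K V \<phi>m M \<phi>0 0 +
    K * (2 * B * (sqrt X * (T / N)) + (sqrt X * (T / N))\<^sup>2) + L / \<delta> * Am * T * (T / N)"
proof -
  define h where "h = T / N"
  have h: "h > 0" and hN: "real N * h = T" using T N by (auto simp: h_def)
  have bound: "ip (\<alpha> t) (\<alpha> t) \<le> Am" if "t \<in> {0..T}" for t
    unfolding Am by (rule control_bound[OF B that])
  have Am0: "Am \<ge> 0" by (simp add: Am)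
  define b where "b = (L / \<delta>)\<^sup>2 * Am"
  have b0: "b \<ge> 0" using Am0 by (simp add: b_def)
  define R where "R n = h * (\<delta> * (growth Am (real (Suc n) * h) - growth Am (real n * h)) + 2 * b * h)" for n
  have cell: "0 \<le> real n * h" "real n * h \<le> real (Suc n) * h" "real (Suc n) * h \<le> T" if "n < N" for n
    using that h hN mult_right_mono[of "real (Suc n)" "real N" h] by auto
  have R0: "R n \<ge> 0" if "n < N" for n
    unfolding R_def using growth_mono[OF bound cell[OF that]] \<delta> h b0 by simp
  have c: "(\<lambda>n. \<alpha> (real n * (T / N))) \<in> discrete_controls M N 0"
    unfolding discrete_controls_def
  proof (intro CollectI ballI)
    fix n assume "n \<in> {0..<N}"
    then have "real n * h \<in> {0..T}" using cell[of n] by auto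
    then show "\<alpha> (real n * (T / N)) \<in> fem_space M" using \<alpha>_fem by (simp add: h_def)
  qed
  have \<phi>0: "\<phi> 0 = \<phi>0" using state by (simp add: semidiscrete_state_def)
  have "(l2norm (\<lambda>x. \<phi> T x - y N x))\<^sup>2 \<le>
    exp (3 * L / \<delta> * T) * (\<Sum>n<N. ((2 * \<delta> + L / \<delta>) * (C * (T / N))\<^sup>2 + 2 * R n / \<delta>) * (T / N))"
  proof (rule euler_error[OF T N \<phi>, where \<alpha> = \<alpha> and c = "\<lambda>n. \<alpha> (real n * (T / N))"])
    show "\<alpha> t \<in> fem_space M" if "t \<in> {0..T}" for t using \<alpha>_fem[OF that] .
    show "euler_state \<delta> T V M N (\<phi> 0) 0 (\<lambda>n. \<alpha> (real n * (T / N))) y" using euler by (simp add: \<phi>0)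
    fix n :: nat and t v assume n: "n < N" and t: "real n * (T / N) < t" "t < real (Suc n) * (T / N)" and v: "v \<in> fem_space M"
    then have t': "real n * h \<le> t" "t \<le> real (Suc n) * h" "0 < t" "t < T"
      using cell[OF n] unfolding h_def by linarith+
    show "((\<lambda>s. ip (\<phi> s) v) has_real_derivative flx (\<phi> t) (\<alpha> t) v) (at t)"
      by (rule state_derivative[OF state \<alpha> v t'(3,4)])
    have "(ip (\<lambda>x. \<alpha> t x - \<alpha> (real n * h) x) v)\<^sup>2 \<le>
        (t - real n * h) * (\<delta> * (growth Am t - growth Am (real n * h)) + 2 * b * (t - real n * h)) * stiff v v"
      unfolding b_def by (rule control_modulus[OF bound cell(1)[OF n] t'(1) less_imp_le[OF t'(4)] v])
    also have "\<dots> \<le> R n * stiff v v"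
    proof -
      have gm: "growth Am (real n * h) \<le> growth Am t" "growth Am t \<le> growth Am (real (Suc n) * h)"
        using t' cell[OF n] by (auto intro!: growth_mono bound)
      have lh: "t - real n * h \<le> h" using t'(2) by (simp add: algebra_simps)
      have "\<delta> * (growth Am t - growth Am (real n * h)) + 2 * b * (t - real n * h) \<le>
          \<delta> * (growth Am (real (Suc n) * h) - growth Am (real n * h)) + 2 * b * h"
        using gm(2) lh \<delta> b0 by (intro add_mono mult_left_mono) auto
      moreover have "0 \<le> \<delta> * (growth Am t - growth Am (real n * h)) + 2 * b * (t - real n * h)"
        using \<delta> b0 t'(1) gm(1) by simp
      ultimately show ?thesis
        unfolding R_def using lh h by (intro mult_right_mono mult_mono) auto
    qed
    finally show "(ip (\<lambda>x. \<alpha> t x - \<alpha> (real n * (T / N)) x) v)\<^sup>2 \<le> R n * stiff v v"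
      by (simp only: h_def)
  qed (use c incr R0 in auto)
  also have "(\<Sum>n<N. ((2 * \<delta> + L / \<delta>) * (C * (T / N))\<^sup>2 + 2 * R n / \<delta>) * (T / N)) \<le>
      ((2 * \<delta> + L / \<delta>) * C\<^sup>2 * T + 2 / \<delta> * (\<delta> * (Am + 2 * L / \<delta> * Am * T) + 2 * b * T)) * h\<^sup>2"
  proof -
    \<comment> \<open>the growth increments telescope\<close>
    have "(\<Sum>n<N. R n) = h * (\<delta> * (\<Sum>n<N. growth Am (real (Suc n) * h) - growth Am (real n * h)) + 2 * b * (real N * h))"
      unfolding R_def by (simp only: sum_distrib_left[symmetric] sum.distrib) (simp add: algebra_simps)
    also have "(\<Sum>n<N. growth Am (real (Suc n) * h) - growth Am (real n * h)) = growth Am T - growth Am 0"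
      using sum_lessThan_telescope[of "\<lambda>n. growth Am (real n * h)" N] by (simp add: hN)
    finally have "(\<Sum>n<N. R n) = h * (\<delta> * (growth Am T - growth Am 0) + 2 * b * T)" by (simp only: hN)
    also have "\<dots> \<le> h * (\<delta> * (Am + 2 * L / \<delta> * Am * T) + 2 * b * T)"
    proof -
      have "growth Am T - growth Am 0 \<le> Am + 2 * L / \<delta> * Am * T"
      proof -
        have "ip (\<alpha> T) (\<alpha> T) - ip (\<alpha> 0) (\<alpha> 0) \<le> Am - 0"
          using T by (intro diff_mono bound) auto
        then show ?thesis by (simp add: growth_def)
      qed
      then show ?thesis using h \<delta> by (intro mult_left_mono add_right_mono) auto
    qed
    finally have SR: "(\<Sum>n<N. R n) \<le> h * (\<delta> * (Am + 2 * L / \<delta> * Am * T) + 2 * b * T)" .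
    have sum_eq: "(\<Sum>n<N. (a + 2 * R n / \<delta>) * h) = a * (real N * h) + 2 / \<delta> * h * (\<Sum>n<N. R n)" for a
    proof -
      have "(\<Sum>n<N. (a + 2 * R n / \<delta>) * h) = (\<Sum>n<N. a * h + 2 / \<delta> * h * R n)"
        by (intro sum.cong refl) (simp add: distrib_right)
      also have "\<dots> = real N * (a * h) + 2 / \<delta> * h * (\<Sum>n<N. R n)"
        by (simp only: sum.distrib sum_distrib_left[symmetric]) simp
      finally show ?thesis by (simp only: mult_ac)
    qed
    have "(\<Sum>n<N. ((2 * \<delta> + L / \<delta>) * (C * h)\<^sup>2 + 2 * R n / \<delta>) * h) =
        (2 * \<delta> + L / \<delta>) * (C * h)\<^sup>2 * (real N * h) + 2 / \<delta> * h * (\<Sum>n<N. R n)"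
      by (rule sum_eq)
    also have "\<dots> \<le> (2 * \<delta> + L / \<delta>) * (C * h)\<^sup>2 * T + 2 / \<delta> * h * (h * (\<delta> * (Am + 2 * L / \<delta> * Am * T) + 2 * b * T))"
      unfolding hN using \<delta> h by (intro add_left_mono mult_left_mono SR) auto
    also have "\<dots> = ((2 * \<delta> + L / \<delta>) * C\<^sup>2 * T + 2 / \<delta> * (\<delta> * (Am + 2 * L / \<delta> * Am * T) + 2 * b * T)) * h\<^sup>2"
      by (simp only: power_mult_distrib distrib_right) (simp only: power2_eq_square mult_ac)
    finally show ?thesis by (simp only: h_def)
  qed
  finally have "(l2norm (\<lambda>x. \<phi> T x - y N x))\<^sup>2 \<le> X * h\<^sup>2"
    by (simp add: X b_def mult.assoc)
  also have X0: "X \<ge> 0" unfolding X using \<delta> L T Am0 by simp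
  then have "X * h\<^sup>2 = (sqrt X * h)\<^sup>2" by (simp add: power_mult_distrib)
  finally have "l2norm (\<lambda>x. \<phi> T x - y N x) \<le> sqrt X * h"
    by (rule power2_le_imp_le) (use X0 h in simp)
  then have err: "l2norm (\<lambda>x. y N x - \<phi> T x) \<le> sqrt X * h" by (subst l2norm_minus_commute)
  have yN: "y N \<in> bdm" using euler by (simp add: euler_state_def)
  have \<phi>T: "\<phi> T \<in> bdm" using \<phi>_fem T by simp
  have "u_tilde \<delta> T K V \<phi>m M N \<phi>0 0 \<le> discrete_cost T K \<phi>m N 0 (\<lambda>n. \<alpha> (real n * (T / N))) y"
    by (rule u_tilde_le[OF K T c euler])
  also have "\<dots> = g_cost K \<phi>m (y N) + T / N * (\<Sum>n<N. h_cost (\<alpha> (real n * (T / N))))"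
    by (simp add: discrete_cost_def atLeast0LessThan)
  also have "\<dots> \<le> (g_cost K \<phi>m (\<phi> T) + K * (2 * B * (sqrt X * h) + (sqrt X * h)\<^sup>2)) +
      ((LINT s:{0..T}|lborel. h_cost (\<alpha> s)) + L / \<delta> * Am * T * (T / N))"
    by (intro add_mono g_cost_le[OF yN \<phi>T \<phi>m K B err] control_cost_quadrature[OF bound N])
  also have "\<dots> = semidiscrete_cost T K \<phi>m 0 \<alpha> \<phi> + K * (2 * B * (sqrt X * h) + (sqrt X * h)\<^sup>2) + L / \<delta> * Am * T * (T / N)"
    by (simp add: semidiscrete_cost_def)
  finally show ?thesis unfolding optimal h_def .
qed

end

section \<open>The potential and the target\<close>

lemma Lipschitz_of_bounded_deriv:
  fixes f :: "real \<Rightarrow> real"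
  assumes "\<And>x. (f has_real_derivative f' x) (at x)" "\<And>x. \<bar>f' x\<bar> \<le> B"
  shows "\<bar>f x - f y\<bar> \<le> B * \<bar>x - y\<bar>"
  using field_differentiable_bound[of UNIV f f' B x y] assms by simp

lemma modified_double_well_bounds:
  assumes "modified_double_well s V"
  shows "\<exists>L. L \<ge> 0 \<and> (\<forall>x. \<bar>deriv V x\<bar> \<le> L) \<and> (\<forall>x. \<bar>deriv (deriv V) x\<bar> \<le> L) \<and>
    (\<forall>x y. \<bar>deriv V x - deriv V y\<bar> \<le> L * \<bar>x - y\<bar>) \<and>
    (\<forall>x y. \<bar>deriv (deriv V) x - deriv (deriv V) y\<bar> \<le> L * \<bar>x - y\<bar>) \<and>
    (\<forall>x y. \<bar>deriv V (x + y) - deriv V x - y * deriv (deriv V) x\<bar> \<le> L * y\<^sup>2)"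
proof -
  have diff: "(deriv ^^ k) V field_differentiable (at x)" for k x
    using assms by (simp add: modified_double_well_def)
  have d: "((deriv ^^ k) V has_real_derivative (deriv ^^ Suc k) V x) (at x)" for k x
    using diff[of k x] by (simp add: DERIV_deriv_iff_field_differentiable)
  have "\<exists>B. \<forall>x. \<bar>(deriv ^^ k) V x\<bar> \<le> B" if "k \<ge> 1" for k
    using assms that by (auto simp: modified_double_well_def bounded_iff)
  then obtain B where B: "\<And>k x. k \<ge> 1 \<Longrightarrow> \<bar>(deriv ^^ k) V x\<bar> \<le> B k" by metis
  define L where "L = max (B 1) (max (B 2) (B 3))"
  have b: "\<bar>deriv V x\<bar> \<le> L" "\<bar>deriv (deriv V) x\<bar> \<le> L" "\<bar>deriv (deriv (deriv V)) x\<bar> \<le> L" for x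
    using B[of 1 x] B[of 2 x] B[of 3 x] by (auto simp: L_def numeral_2_eq_2 numeral_3_eq_3)
  have L: "L \<ge> 0" using order_trans[OF abs_ge_zero b(1)] .
  have d1: "(deriv V has_real_derivative deriv (deriv V) x) (at x)" for x using d[of 1 x] by simp
  have d2: "(deriv (deriv V) has_real_derivative deriv (deriv (deriv V)) x) (at x)" for x
    using d[of 2 x] by (simp add: numeral_2_eq_2)
  note l1 = Lipschitz_of_bounded_deriv[OF d1 b(2)] and l2 = Lipschitz_of_bounded_deriv[OF d2 b(3)]
  have taylor: "\<bar>deriv V (x + y) - deriv V x - y * deriv (deriv V) x\<bar> \<le> L * y\<^sup>2" for x y
  proof -
    define F where "F z = deriv V (x + z) - deriv V x - z * deriv (deriv V) x" for z
    have "norm (F y - F 0) \<le> (L * \<bar>y\<bar>) * norm (y - 0)"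
    proof (rule field_differentiable_bound[of "{- \<bar>y\<bar>..\<bar>y\<bar>}" F "\<lambda>z. deriv (deriv V) (x + z) - deriv (deriv V) x"])
      fix z assume z: "z \<in> {- \<bar>y\<bar>..\<bar>y\<bar>}"
      have "((\<lambda>z. deriv V (x + z)) has_real_derivative deriv (deriv V) (x + z) * (0 + 1)) (at z)"
        by (rule DERIV_chain2[OF d1 DERIV_add[OF DERIV_const DERIV_ident]])
      then have "(F has_real_derivative (deriv (deriv V) (x + z) - deriv (deriv V) x)) (at z)"
        unfolding F_def by (auto intro!: derivative_eq_intros)
      then show "(F has_real_derivative (deriv (deriv V) (x + z) - deriv (deriv V) x)) (at z within {- \<bar>y\<bar>..\<bar>y\<bar>})"
        by (rule has_field_derivative_at_within)
      have "\<bar>deriv (deriv V) (x + z) - deriv (deriv V) x\<bar> \<le> L * \<bar>z\<bar>" using l2[of "x + z" x] by simp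
      also have "\<dots> \<le> L * \<bar>y\<bar>" using z L by (intro mult_left_mono) auto
      finally show "norm (deriv (deriv V) (x + z) - deriv (deriv V) x) \<le> L * \<bar>y\<bar>" by simp
    qed auto
    then show ?thesis by (simp add: F_def power2_eq_square mult.assoc)
  qed
  show ?thesis using L b(1,2) l1 l2 taylor by (intro exI[of _ L] conjI allI)
qed

text \<open>A square integrable weak derivative is integrable on the unit interval, so its primitive is
  continuous.\<close>

lemma h10_bdm:
  assumes "h10 u w" shows "u \<in> bdm"
proof -
  have w: "set_borel_measurable lborel {0..1} w" "set_integrable lborel {0..1} (\<lambda>x. (w x)\<^sup>2)"
    and u: "\<And>x. x \<in> {0..1} \<Longrightarrow> u x = (LINT y:{0..x}|lborel. w y)"
    using assms by (auto simp: h10_def)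
  have int: "set_integrable lborel {0..1} w"
    unfolding set_integrable_def
  proof (rule Bochner_Integration.integrable_bound)
    have "set_integrable lborel {0..1} (\<lambda>x. 1 + (w x)\<^sup>2)"
      by (intro set_integral_add w(2) bdm_integrable bdm_const)
    then show "integrable lborel (\<lambda>x. indicat_real {0..1} x *\<^sub>R (1 + (w x)\<^sup>2))"
      by (simp add: set_integrable_def)
    show "(\<lambda>x. indicat_real {0..1} x *\<^sub>R w x) \<in> borel_measurable lborel"
      using w(1) by (simp add: set_borel_measurable_def)
    have "\<bar>z\<bar> \<le> 1 + z\<^sup>2" for z :: real
    proof -
      have "0 \<le> (\<bar>z\<bar> - 1)\<^sup>2" by simp
      then have "2 * \<bar>z\<bar> \<le> 1 + z\<^sup>2" by (simp add: power2_diff)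
      then show ?thesis using abs_ge_zero[of z] by linarith
    qed
    then show "AE x in lborel. norm (indicat_real {0..1} x *\<^sub>R w x) \<le> norm (indicat_real {0..1} x *\<^sub>R (1 + (w x)\<^sup>2))"
      by (intro AE_I2) (simp add: indicator_def abs_of_nonneg)
  qed
  have "continuous_on {0..1} (\<lambda>x. integral {0..x} w)"
    by (intro indefinite_integral_continuous_1 set_borel_integral_eq_integral(1) int)
  moreover have "integral {0..x} w = u x" if "x \<in> {0..1}" for x
  proof -
    have "set_integrable lborel {0..x} w"
      by (rule set_integrable_subset[OF int]) (use that in auto)
    then show ?thesis using u[OF that] by (simp add: set_borel_integral_eq_integral(2))
  qed
  ultimately have "continuous_on {0..1} u" by (subst continuous_on_cong[OF refl, of _ u "\<lambda>x. integral {0..x} w"]) auto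
  then show ?thesis by (rule bdm_continuous)
qed

section \<open>The error bound\<close>

theorem theorem4p1:
  fixes \<delta> T K s C :: real
    and V \<phi>m :: "real \<Rightarrow> real"
    and r :: "real \<Rightarrow> real"
    and \<phi>0 :: "nat \<Rightarrow> real \<Rightarrow> real"
  assumes "\<delta> > 0" "T > 0" "K > 0"
    and "modified_double_well s V"
    and "negative_minimizer \<delta> V \<phi>m"
    and "\<And>x. x > 0 \<Longrightarrow> r x > 0"
    and "\<And>M. M \<ge> 1 \<Longrightarrow> discrete_stationary \<delta> V M (\<phi>0 M)"
    and "\<And>M N. M \<ge> 1 \<Longrightarrow> N \<ge> 1 \<Longrightarrow> T / real N \<le> r (1 / real M) \<Longrightarrow>
       \<exists>\<alpha>t \<phi>t \<alpha>bar \<phi>r.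
         optimal_discrete_pair \<delta> T K V \<phi>m M N (\<phi>0 M) 0 \<alpha>t \<phi>t \<and>
         optimal_semidiscrete_control \<delta> T K V \<phi>m M (\<phi>0 M) 0 \<alpha>bar \<and>
         euler_state \<delta> T V M N (\<phi>0 M) 0 (\<lambda>n. \<alpha>bar (real n * (T / real N))) \<phi>r \<and>
         (\<forall>n<N. l2norm (\<lambda>x. deriv (\<phi>t (Suc n)) x - deriv (\<phi>t n) x)
               + l2norm (\<lambda>x. deriv (\<phi>r (Suc n)) x - deriv (\<phi>r n) x) \<le> C * (T / real N))"
  shows "\<exists>D. \<forall>M\<ge>1. \<forall>N\<ge>1. T / real N \<le> r (1 / real M) \<longrightarrow>
           \<bar>u_tilde \<delta> T K V \<phi>m M N (\<phi>0 M) 0 - u_bar \<delta> T K V \<phi>m M (\<phi>0 M) 0\<bar> \<le> D * (T / real N)"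
proof -
  note \<delta> = assms(1) and T = assms(2) and K = assms(3)
  obtain L where LL: "L \<ge> 0 \<and> (\<forall>x. \<bar>deriv V x\<bar> \<le> L) \<and> (\<forall>x. \<bar>deriv (deriv V) x\<bar> \<le> L) \<and>
    (\<forall>x y. \<bar>deriv V x - deriv V y\<bar> \<le> L * \<bar>x - y\<bar>) \<and>
    (\<forall>x y. \<bar>deriv (deriv V) x - deriv (deriv V) y\<bar> \<le> L * \<bar>x - y\<bar>) \<and>
    (\<forall>x y. \<bar>deriv V (x + y) - deriv V x - y * deriv (deriv V) x\<bar> \<le> L * y\<^sup>2)"
    using modified_double_well_bounds[OF assms(4)] by blast
  then have L: "L \<ge> 0" by blast
  have \<phi>m: "\<phi>m \<in> bdm" using assms(5) h10_bdm by (auto simp: negative_minimizer_def)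
  \<comment> \<open>\<open>B\<close> bounds the distance to the target of the final states of both optimal pairs, \<open>Am\<close> the squared
    norm of the optimal control\<close>
  define B where "B = L / \<delta>\<^sup>2 + l2norm \<phi>m"
  define Am where "Am = exp (2 * L / \<delta> * T) * (2 * K * B)\<^sup>2"
  define X where "X = exp (3 * L / \<delta> * T) * ((2 * \<delta> + L / \<delta>) * C\<^sup>2 * T +
      2 / \<delta> * (\<delta> * (Am + 2 * L / \<delta> * Am * T) + 2 * ((L / \<delta>)\<^sup>2 * Am) * T))"
  define D where "D = K * (2 * B * sqrt X + X * T) + L / \<delta> * Am * T"
  have Am0: "Am \<ge> 0" by (simp add: Am_def)
  have X0: "X \<ge> 0" unfolding X_def using \<delta> L T Am0 by simp
  have "\<bar>u_tilde \<delta> T K V \<phi>m M N (\<phi>0 M) 0 - u_bar \<delta> T K V \<phi>m M (\<phi>0 M) 0\<bar> \<le> D * (T / real N)"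
    if M: "M \<ge> 1" and N: "N \<ge> 1" and r: "T / real N \<le> r (1 / real M)" for M N :: nat
  proof -
    define h where "h = T / real N"
    have h: "0 < h" "h \<le> T" using T N by (auto simp: h_def divide_le_eq)
    obtain \<alpha>t \<phi>t \<alpha>bar \<phi>r where
      dopt: "optimal_discrete_pair \<delta> T K V \<phi>m M N (\<phi>0 M) 0 \<alpha>t \<phi>t" and
      sopt: "optimal_semidiscrete_control \<delta> T K V \<phi>m M (\<phi>0 M) 0 \<alpha>bar" and
      eu: "euler_state \<delta> T V M N (\<phi>0 M) 0 (\<lambda>n. \<alpha>bar (real n * (T / real N))) \<phi>r" and
      inc: "\<forall>n<N. l2norm (\<lambda>x. deriv (\<phi>t (Suc n)) x - deriv (\<phi>t n) x)
               + l2norm (\<lambda>x. deriv (\<phi>r (Suc n)) x - deriv (\<phi>r n) x) \<le> C * (T / real N)"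
      using assms(8)[OF M N r] by blast
    obtain \<phi> where \<alpha>C: "\<alpha>bar \<in> C_time M 0 T" and
      st: "semidiscrete_state \<delta> T V M (\<phi>0 M) 0 \<alpha>bar \<phi>" and
      co: "semidiscrete_cost T K \<phi>m 0 \<alpha>bar \<phi> = u_bar \<delta> T K V \<phi>m M (\<phi>0 M) 0"
      using sopt by (auto simp: optimal_semidiscrete_control_def)
    obtain d :: nat and e where "(\<forall>i<d. e i \<in> fem_space M) \<and>
        (\<forall>i<d. \<forall>j<d. ip (e i) (e j) = (if i = j then 1 else 0)) \<and>
        (\<forall>u\<in>fem_space M. u = (\<lambda>x. \<Sum>i<d. ip u (e i) * e i x))"
      using fem_orthonormal_basis[OF M] by blast
    then interpret optimal_control M d e \<delta> L V T K \<phi>m "\<phi>0 M" \<alpha>bar \<phi>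
      using M \<delta> T K LL \<phi>m \<alpha>C st co by unfold_locales blast+
    note stat = assms(7)[OF M]
    have \<phi>0M: "\<phi>0 M \<in> fem_space M" using stat by (simp add: discrete_stationary_def)
    have B0: "l2norm (\<lambda>x. \<phi>0 M x - \<phi>m x) \<le> B"
    proof -
      have "l2norm (\<lambda>x. \<phi>0 M x - \<phi>m x) = l2norm (\<lambda>x. \<phi>0 M x + (-1) * \<phi>m x)" by simp
      also have "\<dots> \<le> l2norm (\<phi>0 M) + l2norm (\<lambda>x. (-1) * \<phi>m x)"
        using fem_bdm_M[OF \<phi>0M] \<phi>m by (intro l2norm_triangle bdm_mult bdm_const)
      also have "l2norm (\<lambda>x. (-1) * \<phi>m x) = l2norm \<phi>m" by (simp add: l2norm_def ip_def)
      also have "l2norm (\<phi>0 M) + l2norm \<phi>m \<le> B" using stationary_bound[OF stat] by (simp add: B_def)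
      finally show ?thesis .
    qed
    note vals = stationary_values[OF stat K T, of \<phi>m]
    have "0 \<le> (LINT s:{0..T}|lborel. h_cost (\<alpha>bar s))"
      unfolding set_lebesgue_integral_def h_cost_def by (intro integral_nonneg_AE AE_I2) simp
    then have "g_cost K \<phi>m (\<phi> T) \<le> g_cost K \<phi>m (\<phi>0 M)"
      using vals(1) co by (simp add: semidiscrete_cost_def)
    from l2norm_le_of_g_cost_le[OF K this B0] have B1: "l2norm (\<lambda>x. \<phi> T x - \<phi>m x) \<le> B" .
    have "0 \<le> T / real N * (\<Sum>n=0..<N. h_cost (\<alpha>t n))"
      using T by (intro mult_nonneg_nonneg sum_nonneg) (auto simp: h_cost_def)
    moreover have "discrete_cost T K \<phi>m N 0 \<alpha>t \<phi>t \<le> g_cost K \<phi>m (\<phi>0 M)"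
      using dopt vals(2)[of N] by (simp add: optimal_discrete_pair_def)
    ultimately have "g_cost K \<phi>m (\<phi>t N) \<le> g_cost K \<phi>m (\<phi>0 M)"
      unfolding discrete_cost_def by simp
    from l2norm_le_of_g_cost_le[OF K this B0] have B2: "l2norm (\<lambda>x. \<phi>t N x - \<phi>m x) \<le> B" .
    have Bnn: "B \<ge> 0" using B0 l2norm_nonneg order_trans by blast
    have tfem: "\<phi>t n \<in> fem_space M" "\<phi>r n \<in> fem_space M" if "n \<le> N" for n
      using that dopt eu by (simp_all add: optimal_discrete_pair_def euler_state_def)
    have incr: "stiff (\<lambda>x. \<phi>t (Suc n) x - \<phi>t n x) (\<lambda>x. \<phi>t (Suc n) x - \<phi>t n x) \<le> (C * (T / real N))\<^sup>2"
      "stiff (\<lambda>x. \<phi>r (Suc n) x - \<phi>r n x) (\<lambda>x. \<phi>r (Suc n) x - \<phi>r n x) \<le> (C * (T / real N))\<^sup>2" if n: "n < N" for n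
    proof -
      let ?a = "l2norm (\<lambda>x. deriv (\<phi>t (Suc n)) x - deriv (\<phi>t n) x)"
      let ?b = "l2norm (\<lambda>x. deriv (\<phi>r (Suc n)) x - deriv (\<phi>r n) x)"
      have "?a + ?b \<le> C * (T / real N)" using inc n by blast
      then have "?a \<le> C * (T / real N)" "?b \<le> C * (T / real N)"
        using l2norm_nonneg[of "\<lambda>x. deriv (\<phi>t (Suc n)) x - deriv (\<phi>t n) x"]
          l2norm_nonneg[of "\<lambda>x. deriv (\<phi>r (Suc n)) x - deriv (\<phi>r n) x"] by linarith+
      then have "?a\<^sup>2 \<le> (C * (T / real N))\<^sup>2" "?b\<^sup>2 \<le> (C * (T / real N))\<^sup>2"
        by (auto intro!: power_mono)
      then show "stiff (\<lambda>x. \<phi>t (Suc n) x - \<phi>t n x) (\<lambda>x. \<phi>t (Suc n) x - \<phi>t n x) \<le> (C * (T / real N))\<^sup>2"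
        "stiff (\<lambda>x. \<phi>r (Suc n) x - \<phi>r n x) (\<lambda>x. \<phi>r (Suc n) x - \<phi>r n x) \<le> (C * (T / real N))\<^sup>2"
        using tfem[of n] tfem[of "Suc n"] n
        by (simp_all add: stiff_diff_eq_l2norm[OF M])
    qed
    have "exp (3 * L / \<delta> * T) * ((2 * \<delta> + L / \<delta>) * C\<^sup>2 * T) \<le> X"
      unfolding X_def using \<delta> L T Am0 by (intro mult_left_mono) auto
    from u_bar_le_u_tilde[OF T K N \<phi>0M \<phi>m dopt B2 incr(1) this]
    have low: "u_bar \<delta> T K V \<phi>m M (\<phi>0 M) 0 \<le> u_tilde \<delta> T K V \<phi>m M N (\<phi>0 M) 0 +
        K * (2 * B * (sqrt X * h) + (sqrt X * h)\<^sup>2)" unfolding h_def .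
    from u_tilde_le_u_bar[OF N B1 Am_def eu incr(2) X_def]
    have upp: "u_tilde \<delta> T K V \<phi>m M N (\<phi>0 M) 0 \<le> u_bar \<delta> T K V \<phi>m M (\<phi>0 M) 0 +
        K * (2 * B * (sqrt X * h) + (sqrt X * h)\<^sup>2) + L / \<delta> * Am * T * h" unfolding h_def .
    have "(sqrt X * h)\<^sup>2 \<le> X * T * h"
    proof -
      have "(sqrt X * h)\<^sup>2 = X * (h * h)" using X0 by (simp add: power_mult_distrib power2_eq_square)
      also have "\<dots> \<le> X * (T * h)" using h X0 by (intro mult_left_mono mult_right_mono) auto
      finally show ?thesis by (simp add: mult.assoc)
    qed
    then have "K * (2 * B * (sqrt X * h) + (sqrt X * h)\<^sup>2) \<le> K * (2 * B * (sqrt X * h) + X * T * h)"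
      using K by (intro mult_left_mono add_left_mono) auto
    also have "\<dots> = K * (2 * B * sqrt X + X * T) * h" by (simp add: algebra_simps)
    finally have q: "K * (2 * B * (sqrt X * h) + (sqrt X * h)\<^sup>2) \<le> K * (2 * B * sqrt X + X * T) * h" .
    have p: "0 \<le> L / \<delta> * Am * T * h" using L \<delta> Am0 T h by simp
    have Dh: "D * h = K * (2 * B * sqrt X + X * T) * h + L / \<delta> * Am * T * h"
      by (simp only: D_def distrib_right)
    show ?thesis using low upp q p Dh unfolding h_def[symmetric] abs_le_iff by linarith
  qed
  then show ?thesis by blast
qed

end
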